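(* Let $\mathfrak X$ be a Banach space, $p\in(1,\infty)$, $r\in(0,p]$, and $V\in\mathscr A_p(\mathbb R^n;\mathscr L(\mathfrak X))$. If $f\in L^p(V)$, then $f\in\dot F^0_{p,\infty}(\rho^V_r)$ and $$\|f\|_{\dot F^0_{p,\infty}(\rho^V_r)}\lesssim\|f\|_{L^p(V)}$$ with the implicit positive constant independent of $f$.
   Context: Weights. $f:\mathbb R^n\to\mathfrak X$ is strongly measurable if it is a pointwise limit of simple functions. $V:\mathbb R^n\to\mathscr L(\mathfrak X)$ is a weight if $V(\cdot)\mathfrak e$ and $V(\cdot)^{-1}\mathfrak e$ are strongly measurable for every $\mathfrak e\in\mathfrak X$ and $V(x)$ is invertible for a.e. $x$. It is a $p$-weight if moreover $\mathbf 1_QV(\cdot)\mathfrak e\in L^p(\mathbb R^n;\mathfrak X)$ for all cubes $Q$ and all $\mathfrak e$. $V^{-*}(x):=(V(x)^{-1})^*\in\mathscr L(\mathfrak X^* )$, to which the same notions apply with $\mathfrak X^*$ in place of $\mathfrak X$. $\rho^V_{p,Q}(\mathfrak e):=\big(\frac1{|Q|}\int_Q\|V(x)\mathfrak e\|^p\,dx\big)^{1/p}$, similarly $\rho^{V^{-*}}_{p,Q}(\mathfrak e^* )$; $\rho^*(\mathfrak e^* ):=\sup_{\mathfrak e\ne0}|\langle\mathfrak e^*,\mathfrak e\rangle|/\rho(\mathfrak e)$. For $p\in(1,\infty)$, $p'=p/(p-1)$, $V\in\mathscr A_p(\mathbb R^n;\mathscr L(\mathfrak X))$ means that $V$ is a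 $p$-weight, $V^{-*}$ is a $p'$-weight and there is a finite $C$ with $\rho^{V^{-*}}_{p',Q}(\mathfrak e^* )\le C(\rho^V_{p,Q})^*(\mathfrak e^* )$ for all cubes $Q$ and $\mathfrak e^*\in\mathfrak X^*$. $L^p(V)$ is the space of strongly measurable $f:\mathbb R^n\to\mathfrak X$ with $\|f\|_{L^p(V)}:=\|Vf\|_{L^p(\mathbb R^n;\mathfrak X)}<\infty$. $\mathscr S_\infty$ is the space of Schwartz functions on $\mathbb R^n$ with all moments vanishing; $\mathscr S'_\infty(\mathbb R^n;\mathfrak X)$ is the set of continuous linear maps $\mathscr S_\infty\to\mathfrak X$. A function $f\in L^p(V)$ is regarded as an element of $\mathscr S'_\infty(\mathbb R^n;\mathfrak X)$ through the weak integral $\langle f,\phi\rangle=\int\phi f\in\mathfrak X$, i.e. $\langle\langle f,\phi\rangle,\mathfrak e^*\rangle=\int_{\mathbb R^n}\phi(x)\langle V(x)f(x),V^{-*}(x)\mathfrak e^*\rangle\,dx$ for all $\mathfrak e^*\in\mathfrak X^*$ (the extension by density and continuity of the Bochner integral from boundedly supported simple functions $f$). The convolutions $\varphi_j*f$ are understood accordingly. $\varphi\in\mathscr S(\mathbb R^n)$ is a Littlewood--Paley function if, for some $\sqrt2<\alpha<\beta<\pi$, $c\,\mathbf 1_{[1/\alpha,\alpha]}(|\xi|)\le|\hat\varphi(\xi)|\le C\,\mathbf 1_{[1/\beta,\beta]}(|\xi|)$ for some $c,C>0$ and all $\xi$ (with $\hat\varphi(\xi)=\int\varphi(x)e^{-ix\cdot\xi}dx$);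 $\varphi_j(x):=2^{jn}\varphi(2^jx)$. $\mathscr D_j=\{2^{-j}([0,1)^n+k):k\in\mathbb Z^n\}$. $\dot F^0_{p,\infty}(\rho^V_r)$ is the space of $f\in\mathscr S_\infty'(\mathbb R^n;\mathfrak X)$ with $$\|f\|_{\dot F^0_{p,\infty}(\rho^V_r)}:=\Big\|\sup_{j\in\mathbb Z}\sum_{Q\in\mathscr D_j}\mathbf 1_Q(\cdot)\,\rho^V_{r,Q}\big(\varphi_j*f(\cdot)\big)\Big\|_{L^p(\mathbb R^n)}<\infty,$$ for a fixed Littlewood--Paley function $\varphi$ (different choices give equivalent quasi-norms). *)

theory Defs
  imports "HOL-Analysis.Analysis"
begin

section \<open>Complex Banach spaces and bounded complex-linear operators\<close>

text \<open>The distribution only has real normed spaces. Since Schwartz functions are complex valued and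
  are multiplied with vectors, the Banach spaces here carry a complex scalar multiplication that
  extends the real one.\<close>

class complex_normed_vector = real_normed_vector +
  fixes scaleC :: "complex \<Rightarrow> 'a \<Rightarrow> 'a" (infixr "*\<^sub>C" 75)
  assumes scaleC_add_right: "c *\<^sub>C (x + y) = c *\<^sub>C x + c *\<^sub>C y"
    and scaleC_add_left: "(c + d) *\<^sub>C x = c *\<^sub>C x + d *\<^sub>C x"
    and scaleC_scaleC: "c *\<^sub>C (d *\<^sub>C x) = (c * d) *\<^sub>C x"
    and scaleC_of_real: "of_real r *\<^sub>C x = r *\<^sub>R x"
    and norm_scaleC: "norm (c *\<^sub>C x) = cmod c * norm x"

class complex_banach = complex_normed_vector + banach

instantiation complex :: complex_banach
begin

definition scaleC_complex :: "complex \<Rightarrow> complex \<Rightarrow> complex"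
  where "scaleC_complex c x = c * x"

instance
  by standard (auto simp: scaleC_complex_def algebra_simps norm_mult scaleR_conv_of_real)

end

definition bounded_clinear :: "('a::complex_normed_vector \<Rightarrow> 'b::complex_normed_vector) \<Rightarrow> bool"
  where "bounded_clinear f \<longleftrightarrow> bounded_linear f \<and> (\<forall>c x. f (c *\<^sub>C x) = c *\<^sub>C f x)"

lemma bounded_clinear_scaleC:
  fixes f :: "'a::complex_normed_vector \<Rightarrow> 'b::complex_normed_vector"
  assumes "bounded_clinear f"
  shows "bounded_clinear (\<lambda>x. c *\<^sub>C f x)"
proof -
  interpret f: bounded_linear f
    using assms by (simp add: bounded_clinear_def)
  have comm: "c *\<^sub>C (r *\<^sub>R y) = r *\<^sub>R (c *\<^sub>C y)" for r and y :: 'b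
    by (simp only: scaleC_of_real[symmetric] scaleC_scaleC mult.commute)
  have "bounded_linear (\<lambda>x. c *\<^sub>C f x)"
  proof (rule bounded_linear_intro[where K = "cmod c * onorm f"])
    show "c *\<^sub>C f (x + y) = c *\<^sub>C f x + c *\<^sub>C f y" for x y
      by (simp add: f.add scaleC_add_right)
    show "c *\<^sub>C f (r *\<^sub>R x) = r *\<^sub>R c *\<^sub>C f x" for r x
      by (simp add: f.scaleR comm)
    show "norm (c *\<^sub>C f x) \<le> norm x * (cmod c * onorm f)" for x
      using mult_left_mono[OF onorm[OF f.bounded_linear_axioms, of x] norm_ge_zero[of c]]
      by (simp add: norm_scaleC mult_ac)
  qed
  then show ?thesis
    using assms by (simp add: bounded_clinear_def scaleC_scaleC mult.commute)
qed

typedef (overloaded) ('a, 'b) cblinfun ("(_ \<Rightarrow>\<^sub>C\<^sub>L /_)" [22, 21] 21) =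
  "{f :: 'a::complex_normed_vector \<Rightarrow> 'b::complex_normed_vector. bounded_clinear f}"
  morphisms cblinfun_apply CBlinfun
proof (rule exI[of _ "\<lambda>_. 0"])
  have "c *\<^sub>C (0::'b) = 0" for c
    using norm_scaleC[of c "0::'b"] by simp
  then show "(\<lambda>_. 0) \<in> {f :: 'a \<Rightarrow> 'b. bounded_clinear f}"
    by (simp add: bounded_clinear_def)
qed

declare [[coercion "cblinfun_apply ::
  ('a::complex_normed_vector \<Rightarrow>\<^sub>C\<^sub>L 'b::complex_normed_vector) \<Rightarrow> 'a \<Rightarrow> 'b"]]

setup_lifting type_definition_cblinfun

lemma cblinfun_eqI: "(\<And>x. cblinfun_apply S x = cblinfun_apply T x) \<Longrightarrow> S = T"
  by transfer auto

lemma bounded_clinear_cblinfun_apply: "bounded_clinear (cblinfun_apply T)"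
  by transfer

lemma bounded_linear_cblinfun_apply: "bounded_linear (cblinfun_apply T)"
  using bounded_clinear_cblinfun_apply by (auto simp: bounded_clinear_def)

instantiation cblinfun :: (complex_normed_vector, complex_normed_vector) complex_normed_vector
begin

lift_definition norm_cblinfun :: "'a \<Rightarrow>\<^sub>C\<^sub>L 'b \<Rightarrow> real" is onorm .

lift_definition zero_cblinfun :: "'a \<Rightarrow>\<^sub>C\<^sub>L 'b" is "\<lambda>_. 0"
  using norm_scaleC[of _ "0::'b"] by (simp add: bounded_clinear_def)

lift_definition scaleC_cblinfun :: "complex \<Rightarrow> 'a \<Rightarrow>\<^sub>C\<^sub>L 'b \<Rightarrow> 'a \<Rightarrow>\<^sub>C\<^sub>L 'b"
  is "\<lambda>c f x. c *\<^sub>C f x"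
  by (rule bounded_clinear_scaleC)

definition scaleR_cblinfun :: "real \<Rightarrow> 'a \<Rightarrow>\<^sub>C\<^sub>L 'b \<Rightarrow> 'a \<Rightarrow>\<^sub>C\<^sub>L 'b"
  where "scaleR_cblinfun r T = of_real r *\<^sub>C T"

definition uminus_cblinfun :: "'a \<Rightarrow>\<^sub>C\<^sub>L 'b \<Rightarrow> 'a \<Rightarrow>\<^sub>C\<^sub>L 'b"
  where "uminus_cblinfun T = (- 1) *\<^sub>C T"

lift_definition plus_cblinfun :: "'a \<Rightarrow>\<^sub>C\<^sub>L 'b \<Rightarrow> 'a \<Rightarrow>\<^sub>C\<^sub>L 'b \<Rightarrow> 'a \<Rightarrow>\<^sub>C\<^sub>L 'b"
  is "\<lambda>f g x. f x + g x"
  by (simp add: bounded_clinear_def bounded_linear_add scaleC_add_right)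

definition minus_cblinfun :: "'a \<Rightarrow>\<^sub>C\<^sub>L 'b \<Rightarrow> 'a \<Rightarrow>\<^sub>C\<^sub>L 'b \<Rightarrow> 'a \<Rightarrow>\<^sub>C\<^sub>L 'b"
  where "minus_cblinfun S T = S + - T"

definition dist_cblinfun :: "'a \<Rightarrow>\<^sub>C\<^sub>L 'b \<Rightarrow> 'a \<Rightarrow>\<^sub>C\<^sub>L 'b \<Rightarrow> real"
  where "dist_cblinfun S T = norm (S - T)"

definition sgn_cblinfun :: "'a \<Rightarrow>\<^sub>C\<^sub>L 'b \<Rightarrow> 'a \<Rightarrow>\<^sub>C\<^sub>L 'b"
  where "sgn_cblinfun T = inverse (norm T) *\<^sub>R T"

definition
  "(uniformity :: (('a \<Rightarrow>\<^sub>C\<^sub>L 'b) \<times> ('a \<Rightarrow>\<^sub>C\<^sub>L 'b)) filter) = (INF e\<in>{0<..}. principal {(S, T). dist S T < e})"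

definition open_cblinfun :: "('a \<Rightarrow>\<^sub>C\<^sub>L 'b) set \<Rightarrow> bool"
  where "open_cblinfun U = (\<forall>S\<in>U. \<forall>\<^sub>F (S', T) in uniformity. S' = S \<longrightarrow> T \<in> U)"

instance
proof
  fix S T U :: "'a \<Rightarrow>\<^sub>C\<^sub>L 'b" and c d :: complex and r s :: real
  have one: "1 *\<^sub>C y = y" for y :: 'b
    using scaleC_of_real[of 1 y] by simp
  have neg: "(- 1) *\<^sub>C y = - y" for y :: 'b
    using scaleC_of_real[of "- 1" y] by simp
  have apply_scaleR: "cblinfun_apply (r *\<^sub>R T) x = r *\<^sub>R cblinfun_apply T x" for r and T :: "'a \<Rightarrow>\<^sub>C\<^sub>L 'b" and x
    unfolding scaleR_cblinfun_def by transfer (rule scaleC_of_real)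
  have apply_plus: "cblinfun_apply (S + T) x = cblinfun_apply S x + cblinfun_apply T x" for S T :: "'a \<Rightarrow>\<^sub>C\<^sub>L 'b" and x
    by transfer simp
  have apply_uminus: "cblinfun_apply (- T) x = - cblinfun_apply T x" for T :: "'a \<Rightarrow>\<^sub>C\<^sub>L 'b" and x
    unfolding uminus_cblinfun_def by transfer (rule neg)
  have apply_zero: "cblinfun_apply (0 :: 'a \<Rightarrow>\<^sub>C\<^sub>L 'b) x = 0" for x
    by transfer simp
  show "S + T + U = S + (T + U)" "S + T = T + S" "0 + S = S" "- S + S = 0" "S - T = S + - T"
    by (auto intro!: cblinfun_eqI simp: apply_plus apply_uminus apply_zero minus_cblinfun_def)
  show "r *\<^sub>R (S + T) = r *\<^sub>R S + r *\<^sub>R T" "(r + s) *\<^sub>R S = r *\<^sub>R S + s *\<^sub>R S"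
    "r *\<^sub>R s *\<^sub>R S = (r * s) *\<^sub>R S" "1 *\<^sub>R S = S"
    by (auto intro!: cblinfun_eqI simp: apply_plus apply_scaleR algebra_simps)
  show "dist S T = norm (S - T)" "sgn S = inverse (norm S) *\<^sub>R S"
    "(uniformity :: (('a \<Rightarrow>\<^sub>C\<^sub>L 'b) \<times> ('a \<Rightarrow>\<^sub>C\<^sub>L 'b)) filter) = (INF e\<in>{0<..}. principal {(S, T). dist S T < e})"
    "open V = (\<forall>S\<in>V. \<forall>\<^sub>F (S', T) in uniformity. S' = S \<longrightarrow> T \<in> V)" for V :: "('a \<Rightarrow>\<^sub>C\<^sub>L 'b) set"
    by (simp_all add: dist_cblinfun_def sgn_cblinfun_def uniformity_cblinfun_def open_cblinfun_def)
  have "norm S = 0 \<longleftrightarrow> (\<forall>x. cblinfun_apply S x = 0)"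
    by transfer (simp add: bounded_clinear_def onorm_eq_0)
  then show "(norm S = 0) = (S = 0)"
    by (metis apply_zero cblinfun_eqI)
  show "norm (S + T) \<le> norm S + norm T"
    by transfer (simp add: bounded_clinear_def onorm_triangle)
  show "norm (r *\<^sub>R S) = \<bar>r\<bar> * norm S"
    unfolding scaleR_cblinfun_def
    by transfer (simp add: bounded_clinear_def scaleC_of_real onorm_scaleR)
  show "c *\<^sub>C (S + T) = c *\<^sub>C S + c *\<^sub>C T"
    by transfer (simp add: scaleC_add_right)
  show "(c + d) *\<^sub>C S = c *\<^sub>C S + d *\<^sub>C S"
    by transfer (simp add: scaleC_add_left)
  show "c *\<^sub>C d *\<^sub>C S = (c * d) *\<^sub>C S"
    by transfer (simp add: scaleC_scaleC)
  show "of_real r *\<^sub>C S = r *\<^sub>R S"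
    by (simp add: scaleR_cblinfun_def)
  show "norm (c *\<^sub>C S) = cmod c * norm S"
  proof transfer
    fix c and f :: "'a \<Rightarrow> 'b"
    assume "bounded_clinear f"
    then have "onorm (\<lambda>x. c *\<^sub>C f x) = onorm (\<lambda>x. cmod c *\<^sub>R f x)"
      by (simp add: onorm_def norm_scaleC)
    also have "\<dots> = cmod c * onorm f"
      using \<open>bounded_clinear f\<close> by (simp add: bounded_clinear_def onorm_scaleR)
    finally show "onorm (\<lambda>x. c *\<^sub>C f x) = cmod c * onorm f" .
  qed
qed

end

type_synonym 'a cdual = "'a \<Rightarrow>\<^sub>C\<^sub>L complex"

lift_definition cblinfun_compose ::
  "'b::complex_normed_vector \<Rightarrow>\<^sub>C\<^sub>L 'c::complex_normed_vector \<Rightarrow> 'a::complex_normed_vector \<Rightarrow>\<^sub>C\<^sub>L 'b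
    \<Rightarrow> 'a \<Rightarrow>\<^sub>C\<^sub>L 'c" is "\<lambda>f g x. f (g x)"
  by (auto simp: bounded_clinear_def intro: bounded_linear_compose)

lemma bounded_clinear_compose_right:
  "bounded_clinear (\<lambda>\<phi>::'b::complex_normed_vector \<Rightarrow>\<^sub>C\<^sub>L 'c::complex_normed_vector.
     cblinfun_compose \<phi> (T :: 'a::complex_normed_vector \<Rightarrow>\<^sub>C\<^sub>L 'b))"
proof -
  have add: "cblinfun_compose (\<phi> + \<psi>) T = cblinfun_compose \<phi> T + cblinfun_compose \<psi> T"
    for \<phi> \<psi> :: "'b \<Rightarrow>\<^sub>C\<^sub>L 'c"
    by transfer simp
  have scaleC: "cblinfun_compose (c *\<^sub>C \<phi>) T = c *\<^sub>C cblinfun_compose \<phi> T" for c and \<phi> :: "'b \<Rightarrow>\<^sub>C\<^sub>L 'c"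
    by transfer simp
  have "norm (cblinfun_compose \<phi> T) \<le> norm \<phi> * norm T" for \<phi> :: "'b \<Rightarrow>\<^sub>C\<^sub>L 'c"
    by transfer (auto simp: bounded_clinear_def o_def dest: onorm_compose)
  then have "bounded_linear (\<lambda>\<phi>::'b \<Rightarrow>\<^sub>C\<^sub>L 'c. cblinfun_compose \<phi> T)"
    by (intro bounded_linear_intro[where K = "norm T"] add) (simp_all add: scaleC flip: scaleC_of_real)
  then show ?thesis
    by (simp add: bounded_clinear_def scaleC)
qed

lift_definition cadjoint ::
  "'a::complex_normed_vector \<Rightarrow>\<^sub>C\<^sub>L 'b::complex_normed_vector \<Rightarrow> 'b cdual \<Rightarrow>\<^sub>C\<^sub>L 'a cdual"
  is "\<lambda>(T :: 'a \<Rightarrow>\<^sub>C\<^sub>L 'b) (\<phi> :: 'b cdual). cblinfun_compose \<phi> T"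
  by (rule bounded_clinear_compose_right)

lemma cadjoint_apply: "cadjoint T \<phi> e = \<phi> (T e)"
  by transfer' (simp add: cblinfun_compose.rep_eq)

definition is_cinverse :: "'a::complex_normed_vector \<Rightarrow>\<^sub>C\<^sub>L 'a \<Rightarrow> 'a \<Rightarrow>\<^sub>C\<^sub>L 'a \<Rightarrow> bool"
  where "is_cinverse T S \<longleftrightarrow> (\<forall>e. S (T e) = e) \<and> (\<forall>e. T (S e) = e)"

definition cinvertible :: "'a::complex_normed_vector \<Rightarrow>\<^sub>C\<^sub>L 'a \<Rightarrow> bool"
  where "cinvertible T \<longleftrightarrow> (\<exists>S. is_cinverse T S)"

text \<open>A weight is invertible only almost everywhere; on the exceptional null set the inverse is
  given the value \<open>0\<close>.\<close>

definition cinv :: "'a::complex_normed_vector \<Rightarrow>\<^sub>C\<^sub>L 'a \<Rightarrow> 'a \<Rightarrow>\<^sub>C\<^sub>L 'a"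
  where "cinv T = (if cinvertible T then (THE S. is_cinverse T S) else 0)"


section \<open>Operator weights\<close>

text \<open>The Bochner integral and Borel measurability of the library are tied to second countable
  spaces. The Banach spaces here need not be separable, so strong measurability is spelled out, and
  vector-valued functions are only integrated through their norms or in the weak sense.\<close>

definition strongly_measurable :: "(real^'n \<Rightarrow> 'a::real_normed_vector) \<Rightarrow> bool"
  where "strongly_measurable f \<longleftrightarrow>
    (\<exists>s. (\<forall>k::nat. simple_function lebesgue (s k)) \<and> (\<forall>x. (\<lambda>k. s k x) \<longlonglongrightarrow> f x))"

definition ennpowr :: "ennreal \<Rightarrow> real \<Rightarrow> ennreal"  \<comment> \<open>for positive exponents only\<close>
  where "ennpowr t a = (if t = \<infinity> then \<infinity> else ennreal (enn2real t powr a))"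

definition Lp_norm :: "real \<Rightarrow> (real^'n \<Rightarrow> ennreal) \<Rightarrow> ennreal"
  where "Lp_norm p g = ennpowr (\<integral>\<^sup>+ x. ennpowr (g x) p \<partial>lebesgue) (1 / p)"

definition is_cube :: "(real^'n) set \<Rightarrow> bool"
  where "is_cube Q \<longleftrightarrow> (\<exists>a. \<exists>l>0. Q = {x. \<forall>i. a $ i \<le> x $ i \<and> x $ i < a $ i + l})"

definition weight :: "(real^'n \<Rightarrow> ('a::complex_normed_vector \<Rightarrow>\<^sub>C\<^sub>L 'a)) \<Rightarrow> bool"
  where "weight V \<longleftrightarrow>
    (\<forall>e. strongly_measurable (\<lambda>x. V x e)) \<and>
    (\<forall>e. strongly_measurable (\<lambda>x. cinv (V x) e)) \<and>
    (AE x in lebesgue. cinvertible (V x))"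

definition p_weight :: "real \<Rightarrow> (real^'n \<Rightarrow> ('a::complex_normed_vector \<Rightarrow>\<^sub>C\<^sub>L 'a)) \<Rightarrow> bool"
  where "p_weight p V \<longleftrightarrow> weight V \<and>
    (\<forall>Q e. is_cube Q \<longrightarrow>
      strongly_measurable (\<lambda>x. indicator Q x *\<^sub>R V x e) \<and>
      Lp_norm p (\<lambda>x. ennreal (norm (indicator Q x *\<^sub>R V x e))) < \<infinity>)"

definition dual_weight ::
  "(real^'n \<Rightarrow> ('a::complex_normed_vector \<Rightarrow>\<^sub>C\<^sub>L 'a)) \<Rightarrow> real^'n \<Rightarrow> ('a cdual \<Rightarrow>\<^sub>C\<^sub>L 'a cdual)"
  where "dual_weight V x = cadjoint (cinv (V x))"

definition avg_norm ::
  "(real^'n \<Rightarrow> ('a::complex_normed_vector \<Rightarrow>\<^sub>C\<^sub>L 'a)) \<Rightarrow> real \<Rightarrow> (real^'n) set \<Rightarrow> 'a \<Rightarrow> ennreal"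
  where "avg_norm V p Q e =
    ennpowr ((\<integral>\<^sup>+ x\<in>Q. ennreal (norm (V x e) powr p) \<partial>lebesgue) / emeasure lebesgue Q) (1 / p)"

definition dual_norm :: "('a::complex_normed_vector \<Rightarrow> ennreal) \<Rightarrow> 'a cdual \<Rightarrow> ennreal"
  where "dual_norm \<rho> e' = (SUP e\<in>{e. e \<noteq> 0}. ennreal (cmod (e' e)) / \<rho> e)"

definition Ap_weight :: "real \<Rightarrow> (real^'n \<Rightarrow> ('a::complex_normed_vector \<Rightarrow>\<^sub>C\<^sub>L 'a)) \<Rightarrow> bool"
  where "Ap_weight p V \<longleftrightarrow>
    (let p' = p / (p - 1) in
      p_weight p V \<and> p_weight p' (dual_weight V) \<and>
      (\<exists>C::real. \<forall>Q e'. is_cube Q \<longrightarrow>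
        avg_norm (dual_weight V) p' Q e' \<le> ennreal C * dual_norm (avg_norm V p Q) e'))"

definition wLp_norm ::
  "real \<Rightarrow> (real^'n \<Rightarrow> ('a::complex_normed_vector \<Rightarrow>\<^sub>C\<^sub>L 'a)) \<Rightarrow> (real^'n \<Rightarrow> 'a) \<Rightarrow> ennreal"
  where "wLp_norm p V f = Lp_norm p (\<lambda>x. ennreal (norm (V x (f x))))"

definition wLp_space ::
  "real \<Rightarrow> (real^'n \<Rightarrow> ('a::complex_normed_vector \<Rightarrow>\<^sub>C\<^sub>L 'a)) \<Rightarrow> (real^'n \<Rightarrow> 'a) set"
  where "wLp_space p V = {f. strongly_measurable f \<and> wLp_norm p V f < \<infinity>}"


section \<open>Schwartz functions and vector-valued distributions\<close>

definition partial_deriv :: "'n::finite \<Rightarrow> (real^'n \<Rightarrow> complex) \<Rightarrow> real^'n \<Rightarrow> complex"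
  where "partial_deriv i f x = frechet_derivative f (at x) (axis i 1)"

definition partial_derivs :: "'n::finite list \<Rightarrow> (real^'n \<Rightarrow> complex) \<Rightarrow> real^'n \<Rightarrow> complex"
  where "partial_derivs is = foldr partial_deriv is"

definition monomial :: "('n::finite \<Rightarrow> nat) \<Rightarrow> real^'n \<Rightarrow> real"
  where "monomial \<alpha> x = (\<Prod>i\<in>UNIV. x $ i ^ \<alpha> i)"

definition schwartz :: "(real^'n \<Rightarrow> complex) set"
  where "schwartz = {\<phi>. (\<forall>is x. partial_derivs is \<phi> differentiable at x) \<and>
    (\<forall>\<alpha> is. bounded (range (\<lambda>x. monomial \<alpha> x *\<^sub>R partial_derivs is \<phi> x)))}"

definition schwartz_seminorm :: "('n::finite \<Rightarrow> nat) \<Rightarrow> 'n list \<Rightarrow> (real^'n \<Rightarrow> complex) \<Rightarrow> real"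
  where "schwartz_seminorm \<alpha> is \<phi> = (SUP x. norm (monomial \<alpha> x *\<^sub>R partial_derivs is \<phi> x))"

definition schwartz_topology :: "(real^'n \<Rightarrow> complex) topology"
  where "schwartz_topology = topology_generated_by
    {{\<psi> \<in> schwartz. schwartz_seminorm \<alpha> is (\<lambda>x. \<psi> x - \<phi> x) < \<epsilon>} | \<alpha> is \<phi> \<epsilon>. \<phi> \<in> schwartz \<and> \<epsilon> > 0}"

definition schwartz0 :: "(real^'n \<Rightarrow> complex) set"
  where "schwartz0 = {\<phi> \<in> schwartz. \<forall>\<alpha>. (LINT x|lebesgue. monomial \<alpha> x *\<^sub>R \<phi> x) = 0}"

text \<open>Elements of \<open>S'\<^sub>\<infinity>(\<real>\<^sup>n; X)\<close> are functions on all of \<^typ>\<open>real^'n \<Rightarrow> complex\<close> of which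
  only the restriction to \<open>schwartz0\<close> matters.\<close>

definition distributions0 :: "((real^'n \<Rightarrow> complex) \<Rightarrow> 'a::complex_normed_vector) set"
  where "distributions0 = {F.
    (\<forall>\<phi>\<in>schwartz0. \<forall>\<psi>\<in>schwartz0. F (\<lambda>x. \<phi> x + \<psi> x) = F \<phi> + F \<psi>) \<and>
    (\<forall>c. \<forall>\<phi>\<in>schwartz0. F (\<lambda>x. c * \<phi> x) = c *\<^sub>C F \<phi>) \<and>
    continuous_map (subtopology schwartz_topology schwartz0) euclidean F}"

text \<open>By Hahn--Banach there is at most one weak integral \<open>v\<close>; that it exists for \<open>f\<close> in the
  weighted space is a property of \<open>A\<^sub>p\<close> weights and not part of the definition, so it has to be
  asserted separately wherever \<open>weak_pairing\<close> is used.\<close>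

definition has_weak_integral ::
  "(real^'n \<Rightarrow> ('a::complex_normed_vector \<Rightarrow>\<^sub>C\<^sub>L 'a)) \<Rightarrow> (real^'n \<Rightarrow> 'a) \<Rightarrow> (real^'n \<Rightarrow> complex) \<Rightarrow> 'a \<Rightarrow> bool"
  where "has_weak_integral V f \<phi> v \<longleftrightarrow> (\<forall>e' :: 'a cdual.
    integrable lebesgue (\<lambda>x. \<phi> x * dual_weight V x e' (V x (f x))) \<and>
    e' v = (LINT x|lebesgue. \<phi> x * dual_weight V x e' (V x (f x))))"

definition weak_pairing ::
  "(real^'n \<Rightarrow> ('a::complex_normed_vector \<Rightarrow>\<^sub>C\<^sub>L 'a)) \<Rightarrow> (real^'n \<Rightarrow> 'a) \<Rightarrow> (real^'n \<Rightarrow> complex) \<Rightarrow> 'a"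
  where "weak_pairing V f \<phi> = (THE v. has_weak_integral V f \<phi> v)"


section \<open>The Triebel--Lizorkin norm\<close>

definition fourier :: "(real^'n \<Rightarrow> complex) \<Rightarrow> real^'n \<Rightarrow> complex"
  where "fourier \<phi> \<xi> = (LINT x|lebesgue. \<phi> x * exp (- \<i> * of_real (x \<bullet> \<xi>)))"

definition littlewood_paley :: "(real^'n \<Rightarrow> complex) \<Rightarrow> bool"
  where "littlewood_paley \<phi> \<longleftrightarrow> \<phi> \<in> schwartz \<and>
    (\<exists>\<alpha> \<beta>. sqrt 2 < \<alpha> \<and> \<alpha> < \<beta> \<and> \<beta> < pi \<and>
      (\<exists>c>0. \<exists>C>0. \<forall>\<xi>.
        c * indicator {1 / \<alpha>..\<alpha>} (norm \<xi>) \<le> cmod (fourier \<phi> \<xi>) \<and>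
        cmod (fourier \<phi> \<xi>) \<le> C * indicator {1 / \<beta>..\<beta>} (norm \<xi>)))"

definition dilate :: "(real^'n \<Rightarrow> complex) \<Rightarrow> int \<Rightarrow> real^'n \<Rightarrow> complex"
  where "dilate \<phi> j x = (2 powi (j * int CARD('n))) * \<phi> ((2 powi j) *\<^sub>R x)"

definition dist_conv ::
  "(real^'n \<Rightarrow> complex) \<Rightarrow> ((real^'n \<Rightarrow> complex) \<Rightarrow> 'a) \<Rightarrow> real^'n \<Rightarrow> 'a"
  where "dist_conv \<phi> F x = F (\<lambda>y. \<phi> (x - y))"

definition dyadic_cubes :: "int \<Rightarrow> (real^'n) set set"
  where "dyadic_cubes j =
    {(\<lambda>y. (2 powi (- j)) *\<^sub>R (y + k)) ` {y. \<forall>i. 0 \<le> y $ i \<and> y $ i < 1} | k. \<forall>i. k $ i \<in> \<int>}"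

definition F0_norm :: "(real^'n \<Rightarrow> complex) \<Rightarrow> real \<Rightarrow> real \<Rightarrow>
    (real^'n \<Rightarrow> ('a::complex_normed_vector \<Rightarrow>\<^sub>C\<^sub>L 'a)) \<Rightarrow> ((real^'n \<Rightarrow> complex) \<Rightarrow> 'a) \<Rightarrow> ennreal"
  where "F0_norm \<phi> p r V F = Lp_norm p (\<lambda>x. SUP j::int.
    \<Sum>\<^sub>\<infinity>Q\<in>dyadic_cubes j. indicator Q x * avg_norm V r Q (dist_conv (dilate \<phi> j) F x))"

definition F0_space :: "(real^'n \<Rightarrow> complex) \<Rightarrow> real \<Rightarrow> real \<Rightarrow>
    (real^'n \<Rightarrow> ('a::complex_normed_vector \<Rightarrow>\<^sub>C\<^sub>L 'a)) \<Rightarrow> ((real^'n \<Rightarrow> complex) \<Rightarrow> 'a) set"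
  where "F0_space \<phi> p r V = {F \<in> distributions0. F0_norm \<phi> p r V F < \<infinity>}"

end

theory Submission
  imports Defs
begin

text \<open>Write \<open>g = |Vf|\<close> and, for a functional \<open>e'\<close>, \<open>a = |V\<^sup>-\<^sup>* e'|\<close>, so that the pairing of \<open>e'\<close> with
  the weak integral of \<open>f\<close> against \<open>\<Phi>\<close> is at most \<open>\<integral>|\<Phi>| a g\<close>. The functional is fixed before any
  estimate is made, hence only scalar weights occur: the \<open>A\<^sub>p\<close> condition makes \<open>a\<^sup>p\<^sup>'\<close> an \<open>A\<^sub>\<infinity>\<close> weight with
  constants independent of \<open>e'\<close>. The reverse Hoelder inequality then bounds \<open>\<integral>\<^sub>Q a g\<close> by the \<open>p'\<close>-average of
  \<open>a\<close> and the \<open>q\<close>-average of \<open>g\<close> for some \<open>q < p\<close>. Summation over dilates of a dyadic cube \<open>Q\<close> around \<open>x\<close>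
  gives \<open>|e'(\<phi>\<^sub>j * f(x))| \<le> C \<rho>\<^sup>*\<^sub>Q(e') M(g\<^sup>q)(x)\<^sup>1\<^sup>/\<^sup>q\<close> with the Hardy--Littlewood maximal operator \<open>M\<close>, which
  is bounded on \<open>L\<^sup>p\<^sup>/\<^sup>q\<close>; the Hahn--Banach theorem for the seminorm \<open>\<rho>\<^sub>Q\<close> removes \<open>e'\<close>. The weak integral exists
  because \<open>f\<close> is a limit in \<open>L\<^sup>p(V)\<close> of simple functions and, by Baire's theorem, the dual seminorm of
  each cube is bounded by a multiple of the norm.\<close>

subsection \<open>Powers of extended reals and Hoelder's inequality\<close>

text \<open>In finite dimensions the seminorms of a weight are comparable to norms
  \<open>|A e|\<close> with matrices \<open>A\<close>, with constants depending on the dimension. No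
  such reduction is available here, which is why everything passes through single functionals. The
  functional that norms \<phi>_j * f(x) depends on \<open>x\<close>, \<open>j\<close> and
  \<open>f\<close>; this does no harm, because the bound is pointwise in \<open>x\<close> and its
  constant depends on none of them. For the same reason the supremum over \<open>j\<close> costs
  nothing. The strict inequality \<open>q < p\<close> is essential: Hoelder's inequality with
  exponent \<open>p\<close> would leave M(g^p)^(1/p), and \<open>M\<close> is not bounded on L^1.
  The gain has to come from the weight \<open>a\<close>, since \<open>g\<close> is an arbitrary
  function. Only pairings of \<open>f\<close> with functionals are estimated, so the vector
  representing the integral is constructed as a limit in the Banach space; for this step the
  constants may depend on the cube.\<close>

lemma ennpowr_ennreal: "0 \<le> x \<Longrightarrow> ennpowr (ennreal x) a = ennreal (x powr a)"
  by (simp add: ennpowr_def)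

lemma ennpowr_0 [simp]: "ennpowr 0 a = 0"
  by (simp add: ennpowr_def)

lemma ennpowr_top [simp]: "ennpowr top a = top"
  by (simp add: ennpowr_def)

lemma ennpowr_1 [simp]: "ennpowr t 1 = t"
  by (cases t) (auto simp: ennpowr_def)

lemma ennpowr_eq_0_iff [simp]: "ennpowr t a = 0 \<longleftrightarrow> t = 0"
  by (cases t) (auto simp: ennpowr_def ennreal_eq_0_iff)

lemma ennpowr_eq_top_iff [simp]: "ennpowr t a = top \<longleftrightarrow> t = top"
  by (cases t) (auto simp: ennpowr_def)

lemma ennpowr_less_top_iff [simp]: "ennpowr t a < top \<longleftrightarrow> t < top"
  by (simp flip: less_top)

lemma ennpowr_mono: "s \<le> t \<Longrightarrow> 0 \<le> a \<Longrightarrow> ennpowr s a \<le> ennpowr t a"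
  by (cases s; cases t) (auto simp: ennpowr_ennreal ennreal_leI powr_mono2 top_unique)

lemma ennpowr_ennpowr: "ennpowr (ennpowr t a) b = ennpowr t (a * b)"
  by (cases t) (auto simp: ennpowr_ennreal powr_powr)

text \<open>Both \<open>0\<close> and \<open>top\<close> are fixed by every exponent, also by zero
  and negative ones, so both sides agree under the convention \<open>0 * top = 0\<close>.\<close>

lemma ennpowr_mult: "ennpowr (s * t) a = ennpowr s a * ennpowr t a"
proof (cases s; cases t)
  fix x assume "s = top" "t = ennreal x" "0 \<le> x"
  then show ?thesis
    by (cases "x = 0") (auto simp: ennpowr_ennreal ennreal_top_mult)
next
  fix x assume "t = top" "s = ennreal x" "0 \<le> x"
  then show ?thesis
    by (cases "x = 0") (auto simp: ennpowr_ennreal ennreal_mult_top)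
qed (auto simp: ennpowr_ennreal powr_mult simp flip: ennreal_mult)

lemma ennpowr_add: "ennpowr t (a + b) = ennpowr t a * ennpowr t b"
  by (cases t) (auto simp: ennpowr_ennreal powr_add simp flip: ennreal_mult)

lemma ennpowr_measurable [measurable (raw)]:
  assumes [measurable]: "f \<in> borel_measurable M"
  shows "(\<lambda>x. ennpowr (f x) a) \<in> borel_measurable M"
  unfolding ennpowr_def infinity_ennreal_def by measurable

lemma ennpowr_cancel: "0 < a \<Longrightarrow> ennpowr (ennpowr t a) (1 / a) = t"
  by (simp add: ennpowr_ennpowr)

lemma ennpowr_le_iff: "0 < a \<Longrightarrow> ennpowr s a \<le> ennpowr t a \<longleftrightarrow> s \<le> t"
  using ennpowr_mono[of "ennpowr s a" "ennpowr t a" "1 / a"] ennpowr_mono[of s t a]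
  by (auto simp: ennpowr_cancel)

lemma ennreal_trichotomy: "u = 0 \<or> u = top \<or> (\<exists>x>0. u = ennreal x)" for u :: ennreal
  by (cases u) (auto simp: order_le_less)

section \<open>Young's and Hoelder's inequalities with values in [0, \<infinity>]\<close>

lemma conj_exponent_gt_1:
  fixes p q :: real
  assumes "1 < p" "1 / p + 1 / q = 1"
  shows "1 < q"
proof -
  have "1 / q = 1 - 1 / p" using assms by simp
  then have "0 < 1 / q" "1 / q < 1" using assms(1) by simp_all
  then show ?thesis by (simp add: field_simps split: if_splits)
qed

lemma young_ennreal:
  assumes "1 < p" "1 / p + 1 / q = 1"
  shows "u * v \<le> ennreal (1 / p) * ennpowr u p + ennreal (1 / q) * ennpowr v q"
proof -
  have "1 < q" by (rule conj_exponent_gt_1[OF assms])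
  consider "u = 0" | "v = 0" | "u = top" | "v = top"
    | x y where "u = ennreal x" "v = ennreal y" "0 < x" "0 < y"
    using ennreal_trichotomy[of u] ennreal_trichotomy[of v] by blast
  then show ?thesis
  proof cases
    case 5
    then have "x * y \<le> 1/p * x powr p + 1/q * y powr q"
      using Youngs_inequality[of p q x y] assms \<open>1 < q\<close> by simp
    then show ?thesis using 5 assms \<open>1 < q\<close>
      by (simp add: ennpowr_ennreal flip: ennreal_mult ennreal_plus)
  qed (use assms \<open>1 < q\<close> in \<open>auto simp: ennreal_mult_top\<close>)
qed

lemma Hoelder_nn_integral:
  fixes f g :: "'a \<Rightarrow> ennreal"
  assumes [measurable]: "f \<in> borel_measurable M" "g \<in> borel_measurable M"
    and pq: "1 < p" "1 / p + 1 / q = 1"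
  shows "(\<integral>\<^sup>+x. f x * g x \<partial>M) \<le>
     ennpowr (\<integral>\<^sup>+x. ennpowr (f x) p \<partial>M) (1/p) * ennpowr (\<integral>\<^sup>+x. ennpowr (g x) q \<partial>M) (1/q)"
proof -
  have q: "1 < q" by (rule conj_exponent_gt_1[OF pq])
  let ?F = "\<integral>\<^sup>+x. ennpowr (f x) p \<partial>M" and ?G = "\<integral>\<^sup>+x. ennpowr (g x) q \<partial>M"
  consider "?F = 0" | "?G = 0" | "?F \<noteq> 0" "?G = top" | "?G \<noteq> 0" "?F = top"
    | A B where "?F = ennreal A" "?G = ennreal B" "0 < A" "0 < B"
    using ennreal_trichotomy[of ?F] ennreal_trichotomy[of ?G] by blast
  then show ?thesis
  proof cases
    case 1
    then have "AE x in M. f x = 0"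
      by (subst (asm) nn_integral_0_iff_AE) auto
    then have "(\<integral>\<^sup>+x. f x * g x \<partial>M) = (\<integral>\<^sup>+x. 0 \<partial>M)"
      by (intro nn_integral_cong_AE) auto
    then show ?thesis by simp
  next
    case 2
    then have "AE x in M. g x = 0"
      by (subst (asm) nn_integral_0_iff_AE) auto
    then have "(\<integral>\<^sup>+x. f x * g x \<partial>M) = (\<integral>\<^sup>+x. 0 \<partial>M)"
      by (intro nn_integral_cong_AE) auto
    then show ?thesis by simp
  next
    case 3
    then have "ennpowr ?F (1/p) * ennpowr ?G (1/q) = top"
      by (simp add: ennreal_mult_top)
    then show ?thesis by simp
  next
    case 4
    then have "ennpowr ?F (1/p) * ennpowr ?G (1/q) = top"
      by (simp add: ennreal_top_mult)
    then show ?thesis by simp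
  next
    case 5
    \<comment> \<open>Normalisation: the powers of \<open>\<alpha> * f\<close> and
      \<open>\<beta> * g\<close> have integral 1, so integrating Young's inequality gives the bound
      \<open>1 / p + 1 / q = 1\<close>.\<close>
    define \<alpha> where "\<alpha> = ennreal (A powr (- (1/p)))"
    define \<beta> where "\<beta> = ennreal (B powr (- (1/q)))"
    have 1: "ennpowr (\<alpha> * f x) p = ennreal (1/A) * ennpowr (f x) p" for x
      using 5 pq by (simp add: ennpowr_mult \<alpha>_def ennpowr_ennreal powr_powr powr_minus_divide powr_divide)
    have 2: "ennpowr (\<beta> * g x) q = ennreal (1/B) * ennpowr (g x) q" for x
      using 5 q by (simp add: ennpowr_mult \<beta>_def ennpowr_ennreal powr_powr powr_minus_divide powr_divide)
    have "\<alpha> * \<beta> * (\<integral>\<^sup>+x. f x * g x \<partial>M) = (\<integral>\<^sup>+x. (\<alpha> * f x) * (\<beta> * g x) \<partial>M)"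
      by (simp flip: nn_integral_cmult add: mult_ac)
    also have "\<dots> \<le> (\<integral>\<^sup>+x. ennreal (1 / p) * (ennreal (1/A) * ennpowr (f x) p) +
         ennreal (1 / q) * (ennreal (1/B) * ennpowr (g x) q) \<partial>M)"
      unfolding 1[symmetric] 2[symmetric] by (intro nn_integral_mono young_ennreal pq)
    also have "\<dots> = ennreal (1 / p) * (ennreal (1/A) * ennreal A) +
         ennreal (1 / q) * (ennreal (1/B) * ennreal B)"
      by (simp add: nn_integral_add nn_integral_cmult 5)
    also have "\<dots> = 1" using 5 pq q
      by (simp flip: ennreal_mult ennreal_plus add: ennreal_1[symmetric] del: ennreal_1)
    finally have *: "\<alpha> * \<beta> * (\<integral>\<^sup>+x. f x * g x \<partial>M) \<le> 1" .
    have inv: "ennreal (A powr (1/p)) * ennreal (B powr (1/q)) * (\<alpha> * \<beta>) = 1"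
      using 5 by (simp add: \<alpha>_def \<beta>_def powr_minus_divide flip: ennreal_mult)
    have "(\<integral>\<^sup>+x. f x * g x \<partial>M) = ennreal (A powr (1/p)) * ennreal (B powr (1/q)) *
       (\<alpha> * \<beta> * (\<integral>\<^sup>+x. f x * g x \<partial>M))"
      using inv by (metis mult.assoc mult_1)
    also have "\<dots> \<le> ennreal (A powr (1/p)) * ennreal (B powr (1/q)) * 1"
      by (intro mult_left_mono *) auto
    finally show ?thesis using 5 by (simp add: ennpowr_ennreal)
  qed
qed

text \<open>Hoelder for the counting measure. The roots sit on the summands because the dyadic
  induction produces terms that are already roots of integrals and energies.\<close>

lemma Hoelder_sum:
  fixes f g :: "'a \<Rightarrow> ennreal"
  assumes "finite A" and pq: "1 < p" "1 / p + 1 / q = 1"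
  shows "(\<Sum>x\<in>A. ennpowr (f x) (1/p) * ennpowr (g x) (1/q)) \<le>
     ennpowr (\<Sum>x\<in>A. f x) (1/p) * ennpowr (\<Sum>x\<in>A. g x) (1/q)"
proof -
  have "1 < q" by (rule conj_exponent_gt_1[OF pq])
  then show ?thesis
  using Hoelder_nn_integral[of "\<lambda>x. ennpowr (f x) (1/p)" "count_space A" "\<lambda>x. ennpowr (g x) (1/q)" p q] assms
  by (simp add: nn_integral_count_space_finite ennpowr_ennpowr)
qed

subsection \<open>The Hardy--Littlewood maximal operator\<close>

text \<open>Dividing by the power of the radius instead of the volume of the ball rescales the usual
  operator by \<open>unit_ball_vol\<close>.\<close>

definition hl_max :: "('a::euclidean_space \<Rightarrow> ennreal) \<Rightarrow> 'a \<Rightarrow> ennreal"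
  where "hl_max h x = (SUP r\<in>{0<..}. (\<integral>\<^sup>+y\<in>ball x r. h y \<partial>lborel) / ennreal (r ^ DIM('a)))"

lemma less_divide_ennreal_iff:
  fixes t :: real and I :: ennreal
  assumes "0 < c" "0 \<le> t"
  shows "ennreal t < I / ennreal c \<longleftrightarrow> ennreal (t * c) < I"
proof -
  have "I / ennreal c \<le> ennreal t \<longleftrightarrow> I \<le> ennreal (t * c)"
  proof
    assume "I / ennreal c \<le> ennreal t"
    then have "I / ennreal c * ennreal c \<le> ennreal t * ennreal c" by (rule mult_right_mono) simp
    moreover have "I / ennreal c * ennreal c = I"
      using assms by (simp add: ennreal_divide_times ennreal_times_divide mult_divide_eq_ennreal)
    ultimately show "I \<le> ennreal (t * c)" using assms by (simp add: ennreal_mult)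
  next
    assume "I \<le> ennreal (t * c)"
    then show "I / ennreal c \<le> ennreal t"
      using assms by (intro divide_le_posI_ennreal) (auto simp: ennreal_mult mult.commute)
  qed
  then show ?thesis by (simp add: not_le[symmetric])
qed

lemma less_hl_max_iff:
  fixes h :: "'a::euclidean_space \<Rightarrow> ennreal"
  assumes "0 \<le> t"
  shows "ennreal t < hl_max h x \<longleftrightarrow>
    (\<exists>r>0. ennreal (t * r ^ DIM('a)) < (\<integral>\<^sup>+y\<in>ball x r. h y \<partial>lborel))"
proof -
  have "ennreal t < hl_max h x \<longleftrightarrow>
    (\<exists>r\<in>{0<..}. ennreal t < (\<integral>\<^sup>+y\<in>ball x r. h y \<partial>lborel) / ennreal (r ^ DIM('a)))"
    unfolding hl_max_def by (rule less_SUP_iff)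
  also have "\<dots> \<longleftrightarrow> (\<exists>r>0. ennreal (t * r ^ DIM('a)) < (\<integral>\<^sup>+y\<in>ball x r. h y \<partial>lborel))"
    using assms by (auto simp: less_divide_ennreal_iff)
  finally show ?thesis .
qed

text \<open>Lower semicontinuity, the source of measurability: the strict inequality at radius
  \<open>r\<close> survives a slightly larger radius \<open>r + d\<close> in the power, and
  \<open>ball z (r + d)\<close> contains \<open>ball x r\<close> for all \<open>z\<close> near
  \<open>x\<close>.\<close>

lemma open_hl_max_greater:
  fixes h :: "'a::euclidean_space \<Rightarrow> ennreal"
  assumes "0 \<le> t"
  shows "open {x. ennreal t < hl_max h x}"
proof (unfold open_dist, intro ballI)
  fix x assume "x \<in> {x. ennreal t < hl_max h x}"
  then obtain r where r: "r > 0" "ennreal (t * r ^ DIM('a)) < (\<integral>\<^sup>+y\<in>ball x r. h y \<partial>lborel)"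
    using assms by (auto simp: less_hl_max_iff)
  have "((\<lambda>d. ennreal (t * (r + d) ^ DIM('a))) \<longlongrightarrow> ennreal (t * (r + 0) ^ DIM('a))) (at_right 0)"
    by (intro tendsto_intros)
  then have "\<forall>\<^sub>F d in at_right 0. ennreal (t * (r + d) ^ DIM('a)) < (\<integral>\<^sup>+y\<in>ball x r. h y \<partial>lborel)"
    using r by (intro order_tendstoD) auto
  then obtain d where d: "d > 0" "ennreal (t * (r + d) ^ DIM('a)) < (\<integral>\<^sup>+y\<in>ball x r. h y \<partial>lborel)"
    using eventually_happens'[OF trivial_limit_at_right_real eventually_conj[OF eventually_at_right_less]] by blast
  have "ennreal t < hl_max h z" if "dist z x < d" for z
  proof -
    have "(\<integral>\<^sup>+y\<in>ball x r. h y \<partial>lborel) \<le> (\<integral>\<^sup>+y\<in>ball z (r + d). h y \<partial>lborel)"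
    proof (intro nn_integral_mono mult_left_mono)
      have "ball x r \<subseteq> ball z (r + d)"
      proof
        fix w assume "w \<in> ball x r"
        then show "w \<in> ball z (r + d)" using that dist_triangle[of z w x] by simp
      qed
      then show "indicator (ball x r) y \<le> (indicator (ball z (r + d)) y :: ennreal)" for y
        by (auto split: split_indicator)
    qed auto
    then have "ennreal (t * (r + d) ^ DIM('a)) < (\<integral>\<^sup>+y\<in>ball z (r + d). h y \<partial>lborel)"
      by (rule less_le_trans[OF d(2)])
    moreover have "r + d > 0" using r d by simp
    ultimately show ?thesis using assms less_hl_max_iff by blast
  qed
  then show "\<exists>e>0. \<forall>y. dist y x < e \<longrightarrow> y \<in> {x. ennreal t < hl_max h x}"
    using d(1) by blast
qed

lemma hl_max_borel_measurable [measurable]: "hl_max h \<in> borel_measurable borel"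
proof (rule borel_measurableI_greater)
  fix y :: ennreal
  have "{x. y < hl_max h x} \<in> sets borel"
  proof (cases y)
    case (real t)
    then show ?thesis using open_hl_max_greater[of t h] by (simp add: borel_open)
  qed simp
  then show "{x \<in> space borel. y < hl_max h x} \<in> sets borel" by simp
qed

text \<open>The sum is written as an integral over a counting measure, so that the countable family
  selected by the covering lemma need not be enumerated.\<close>

lemma emeasure_UN_countable_le:
  assumes sets: "\<And>i. i \<in> I \<Longrightarrow> X i \<in> sets M" and I: "countable I"
  shows "emeasure M (\<Union>i\<in>I. X i) \<le> (\<integral>\<^sup>+i. emeasure M (X i) \<partial>count_space I)"
proof -
  have "emeasure M (\<Union>i\<in>I. X i) = (\<integral>\<^sup>+x. indicator (\<Union>i\<in>I. X i) x \<partial>M)"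
    using assms by (intro nn_integral_indicator[symmetric] sets.countable_UN'') auto
  also have "\<dots> \<le> (\<integral>\<^sup>+x. (\<integral>\<^sup>+i. indicator (X i) x \<partial>count_space I) \<partial>M)"
  proof (intro nn_integral_mono)
    fix x
    show "indicator (\<Union>i\<in>I. X i) x \<le> (\<integral>\<^sup>+i. indicator (X i) x \<partial>count_space I)"
    proof (cases "x \<in> (\<Union>i\<in>I. X i)")
      case True
      then obtain i where i: "i \<in> I" "x \<in> X i" by auto
      have "1 = (\<integral>\<^sup>+j. indicator {i} j \<partial>count_space I)"
        using i by (simp add: nn_integral_indicator_singleton' emeasure_count_space)
      also have "\<dots> \<le> (\<integral>\<^sup>+j. indicator (X j) x \<partial>count_space I)"
        using i by (intro nn_integral_mono) (auto split: split_indicator)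
      finally show ?thesis using True by simp
    qed simp
  qed
  also have "\<dots> = (\<integral>\<^sup>+i. (\<integral>\<^sup>+x. indicator (X i) x \<partial>M) \<partial>count_space I)"
    using assms by (intro nn_integral_count_space_nn_integral) auto
  also have "\<dots> = (\<integral>\<^sup>+i. emeasure M (X i) \<partial>count_space I)"
    using assms by (intro nn_integral_cong) auto
  finally show ?thesis .
qed

text \<open>Each point of the level set is the centre of a ball with mass above
  \<open>t * r ^ n\<close>. By Vitali's lemma a disjoint subfamily, enlarged five times, covers the
  set; this is the origin of \<open>5 ^ DIM('a)\<close>.\<close>

lemma hl_max_weak_type:
  fixes h :: "'a::euclidean_space \<Rightarrow> ennreal"
  assumes [measurable]: "h \<in> borel_measurable borel" and t: "0 < t"
  shows "ennreal t * emeasure lborel {x. ennreal t < hl_max h x} \<le>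
    ennreal (unit_ball_vol DIM('a) * 5 ^ DIM('a)) * (\<integral>\<^sup>+x. h x \<partial>lborel)"
proof (cases "(\<integral>\<^sup>+x. h x \<partial>lborel) = top")
  case True
  then show ?thesis using unit_ball_vol_pos[of "DIM('a)"]
    by (simp add: ennreal_mult_top less_imp_neq[symmetric])
next
  case False
  then obtain I where I: "(\<integral>\<^sup>+x. h x \<partial>lborel) = ennreal I" "0 \<le> I" by (cases "\<integral>\<^sup>+x. h x \<partial>lborel") auto
  let ?n = "DIM('a)"
  let ?U = "{x. ennreal t < hl_max h x}"
  have "\<forall>x\<in>?U. \<exists>r. r > 0 \<and> ennreal (t * r ^ ?n) < (\<integral>\<^sup>+y\<in>ball x r. h y \<partial>lborel)"
    using less_hl_max_iff[of t h] t by simp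
  then obtain r where "\<forall>x\<in>?U. r x > 0 \<and> ennreal (t * r x ^ ?n) < (\<integral>\<^sup>+y\<in>ball x (r x). h y \<partial>lborel)"
    by (rule bchoice[THEN exE])
  then have r: "r x > 0 \<and> ennreal (t * r x ^ ?n) < (\<integral>\<^sup>+y\<in>ball x (r x). h y \<partial>lborel)" if "x \<in> ?U" for x
    using that by blast
  \<comment> \<open>Finite total mass bounds the radii, which the covering lemma demands; hence the
    separate case of an infinite integral.\<close>
  have "r x ^ ?n < I / t" if "x \<in> ?U" for x
  proof -
    have "ennreal (t * r x ^ ?n) < (\<integral>\<^sup>+y\<in>ball x (r x). h y \<partial>lborel)"
      using r[OF that] by simp
    also have "\<dots> \<le> ennreal I"
      unfolding I(1)[symmetric] by (intro nn_integral_mono) (auto split: split_indicator)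
    finally show ?thesis using t r[OF that] by (simp add: ennreal_less_iff field_simps)
  qed
  then have root_le: "root ?n (r x ^ ?n) \<le> root ?n (I / t)" if "x \<in> ?U" for x
    using that by (simp add: less_imp_le)
  then have bd: "0 < r x \<and> r x \<le> root ?n (I / t)" if "x \<in> ?U" for x
  proof -
    have "root ?n (r x ^ ?n) = r x"
      using r[OF that] by (intro real_root_power_cancel) auto
    then show ?thesis using root_le[OF that] r[OF that] by simp
  qed
  have "?U \<subseteq> (\<Union>i\<in>?U. ball i (r i))" using r by fastforce
  then obtain C where C: "countable C" "C \<subseteq> ?U"
     and dis: "pairwise (\<lambda>i j. disjnt (ball i (r i)) (ball j (r j))) C"
     and cov: "?U \<subseteq> (\<Union>i\<in>C. ball i (5 * r i))"
    by (rule Vitali_covering_lemma_balls[where r = r, OF _ bd])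
  let ?k = "unit_ball_vol ?n * 5 ^ ?n"
  have k0: "0 \<le> ?k" by simp
  have "ennreal t * emeasure lborel ?U \<le> ennreal t * emeasure lborel (\<Union>i\<in>C. ball i (5 * r i))"
    using cov C by (intro mult_left_mono emeasure_mono) auto
  also have "\<dots> \<le> ennreal t * (\<integral>\<^sup>+i. emeasure lborel (ball i (5 * r i)) \<partial>count_space C)"
    using C by (intro mult_left_mono emeasure_UN_countable_le) auto
  also have "\<dots> = (\<integral>\<^sup>+i. ennreal t * emeasure lborel (ball i (5 * r i)) \<partial>count_space C)"
    by (simp add: nn_integral_cmult)
  also have "\<dots> \<le> (\<integral>\<^sup>+i. ennreal ?k * (\<integral>\<^sup>+y\<in>ball i (r i). h y \<partial>lborel) \<partial>count_space C)"
  proof (intro nn_integral_mono)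
    fix i assume "i \<in> space (count_space C)"
    then have i: "r i > 0" "ennreal (t * r i ^ ?n) < (\<integral>\<^sup>+y\<in>ball i (r i). h y \<partial>lborel)" using C r by auto
    have "ennreal t * emeasure lborel (ball i (5 * r i)) = ennreal ?k * ennreal (t * r i ^ ?n)"
      using i t by (simp add: emeasure_ball power_mult_distrib mult_ac flip: ennreal_mult)
    also have "\<dots> \<le> ennreal ?k * (\<integral>\<^sup>+y\<in>ball i (r i). h y \<partial>lborel)"
      using i by (intro mult_left_mono) auto
    finally show "ennreal t * emeasure lborel (ball i (5 * r i)) \<le> \<dots>" .
  qed
  also have "\<dots> = ennreal ?k * (\<integral>\<^sup>+i. (\<integral>\<^sup>+y\<in>ball i (r i). h y \<partial>lborel) \<partial>count_space C)"
    by (simp add: nn_integral_cmult)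
  also have "(\<integral>\<^sup>+i. (\<integral>\<^sup>+y\<in>ball i (r i). h y \<partial>lborel) \<partial>count_space C) =
     (\<integral>\<^sup>+i. emeasure (density lborel h) (ball i (r i)) \<partial>count_space C)"
    by (intro nn_integral_cong) (simp add: emeasure_density)
  also have "\<dots> = emeasure (density lborel h) (\<Union>i\<in>C. ball i (r i))"
    using C dis by (intro emeasure_UN_countable[symmetric])
      (auto simp: pairwise_def disjnt_def disjoint_family_on_def)
  also have "\<dots> = (\<integral>\<^sup>+y\<in>(\<Union>i\<in>C. ball i (r i)). h y \<partial>lborel)"
    using C by (intro emeasure_density) auto
  also have "\<dots> \<le> (\<integral>\<^sup>+y. h y \<partial>lborel)"
    by (intro nn_integral_mono) (auto split: split_indicator)
  finally show ?thesis by (simp add: mult_left_mono)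
qed

text \<open>Where \<open>h \<le> t\<close>, the function contributes at most \<open>t\<close> times
  the volume of the ball to each average. This is the bounded endpoint of the interpolation between
  L^1 and L^\<infinity>.\<close>

lemma hl_max_truncate:
  fixes h :: "'a::euclidean_space \<Rightarrow> ennreal"
  assumes [measurable]: "h \<in> borel_measurable borel" and t: "0 \<le> t"
  shows "hl_max h x \<le> hl_max (\<lambda>x. h x * indicator {x. ennreal t < h x} x) x +
    ennreal (unit_ball_vol DIM('a) * t)"
  unfolding hl_max_def
proof (rule SUP_least)
  fix r :: real assume "r \<in> {0<..}"
  then have r: "r > 0" by simp
  let ?k = "\<lambda>x. h x * indicator {x. ennreal t < h x} x" and ?n = "DIM('a)"
  have "{x \<in> space borel. ennreal t < h x} \<in> sets borel" by measurable
  then have [measurable]: "{x. ennreal t < h x} \<in> sets borel" by simp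
  have [measurable]: "ball x r \<in> sets borel" by simp
  have "(\<integral>\<^sup>+y\<in>ball x r. h y \<partial>lborel) \<le> (\<integral>\<^sup>+y. ?k y * indicator (ball x r) y + ennreal t * indicator (ball x r) y \<partial>lborel)"
    by (intro nn_integral_mono) (auto split: split_indicator)
  also have "\<dots> = (\<integral>\<^sup>+y\<in>ball x r. ?k y \<partial>lborel) + ennreal t * emeasure lborel (ball x r)"
    by (subst nn_integral_add) (measurable, simp add: nn_integral_cmult_indicator)
  also have "ennreal t * emeasure lborel (ball x r) = ennreal (unit_ball_vol ?n * t) * ennreal (r ^ ?n)"
    using r t by (simp add: emeasure_ball mult_ac flip: ennreal_mult)
  finally have "(\<integral>\<^sup>+y\<in>ball x r. h y \<partial>lborel) / ennreal (r ^ ?n) \<le>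
    ((\<integral>\<^sup>+y\<in>ball x r. ?k y \<partial>lborel) + ennreal (unit_ball_vol ?n * t) * ennreal (r ^ ?n)) / ennreal (r ^ ?n)"
    by (rule divide_right_mono_ennreal)
  also have "\<dots> = (\<integral>\<^sup>+y\<in>ball x r. ?k y \<partial>lborel) / ennreal (r ^ ?n) + ennreal (unit_ball_vol ?n * t)"
    using r by (simp add: add_divide_distrib_ennreal mult_divide_eq_ennreal)
  also have "\<dots> \<le> (SUP r\<in>{0<..}. (\<integral>\<^sup>+y\<in>ball x r. ?k y \<partial>lborel) / ennreal (r ^ ?n)) + ennreal (unit_ball_vol ?n * t)"
    using r by (intro add_right_mono SUP_upper) auto
  finally show "(\<integral>\<^sup>+y\<in>ball x r. h y \<partial>lborel) / ennreal (r ^ ?n) \<le> \<dots>" .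
qed

section \<open>Layer-cake formulas and the strong type bound\<close>

lemma nn_integral_layer:
  fixes u :: ennreal
  assumes a: "-1 < a"
  shows "(\<integral>\<^sup>+t. ennreal (t powr a) * indicator {t. 0 < t \<and> ennreal t < u} t \<partial>lborel)
    = ennreal (1 / (a + 1)) * ennpowr u (a + 1)"
proof -
  have fin: "(\<integral>\<^sup>+t. ennreal (t powr a) * indicator {t. 0 < t \<and> ennreal t < ennreal c} t \<partial>lborel)
    = ennreal (1 / (a + 1) * c powr (a + 1))" if c: "0 \<le> c" for c
  proof -
    have "(\<integral>\<^sup>+t. ennreal (t powr a * indicator {0..c} t) \<partial>lborel) = ennreal (c powr (a + 1) / (a + 1))"
    proof (rule nn_integral_has_integral_lborel)
      show "((\<lambda>t. t powr a * indicator {0..c} t) has_integral c powr (a + 1) / (a + 1)) UNIV"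
        using has_integral_powr_from_0[OF a c] has_integral_restrict_UNIV[of "{0..c}" "\<lambda>t. t powr a"]
        by (simp add: indicator_def of_bool_def if_distrib cong: if_cong)
    qed auto
    moreover have "AE t in lborel. t \<noteq> 0" "AE t in lborel. t \<noteq> c"
      by (simp_all add: AE_lborel_singleton)
    then have "AE t in lborel. ennreal (t powr a) * indicator {t. 0 < t \<and> ennreal t < ennreal c} t
      = ennreal (t powr a * indicator {0..c} t)"
      by eventually_elim (use c in \<open>auto simp: indicator_def ennreal_less_iff\<close>)
    then have "(\<integral>\<^sup>+t. ennreal (t powr a) * indicator {t. 0 < t \<and> ennreal t < ennreal c} t \<partial>lborel) =
      (\<integral>\<^sup>+t. ennreal (t powr a * indicator {0..c} t) \<partial>lborel)"
      by (rule nn_integral_cong_AE)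
    ultimately show ?thesis by simp
  qed
  show ?thesis
  proof (cases u)
    case (real c)
    then show ?thesis using fin[of c] a by (simp add: ennpowr_ennreal flip: ennreal_mult)
  next
    case top
    let ?J = "\<integral>\<^sup>+t. ennreal (t powr a) * indicator {t. 0 < t \<and> ennreal t < top} t \<partial>lborel"
    have "ennreal x \<le> ?J" if "0 \<le> x" for x
    proof -
      \<comment> \<open>Chosen so that the layer integral up to \<open>c\<close> equals
        \<open>x\<close>; thus the integral for \<open>u = top\<close> dominates every real
        number.\<close>
      define c where "c = ((a + 1) * x) powr (1 / (a + 1))"
      have "ennreal x = ennreal (1 / (a + 1) * c powr (a + 1))"
        using a that by (simp add: c_def powr_powr)
      also have "\<dots> = (\<integral>\<^sup>+t. ennreal (t powr a) * indicator {t. 0 < t \<and> ennreal t < ennreal c} t \<partial>lborel)"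
        by (rule fin[symmetric]) (simp add: c_def)
      also have "\<dots> \<le> ?J"
        by (intro nn_integral_mono mult_left_mono) (auto split: split_indicator)
      finally show ?thesis .
    qed
    then have J: "ennreal x \<le> ?J" if "0 \<le> x" for x
      using that by blast
    have "?J = top"
    proof (cases ?J)
      case (real J)
      then have "ennreal (J + 1) \<le> ennreal J" using J[of "J + 1"] by simp
      then show ?thesis using real by simp
    qed
    then show ?thesis using top a by (simp add: ennreal_mult_top)
  qed
qed

text \<open>The weight \<open>h\<close> serves both ends of the interpolation: weight 1 expresses
  the norm of the maximal function through its level sets, and \<open>F = h\<close> sums the
  truncated masses back to the norm of \<open>h\<close>.\<close>

lemma nn_integral_layer_cake:
  fixes F :: "'a::euclidean_space \<Rightarrow> ennreal"
  assumes [measurable]: "F \<in> borel_measurable borel" "h \<in> borel_measurable borel" and a: "-1 < a"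
  shows "(\<integral>\<^sup>+x. h x * ennpowr (F x) (a + 1) \<partial>lborel) = ennreal (a + 1) *
    (\<integral>\<^sup>+t. ennreal (t powr a) * indicator {0<..} t * (\<integral>\<^sup>+x. h x * indicator {x. ennreal t < F x} x \<partial>lborel) \<partial>lborel)"
proof -
  let ?G = "\<lambda>x t. h x * (ennreal (t powr a) * indicator {t. 0 < t \<and> ennreal t < F x} t)"
  have "(\<integral>\<^sup>+t. ennreal (t powr a) * indicator {0<..} t * (\<integral>\<^sup>+x. h x * indicator {x. ennreal t < F x} x \<partial>lborel) \<partial>lborel)
    = (\<integral>\<^sup>+t. (\<integral>\<^sup>+x. ?G x t \<partial>lborel) \<partial>lborel)"
    by (intro nn_integral_cong, subst nn_integral_cmult[symmetric])
       (auto intro!: nn_integral_cong split: split_indicator simp: mult.commute)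
  also have "\<dots> = (\<integral>\<^sup>+x. (\<integral>\<^sup>+t. ?G x t \<partial>lborel) \<partial>lborel)"
    by (rule lborel_pair.Fubini') measurable
  also have "\<dots> = (\<integral>\<^sup>+x. h x * (ennreal (1 / (a + 1)) * ennpowr (F x) (a + 1)) \<partial>lborel)"
    by (intro nn_integral_cong) (simp add: nn_integral_cmult nn_integral_layer[OF a])
  also have "\<dots> = ennreal (1 / (a + 1)) * (\<integral>\<^sup>+x. h x * ennpowr (F x) (a + 1) \<partial>lborel)"
    by (simp add: nn_integral_cmult[symmetric] mult_ac)
  finally show ?thesis
    using a by (simp flip: mult.assoc ennreal_mult)
qed

lemma hl_max_strong_type:
  assumes s: "1 < s"
  obtains C :: real where "0 \<le> C" "\<And>h :: 'a::euclidean_space \<Rightarrow> ennreal. h \<in> borel_measurable borel \<Longrightarrow>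
    (\<integral>\<^sup>+x. ennpowr (hl_max h x) s \<partial>lborel) \<le> ennreal C * (\<integral>\<^sup>+x. ennpowr (h x) s \<partial>lborel)"
proof -
  let ?n = "DIM('a)"
  define \<kappa> where "\<kappa> = unit_ball_vol ?n"
  have \<kappa>: "\<kappa> > 0" by (simp add: \<kappa>_def unit_ball_vol_pos)
  define C where "C = (2 * \<kappa>) powr s * (s * (5 ^ ?n * (1 / (s - 1))))"
  have "(\<integral>\<^sup>+x. ennpowr (hl_max h x) s \<partial>lborel) \<le> ennreal C * (\<integral>\<^sup>+x. ennpowr (h x) s \<partial>lborel)"
    if [measurable]: "h \<in> borel_measurable borel" for h :: "'a \<Rightarrow> ennreal"
  proof -
    \<comment> \<open>Where \<open>F\<close> exceeds \<open>t\<close> the maximal function exceeds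
      \<open>2 * \<kappa> * t\<close>. Truncation at height \<open>t\<close> costs at most
      \<open>\<kappa> * t\<close>, so more than \<open>\<kappa> * t\<close> is left for the
      truncated function.\<close>
    define F where "F x = ennreal (1 / (2 * \<kappa>)) * hl_max h x" for x
    have [measurable]: "F \<in> borel_measurable borel" unfolding F_def by measurable
    have hF: "hl_max h x = ennreal (2 * \<kappa>) * F x" for x
      using \<kappa> by (simp add: F_def flip: mult.assoc ennreal_mult)
    have level: "emeasure lborel {x. ennreal t < F x} \<le>
        ennreal (5 ^ ?n / t) * (\<integral>\<^sup>+x. h x * indicator {x. ennreal t < h x} x \<partial>lborel)" if t: "t > 0" for t
    proof -
      let ?k = "\<lambda>x. h x * indicator {x. ennreal t < h x} x"
      have "{x. ennreal t < F x} \<subseteq> {x. ennreal (\<kappa> * t) < hl_max ?k x}"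
      proof safe
        fix x assume "ennreal t < F x"
        show "ennreal (\<kappa> * t) < hl_max ?k x"
        proof (rule ccontr)
          assume "\<not> ennreal (\<kappa> * t) < hl_max ?k x"
          then have "hl_max h x \<le> ennreal (\<kappa> * t) + ennreal (\<kappa> * t)"
            using hl_max_truncate[of h t x] t unfolding \<kappa>_def[symmetric]
            by (intro order_trans[OF hl_max_truncate[of h t x, folded \<kappa>_def]] add_right_mono) auto
          then have "F x \<le> ennreal (1 / (2 * \<kappa>)) * ennreal (2 * \<kappa> * t)"
            unfolding F_def using \<kappa> t by (intro mult_left_mono) (auto simp: mult.assoc simp flip: ennreal_plus)
          also have "\<dots> = ennreal t" using \<kappa> t by (simp flip: ennreal_mult)
          finally show False using \<open>ennreal t < F x\<close> by simp
        qed
      qed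
      then have "emeasure lborel {x. ennreal t < F x} \<le> emeasure lborel {x. ennreal (\<kappa> * t) < hl_max ?k x}"
        by (intro emeasure_mono) auto
      also have "\<dots> = ennreal (1 / (\<kappa> * t)) * (ennreal (\<kappa> * t) * emeasure lborel {x. ennreal (\<kappa> * t) < hl_max ?k x})"
        using \<kappa> t by (simp flip: mult.assoc ennreal_mult)
      also have "\<dots> \<le> ennreal (1 / (\<kappa> * t)) * (ennreal (\<kappa> * 5 ^ ?n) * (\<integral>\<^sup>+x. ?k x \<partial>lborel))"
        using \<kappa> t unfolding \<kappa>_def by (intro mult_left_mono hl_max_weak_type) auto
      also have "\<dots> = ennreal (5 ^ ?n / t) * (\<integral>\<^sup>+x. ?k x \<partial>lborel)"
        using \<kappa> t by (simp flip: mult.assoc ennreal_mult)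
      finally show ?thesis .
    qed
    have "(\<integral>\<^sup>+x. ennpowr (F x) s \<partial>lborel) = ennreal s *
       (\<integral>\<^sup>+t. ennreal (t powr (s - 1)) * indicator {0<..} t * emeasure lborel {x. ennreal t < F x} \<partial>lborel)"
      using nn_integral_layer_cake[of F "\<lambda>_. 1" "s - 1"] s by simp
    also have "\<dots> \<le> ennreal s * (\<integral>\<^sup>+t. ennreal (5 ^ ?n) * (ennreal (t powr (s - 2)) * indicator {0<..} t *
         (\<integral>\<^sup>+x. h x * indicator {x. ennreal t < h x} x \<partial>lborel)) \<partial>lborel)"
    proof (intro mult_left_mono nn_integral_mono)
      fix t :: real
      let ?H = "\<integral>\<^sup>+x. h x * indicator {x. ennreal t < h x} x \<partial>lborel"
      show "ennreal (t powr (s - 1)) * indicator {0<..} t * emeasure lborel {x. ennreal t < F x} \<le>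
         ennreal (5 ^ ?n) * (ennreal (t powr (s - 2)) * indicator {0<..} t * ?H)"
      proof (cases "0 < t")
        case True
        have "t powr (s - 1) * (5 ^ ?n / t) = 5 ^ ?n * t powr (s - 2)"
          using True powr_add[of t "s - 2" 1] by simp
        then have "ennreal (t powr (s - 1)) * (ennreal (5 ^ ?n / t) * ?H) = ennreal (5 ^ ?n) * (ennreal (t powr (s - 2)) * ?H)"
          using True by (simp flip: mult.assoc ennreal_mult)
        then show ?thesis
          using mult_left_mono[OF level[OF True], of "ennreal (t powr (s - 1))"] True by simp
      qed simp
    qed auto
    also have "\<dots> = ennreal s * (ennreal (5 ^ ?n) * (\<integral>\<^sup>+t. ennreal (t powr (s - 2)) * indicator {0<..} t *
         (\<integral>\<^sup>+x. h x * indicator {x. ennreal t < h x} x \<partial>lborel) \<partial>lborel))"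
      by (subst nn_integral_cmult) auto
    also have "(\<integral>\<^sup>+t. ennreal (t powr (s - 2)) * indicator {0<..} t *
         (\<integral>\<^sup>+x. h x * indicator {x. ennreal t < h x} x \<partial>lborel) \<partial>lborel) =
       ennreal (1 / (s - 1)) * (\<integral>\<^sup>+x. h x * ennpowr (h x) (s - 1) \<partial>lborel)"
      using nn_integral_layer_cake[of h h "s - 2"] s by (simp flip: mult.assoc ennreal_mult)
    also have "(\<integral>\<^sup>+x. h x * ennpowr (h x) (s - 1) \<partial>lborel) = (\<integral>\<^sup>+x. ennpowr (h x) s \<partial>lborel)"
      using ennpowr_add[of _ 1 "s - 1"] by (intro nn_integral_cong) simp
    finally have *: "(\<integral>\<^sup>+x. ennpowr (F x) s \<partial>lborel) \<le>
      ennreal (s * (5 ^ ?n * (1 / (s - 1)))) * (\<integral>\<^sup>+x. ennpowr (h x) s \<partial>lborel)"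
      using s by (simp flip: mult.assoc ennreal_mult)
    have "(\<integral>\<^sup>+x. ennpowr (hl_max h x) s \<partial>lborel) = ennreal ((2 * \<kappa>) powr s) * (\<integral>\<^sup>+x. ennpowr (F x) s \<partial>lborel)"
      using \<kappa> by (simp add: hF ennpowr_mult ennpowr_ennreal nn_integral_cmult)
    also have "\<dots> \<le> ennreal ((2 * \<kappa>) powr s) * (ennreal (s * (5 ^ ?n * (1 / (s - 1)))) * (\<integral>\<^sup>+x. ennpowr (h x) s \<partial>lborel))"
      by (intro mult_left_mono *) auto
    also have "\<dots> = ennreal C * (\<integral>\<^sup>+x. ennpowr (h x) s \<partial>lborel)"
      unfolding C_def using s \<kappa> by (simp flip: mult.assoc ennreal_mult)
    finally show ?thesis .
  qed
  moreover have "0 \<le> C" using s \<kappa> by (simp add: C_def)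
  ultimately show ?thesis using that by blast
qed

subsection \<open>Dyadic cubes and the reverse Hoelder inequality\<close>

text \<open>Half-open, so that the children partition the cube exactly and the corner
  \<open>a\<close> belongs to it.\<close>

definition cube :: "real^'n \<Rightarrow> real \<Rightarrow> (real^'n) set"
  where "cube a l = {x. \<forall>i. a $ i \<le> x $ i \<and> x $ i < a $ i + l}"

text \<open>The index type \<open>'n \<Rightarrow> bool\<close> has \<open>2 ^ CARD('n)\<close>
  elements, so sums over children are sums over a finite type.\<close>

definition child :: "real^'n \<Rightarrow> real \<Rightarrow> ('n \<Rightarrow> bool) \<Rightarrow> real^'n"
  where "child a l b = (\<chi> i. a $ i + (if b i then l / 2 else 0))"

lemma cube_between:
  fixes a :: "real^'n"
  shows "box a (a + vec l) \<subseteq> cube a l" "cube a l \<subseteq> cbox a (a + vec l)"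
  by (auto simp: cube_def box_def cbox_def Basis_vec_def inner_axis less_imp_le)

lemma cube_eq_Int:
  fixes a :: "real^'n"
  shows "cube a l = (\<Inter>i. {x. a $ i \<le> x $ i}) \<inter> (\<Inter>i. {x. x $ i < a $ i + l})"
  by (auto simp: cube_def)

lemma cube_borel [measurable, simp]:
  fixes a :: "real^'n"
  shows "cube a l \<in> sets borel"
proof -
  have "{x::real^'n. c \<le> x $ i} \<in> sets borel" "{x::real^'n. x $ i < c} \<in> sets borel" for i c
    by (auto intro!: borel_closed borel_open closed_Collect_le open_Collect_less continuous_intros)
  then show ?thesis unfolding cube_eq_Int by (intro sets.Int sets.finite_INT) auto
qed

lemma cube_lebesgue [measurable, simp]: "cube a l \<in> sets lebesgue"
  by (simp add: sets_completionI_sets)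

lemma emeasure_lborel_cube:
  fixes a :: "real^'n"
  assumes "0 \<le> l"
  shows "emeasure lborel (cube a l) = ennreal (l ^ CARD('n))"
proof -
  have l: "vec l \<bullet> b = l" if "b \<in> Basis" for b :: "real^'n"
    using that by (auto simp: Basis_vec_def inner_axis)
  have le: "a \<bullet> b \<le> (a + vec l) \<bullet> b" if "b \<in> Basis" for b
    using that assms l[of b] by (simp add: inner_add_left)
  have "(\<Prod>b\<in>Basis. (a + vec l - a) \<bullet> b) = (\<Prod>b\<in>(Basis :: (real^'n) set). l)"
    by (intro prod.cong) (simp_all add: l)
  then have prod: "(\<Prod>b\<in>Basis. (a + vec l - a) \<bullet> b) = l ^ CARD('n)"
    by simp
  have "emeasure lborel (box a (a + vec l)) \<le> emeasure lborel (cube a l)"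
    by (intro emeasure_mono cube_between) simp
  moreover have "emeasure lborel (cube a l) \<le> emeasure lborel (cbox a (a + vec l))"
    by (intro emeasure_mono cube_between) simp
  ultimately show "emeasure lborel (cube a l) = ennreal (l ^ CARD('n))"
    using emeasure_lborel_box[of a "a + vec l"] emeasure_lborel_cbox[of a "a + vec l"] le prod
    by (intro antisym) simp_all
qed

lemma emeasure_cube:
  fixes a :: "real^'n"
  shows "0 \<le> l \<Longrightarrow> emeasure lebesgue (cube a l) = ennreal (l ^ CARD('n))"
  by (simp add: emeasure_lborel_cube)

lemma cube_children:
  fixes a :: "real^'n"
  assumes "0 < l"
  shows "cube a l = (\<Union>b. cube (child a l b) (l / 2))"
    and "disjoint_family (\<lambda>b. cube (child a l b) (l / 2))"
proof -
  show "cube a l = (\<Union>b. cube (child a l b) (l / 2))"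
  proof (intro set_eqI iffI)
    fix x assume x: "x \<in> cube a l"
    have "x \<in> cube (child a l (\<lambda>i. a $ i + l / 2 \<le> x $ i)) (l / 2)"
      unfolding cube_def child_def
    proof (safe, goal_cases)
      case (1 i) then show ?case using x by (simp add: cube_def)
    next
      case (2 i) then show ?case using x[unfolded cube_def, simplified, rule_format, of i] by (auto simp: not_le)
    qed
    then show "x \<in> (\<Union>b. cube (child a l b) (l / 2))" by blast
  next
    fix x assume "x \<in> (\<Union>b. cube (child a l b) (l / 2))"
    then obtain b where "x \<in> cube (child a l b) (l / 2)" by blast
    then have *: "a $ i + (if b i then l / 2 else 0) \<le> x $ i \<and> x $ i < a $ i + (if b i then l / 2 else 0) + l / 2" for i
      by (simp add: cube_def child_def)
    have "a $ i \<le> x $ i \<and> x $ i < a $ i + l" for i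
      using *[of i] assms by (cases "b i") auto
    then show "x \<in> cube a l" by (simp add: cube_def)
  qed
  show "disjoint_family (\<lambda>b. cube (child a l b) (l / 2))"
    unfolding disjoint_family_on_def
  proof (intro ballI impI)
    fix b c :: "'n \<Rightarrow> bool" assume "b \<noteq> c"
    then obtain i where i: "b i \<noteq> c i" by blast
    show "cube (child a l b) (l / 2) \<inter> cube (child a l c) (l / 2) = {}"
    proof (rule ccontr)
      assume "cube (child a l b) (l / 2) \<inter> cube (child a l c) (l / 2) \<noteq> {}"
      then obtain x where "x \<in> cube (child a l b) (l / 2)" "x \<in> cube (child a l c) (l / 2)" by blast
      then have "a $ i + (if b i then l / 2 else 0) \<le> x $ i" "x $ i < a $ i + (if b i then l / 2 else 0) + l / 2"
        "a $ i + (if c i then l / 2 else 0) \<le> x $ i" "x $ i < a $ i + (if c i then l / 2 else 0) + l / 2"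
        by (simp_all add: cube_def child_def)
      then show False using i by (cases "b i") auto
    qed
  qed
qed

lemma child_subset: "0 < l \<Longrightarrow> cube (child a l b) (l / 2) \<subseteq> cube a l"
  using cube_children(1)[of l a] by blast

lemma nn_integral_disjoint_UNION_finite:
  fixes f :: "'a \<Rightarrow> ennreal"
  assumes "finite I" "disjoint_family_on A I" "\<And>i. i \<in> I \<Longrightarrow> A i \<in> sets M"
    and [measurable]: "f \<in> borel_measurable M"
  shows "(\<integral>\<^sup>+x\<in>(\<Union>i\<in>I. A i). f x \<partial>M) = (\<Sum>i\<in>I. \<integral>\<^sup>+x\<in>A i. f x \<partial>M)"
proof -
  have "(\<integral>\<^sup>+x\<in>(\<Union>i\<in>I. A i). f x \<partial>M) = emeasure (density M f) (\<Union>i\<in>I. A i)"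
    using assms by (intro emeasure_density[symmetric]) auto
  also have "\<dots> = (\<Sum>i\<in>I. emeasure (density M f) (A i))"
    using assms by (intro sum_emeasure[symmetric]) auto
  also have "\<dots> = (\<Sum>i\<in>I. \<integral>\<^sup>+x\<in>A i. f x \<partial>M)"
    using assms by (intro sum.cong emeasure_density) auto
  finally show ?thesis .
qed

lemma nn_integral_children:
  fixes a :: "real^'n"
  assumes "0 < l" "f \<in> borel_measurable lebesgue"
  shows "(\<integral>\<^sup>+x\<in>cube a l. f x \<partial>lebesgue) = (\<Sum>b\<in>UNIV. \<integral>\<^sup>+x\<in>cube (child a l b) (l / 2). f x \<partial>lebesgue)"
  unfolding cube_children(1)[OF assms(1), of a]
  using assms cube_children(2)[OF assms(1), of a] by (intro nn_integral_disjoint_UNION_finite) auto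

section \<open>Averages, dyadic energies and stopping cubes\<close>

definition cube_avg :: "(real^'n \<Rightarrow> ennreal) \<Rightarrow> real^'n \<Rightarrow> real \<Rightarrow> ennreal"
  where "cube_avg w a l = (\<integral>\<^sup>+x\<in>cube a l. w x \<partial>lebesgue) / ennreal (l ^ CARD('n))"

lemma cube_avg_times:
  fixes a :: "real^'n"
  assumes "0 < l"
  shows "ennreal (l ^ CARD('n)) * cube_avg w a l = (\<integral>\<^sup>+x\<in>cube a l. w x \<partial>lebesgue)"
  using assms mult_divide_eq_ennreal[of "ennreal (l ^ CARD('n))" "\<integral>\<^sup>+x\<in>cube a l. w x \<partial>lebesgue"]
  by (simp add: cube_avg_def ennreal_times_divide mult.commute)

text \<open>The sum over the cubes of generation \<open>k\<close> of volume times the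
  \<open>s\<close>-th power of the average, a discrete substitute for the integral of
  \<open>w\<close> to the power \<open>s\<close>. A bound uniform in \<open>k\<close> is the reverse
  Hoelder inequality without a passage to the limit.\<close>

fun dyadic_energy :: "(real^'n \<Rightarrow> ennreal) \<Rightarrow> real \<Rightarrow> nat \<Rightarrow> real^'n \<Rightarrow> real \<Rightarrow> ennreal"
  where "dyadic_energy w s 0 a l = ennreal (l ^ CARD('n)) * ennpowr (cube_avg w a l) s"
  | "dyadic_energy w s (Suc k) a l = (\<Sum>b\<in>UNIV. dyadic_energy w s k (child a l b) (l / 2))"

text \<open>Calderon--Zygmund stopping cubes, searched for only \<open>k\<close> generations deep: neither maximal
  cubes of an infinite family nor Lebesgue differentiation are needed.\<close>

fun stopped :: "(real^'n \<Rightarrow> ennreal) \<Rightarrow> ennreal \<Rightarrow> nat \<Rightarrow> real^'n \<Rightarrow> real \<Rightarrow> (real^'n) set"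
  where "stopped w T 0 a l = (if T < cube_avg w a l then cube a l else {})"
  | "stopped w T (Suc k) a l = (if T < cube_avg w a l then cube a l
       else (\<Union>b. stopped w T k (child a l b) (l / 2)))"

lemma stopped_subset: "0 < l \<Longrightarrow> stopped w T k a l \<subseteq> cube a l"
proof (induction k arbitrary: a l)
  case (Suc k)
  have "stopped w T k (child a l b) (l / 2) \<subseteq> cube a l" for b
    using Suc.IH[of "l / 2" "child a l b"] child_subset[OF Suc.prems, of a b] Suc.prems by auto
  then show ?case by auto
qed auto

lemma stopped_measurable [measurable, simp]: "stopped w T k a l \<in> sets lebesgue"
  by (induction k arbitrary: a l) (auto intro!: sets.finite_UN)

lemma stopped_disjoint: "0 < l \<Longrightarrow> disjoint_family (\<lambda>b. stopped w T k (child a l b) (l / 2))"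
  using stopped_subset[of "l / 2" w T k]
  by (intro disjoint_family_subset[OF cube_children(2)[of l a]]) auto

text \<open>On each selected cube the average exceeds \<open>T\<close>, and the selected cubes are
  disjoint, so the inequalities add up.\<close>

lemma stopped_weak:
  fixes a :: "real^'n"
  assumes [measurable]: "w \<in> borel_measurable lebesgue"
  shows "0 < l \<Longrightarrow> T * emeasure lebesgue (stopped w T k a l) \<le> (\<integral>\<^sup>+x\<in>stopped w T k a l. w x \<partial>lebesgue)"
proof (induction k arbitrary: a l)
  have top: "T * emeasure lebesgue (cube a l) \<le> (\<integral>\<^sup>+x\<in>cube a l. w x \<partial>lebesgue)"
    if "T < cube_avg w a l" "0 < l" for a :: "real^'n" and l
  proof -
    have "T * ennreal (l ^ CARD('n)) \<le> cube_avg w a l * ennreal (l ^ CARD('n))"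
      using that by (intro mult_right_mono) auto
    then show ?thesis
      using that cube_avg_times[of l w a] by (simp add: emeasure_lborel_cube mult.commute)
  qed
  {
    case 0
    then show ?case using top by simp
  next
    case (Suc k)
    show ?case
    proof (cases "T < cube_avg w a l")
      case True
      then show ?thesis using top Suc.prems by simp
    next
      case False
      have "T * emeasure lebesgue (\<Union>b. stopped w T k (child a l b) (l / 2)) =
        (\<Sum>b\<in>UNIV. T * emeasure lebesgue (stopped w T k (child a l b) (l / 2)))"
        using stopped_disjoint[OF Suc.prems] by (subst sum_emeasure[symmetric]) (auto simp: sum_distrib_left)
      also have "\<dots> \<le> (\<Sum>b\<in>UNIV. \<integral>\<^sup>+x\<in>stopped w T k (child a l b) (l / 2). w x \<partial>lebesgue)"
        using Suc by (intro sum_mono) auto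
      also have "\<dots> = (\<integral>\<^sup>+x\<in>(\<Union>b. stopped w T k (child a l b) (l / 2)). w x \<partial>lebesgue)"
        using stopped_disjoint[OF Suc.prems] by (intro nn_integral_disjoint_UNION_finite[symmetric]) auto
      finally show ?thesis using False by simp
    qed
  }
qed

text \<open>The volume drops by the factor \<open>2 ^ CARD('n)\<close> while the mass does not grow.
  Hence a cube whose parent was not stopped has average at most \<open>2 ^ CARD('n) * T\<close>, the
  upper half of the Calderon--Zygmund bounds.\<close>

lemma cube_avg_child_le:
  fixes a :: "real^'n"
  assumes "0 < l"
  shows "cube_avg w (child a l b) (l / 2) \<le> 2 ^ CARD('n) * cube_avg w a l"
proof -
  have eq: "ennreal ((l / 2) ^ CARD('n)) * 2 ^ CARD('n) = ennreal (l ^ CARD('n))"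
  proof -
    have "ennreal (l ^ CARD('n)) = ennreal ((l / 2) ^ CARD('n) * 2 ^ CARD('n))"
      by (simp add: power_divide)
    also have "\<dots> = ennreal ((l / 2) ^ CARD('n)) * 2 ^ CARD('n)"
      using assms by (subst ennreal_mult) (auto simp flip: ennreal_power)
    finally show ?thesis by simp
  qed
  have "cube_avg w (child a l b) (l / 2) \<le> (\<integral>\<^sup>+x\<in>cube a l. w x \<partial>lebesgue) / ennreal ((l / 2) ^ CARD('n))"
    unfolding cube_avg_def using child_subset[OF assms, of a b]
    by (intro divide_right_mono_ennreal nn_integral_mono mult_left_mono) (auto split: split_indicator)
  also have "\<dots> \<le> 2 ^ CARD('n) * cube_avg w a l"
    using assms cube_avg_times[OF assms, of w a]
    by (intro divide_le_posI_ennreal) (simp_all add: eq mult.assoc[symmetric])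
  finally show ?thesis .
qed

lemma dyadic_energy_0:
  fixes a :: "real^'n"
  assumes "0 < l"
  shows "dyadic_energy w (1 + \<epsilon>) 0 a l = ennpowr (cube_avg w a l) \<epsilon> * (\<integral>\<^sup>+x\<in>cube a l. w x \<partial>lebesgue)"
  by (simp add: ennpowr_add mult_ac flip: cube_avg_times[OF assms, of w a])

text \<open>A stopped cube is charged with the bound for its remaining generations and with its
  average, at most \<open>2 ^ CARD('n) * T\<close>; a cube of the last generation that was never
  stopped has average at most \<open>T\<close>. Cubes stopped below the root have fewer than
  \<open>k\<close> generations left. Only a stopped root needs the bound for \<open>k\<close>
  itself, hence the separate third premise.\<close>

lemma energy_stopped_bound:
  fixes a :: "real^'n"
  assumes [measurable]: "w \<in> borel_measurable lebesgue" and eps: "0 < \<epsilon>"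
  shows "\<lbrakk>0 < l;
     \<And>j a l. j < k \<Longrightarrow> 0 < l \<Longrightarrow> dyadic_energy w (1 + \<epsilon>) j a l \<le> C * dyadic_energy w (1 + \<epsilon>) 0 a l;
     T < cube_avg w a l \<Longrightarrow> dyadic_energy w (1 + \<epsilon>) k a l \<le> C * dyadic_energy w (1 + \<epsilon>) 0 a l;
     cube_avg w a l \<le> 2 ^ CARD('n) * T\<rbrakk> \<Longrightarrow>
     dyadic_energy w (1 + \<epsilon>) k a l \<le>
       C * ennpowr (2 ^ CARD('n) * T) \<epsilon> * (\<integral>\<^sup>+x\<in>stopped w T k a l. w x \<partial>lebesgue) +
       ennpowr T \<epsilon> * (\<integral>\<^sup>+x\<in>cube a l. w x \<partial>lebesgue)"
proof (induction k arbitrary: a l)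
  have top: "dyadic_energy w (1 + \<epsilon>) k a l \<le>
       C * ennpowr (2 ^ CARD('n) * T) \<epsilon> * (\<integral>\<^sup>+x\<in>cube a l. w x \<partial>lebesgue) +
       ennpowr T \<epsilon> * (\<integral>\<^sup>+x\<in>cube a l. w x \<partial>lebesgue)"
    if "0 < l" "dyadic_energy w (1 + \<epsilon>) k a l \<le> C * dyadic_energy w (1 + \<epsilon>) 0 a l"
      "cube_avg w a l \<le> 2 ^ CARD('n) * T" for k a l
  proof -
    have "dyadic_energy w (1 + \<epsilon>) k a l \<le> C * (ennpowr (cube_avg w a l) \<epsilon> * (\<integral>\<^sup>+x\<in>cube a l. w x \<partial>lebesgue))"
      using that(2) unfolding dyadic_energy_0[OF that(1)] .
    also have "\<dots> \<le> C * (ennpowr (2 ^ CARD('n) * T) \<epsilon> * (\<integral>\<^sup>+x\<in>cube a l. w x \<partial>lebesgue))"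
      using that eps by (intro mult_left_mono mult_right_mono ennpowr_mono) auto
    finally show ?thesis by (simp add: mult.assoc add_increasing2)
  qed
  {
    case (0 a l)
    show ?case
    proof (cases "T < cube_avg w a l")
      case True
      then show ?thesis using top[OF 0(1) 0(3) 0(4)] by simp
    next
      case False
      have "dyadic_energy w (1 + \<epsilon>) 0 a l = ennpowr (cube_avg w a l) \<epsilon> * (\<integral>\<^sup>+x\<in>cube a l. w x \<partial>lebesgue)"
        by (rule dyadic_energy_0[OF 0(1)])
      also have "\<dots> \<le> ennpowr T \<epsilon> * (\<integral>\<^sup>+x\<in>cube a l. w x \<partial>lebesgue)"
        using False eps by (intro mult_right_mono ennpowr_mono) auto
      finally show ?thesis using False by simp
    qed
  next
    case (Suc k a l)
    show ?case
    proof (cases "T < cube_avg w a l")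
      case True
      then show ?thesis using top[OF Suc.prems(1) Suc.prems(3) Suc.prems(4)] by simp
    next
      case False
      let ?c = "\<lambda>b. child a l b"
      have "dyadic_energy w (1 + \<epsilon>) (Suc k) a l \<le> (\<Sum>b\<in>UNIV.
         C * ennpowr (2 ^ CARD('n) * T) \<epsilon> * (\<integral>\<^sup>+x\<in>stopped w T k (?c b) (l / 2). w x \<partial>lebesgue) +
         ennpowr T \<epsilon> * (\<integral>\<^sup>+x\<in>cube (?c b) (l / 2). w x \<partial>lebesgue))"
        unfolding dyadic_energy.simps
      proof (intro sum_mono Suc.IH)
        fix b
        show "cube_avg w (child a l b) (l / 2) \<le> 2 ^ CARD('n) * T"
          using False by (intro order_trans[OF cube_avg_child_le[OF Suc.prems(1)]] mult_left_mono) auto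
      qed (use Suc.prems in auto)
      also have "\<dots> = C * ennpowr (2 ^ CARD('n) * T) \<epsilon> * (\<Sum>b\<in>UNIV. \<integral>\<^sup>+x\<in>stopped w T k (?c b) (l / 2). w x \<partial>lebesgue) +
         ennpowr T \<epsilon> * (\<Sum>b\<in>UNIV. \<integral>\<^sup>+x\<in>cube (?c b) (l / 2). w x \<partial>lebesgue)"
        by (simp add: sum.distrib sum_distrib_left)
      also have "(\<Sum>b\<in>UNIV. \<integral>\<^sup>+x\<in>stopped w T k (?c b) (l / 2). w x \<partial>lebesgue) =
         (\<integral>\<^sup>+x\<in>stopped w T (Suc k) a l. w x \<partial>lebesgue)"
        using stopped_disjoint[OF Suc.prems(1)] False
        by (subst nn_integral_disjoint_UNION_finite[symmetric]) auto
      also have "(\<Sum>b\<in>UNIV. \<integral>\<^sup>+x\<in>cube (?c b) (l / 2). w x \<partial>lebesgue) = (\<integral>\<^sup>+x\<in>cube a l. w x \<partial>lebesgue)"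
        using Suc.prems by (intro nn_integral_children[symmetric]) auto
      finally show ?thesis .
    qed
  }
qed

section \<open>Self-improvement of A-infinity weights\<close>

definition Ainfty :: "real \<Rightarrow> (real^'n \<Rightarrow> ennreal) \<Rightarrow> bool"
  where "Ainfty \<theta> w \<longleftrightarrow> (\<forall>a l. 0 < l \<longrightarrow> (\<integral>\<^sup>+x\<in>cube a l. w x \<partial>lebesgue) < top \<and>
    (\<forall>E\<in>sets lebesgue. E \<subseteq> cube a l \<longrightarrow> 4 * emeasure lebesgue E \<le> ennreal (l ^ CARD('n)) \<longrightarrow>
      (\<integral>\<^sup>+x\<in>E. w x \<partial>lebesgue) \<le> ennreal \<theta> * (\<integral>\<^sup>+x\<in>cube a l. w x \<partial>lebesgue)))"

lemma nn_integral_set_mono: "A \<subseteq> B \<Longrightarrow> (\<integral>\<^sup>+x\<in>A. f x \<partial>M) \<le> (\<integral>\<^sup>+x\<in>B. f x \<partial>M)" for f :: "_ \<Rightarrow> ennreal"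
  by (intro nn_integral_mono mult_left_mono) (auto split: split_indicator)

text \<open>Chebyshev: stopping at four times the average \<open>A\<close> gives
  \<open>4 * A * |E| \<le> w(E) \<le> w(Q) = A * |Q|\<close>, so the stopped set fills at most a
  quarter of the cube. That is the proportion fixed in \<open>Ainfty\<close>. Dividing by
  \<open>A\<close> is legitimate because \<open>A\<close> is finite and, after a case distinction,
  nonzero.\<close>

lemma stopped_small:
  fixes a :: "real^'n"
  assumes [measurable]: "w \<in> borel_measurable lebesgue" and A: "Ainfty \<theta> w" and l: "0 < l"
  shows "(\<integral>\<^sup>+x\<in>stopped w (4 * cube_avg w a l) k a l. w x \<partial>lebesgue) \<le> ennreal \<theta> * (\<integral>\<^sup>+x\<in>cube a l. w x \<partial>lebesgue)"
proof -
  let ?E = "stopped w (4 * cube_avg w a l) k a l"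
  have sub: "?E \<subseteq> cube a l" by (rule stopped_subset[OF l])
  have W: "(\<integral>\<^sup>+x\<in>?E. w x \<partial>lebesgue) \<le> (\<integral>\<^sup>+x\<in>cube a l. w x \<partial>lebesgue)"
    by (rule nn_integral_set_mono[OF sub])
  have fin: "(\<integral>\<^sup>+x\<in>cube a l. w x \<partial>lebesgue) < top" using A l by (auto simp: Ainfty_def)
  show ?thesis
  proof (cases "cube_avg w a l = 0")
    case True
    then have "(\<integral>\<^sup>+x\<in>cube a l. w x \<partial>lebesgue) = 0" using cube_avg_times[OF l, of w a] by simp
    then show ?thesis using W by simp
  next
    case False
    have "cube_avg w a l < top" using fin l
      by (simp add: cube_avg_def ennreal_divide_eq_top_iff less_top[symmetric])
    then have "cube_avg w a l \<noteq> top" by simp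
    have "cube_avg w a l * (4 * emeasure lebesgue ?E) \<le> (\<integral>\<^sup>+x\<in>?E. w x \<partial>lebesgue)"
      using stopped_weak[OF assms(1) l, of "4 * cube_avg w a l" k a] by (simp add: mult_ac)
    also have "\<dots> \<le> cube_avg w a l * ennreal (l ^ CARD('n))"
      using W cube_avg_times[OF l, of w a] by (simp add: mult.commute)
    finally have "4 * emeasure lebesgue ?E \<le> ennreal (l ^ CARD('n))"
      using False \<open>cube_avg w a l \<noteq> top\<close> by (simp add: ennreal_mult_le_mult_iff)
    then show ?thesis using A l sub by (auto simp: Ainfty_def)
  qed
qed

text \<open>Gehring's self-improvement. The induction over the generations replaces the usual absorption
  argument, so that the energies need not be known to be finite.\<close>

lemma dyadic_energy_bound:
  fixes w :: "real^'n \<Rightarrow> ennreal"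
  assumes [measurable]: "w \<in> borel_measurable lebesgue" and A: "Ainfty \<theta> w"
    and \<theta>: "0 \<le> \<theta>" "\<theta> < 1" and \<epsilon>: "0 < \<epsilon>" "\<theta> * (2 ^ CARD('n) * 4) powr \<epsilon> \<le> (1 + \<theta>) / 2"
  defines "C \<equiv> 4 powr \<epsilon> * 2 / (1 - \<theta>)"
  shows "0 < l \<Longrightarrow> dyadic_energy w (1 + \<epsilon>) k a l \<le> ennreal C * dyadic_energy w (1 + \<epsilon>) 0 a l"
proof (induction k arbitrary: a l rule: less_induct)
  case (less k)
  have C1: "1 \<le> C"
  proof -
    have "1 - \<theta> \<le> 2 * 4 powr \<epsilon>" using \<theta> \<epsilon> ge_one_powr_ge_zero[of 4 \<epsilon>] by linarith
    then show ?thesis using \<theta> by (simp add: C_def field_simps)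
  qed
  \<comment> \<open>\<open>C\<close> solves
    \<open>C * ((1 + \<theta>) / 2) + 4 powr \<epsilon> = C\<close>, so an induction step reproduces
    the same constant.\<close>
  have C: "C * (\<theta> * (2 ^ CARD('n) * 4) powr \<epsilon>) + 4 powr \<epsilon> \<le> C"
  proof -
    have "C * (\<theta> * (2 ^ CARD('n) * 4) powr \<epsilon>) \<le> C * ((1 + \<theta>) / 2)"
      using C1 \<epsilon> by (intro mult_left_mono) auto
    moreover have "C * ((1 + \<theta>) / 2) + 4 powr \<epsilon> = C"
      using \<theta> by (simp add: C_def field_simps)
    ultimately show ?thesis by linarith
  qed
  show ?case
  proof -
    let ?A = "cube_avg w a l"
    let ?T = "4 * ?A" and ?W = "\<integral>\<^sup>+x\<in>cube a l. w x \<partial>lebesgue"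
    \<comment> \<open>At the level \<open>4 * A\<close> the root is not stopped. The third premise
      of \<open>energy_stopped_bound\<close> is therefore vacuous, and the induction hypothesis for
      fewer generations suffices.\<close>
    have le4: "?A \<le> ?T" and notT: "\<not> ?T < ?A"
      using mult_right_mono[of 1 "4 :: ennreal" ?A] by (simp_all add: not_less)
    have "1 * ?T \<le> 2 ^ CARD('n) * ?T"
      using one_le_power[of "2 :: ennreal" "CARD('n)"] by (intro mult_right_mono) auto
    then have "dyadic_energy w (1 + \<epsilon>) k a l \<le>
      ennreal C * ennpowr (2 ^ CARD('n) * ?T) \<epsilon> * (\<integral>\<^sup>+x\<in>stopped w ?T k a l. w x \<partial>lebesgue) + ennpowr ?T \<epsilon> * ?W"
      using less notT le4 by (intro energy_stopped_bound \<epsilon>) auto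
    also have "\<dots> \<le> ennreal C * ennpowr (2 ^ CARD('n) * ?T) \<epsilon> * (ennreal \<theta> * ?W) + ennpowr ?T \<epsilon> * ?W"
      by (intro add_right_mono mult_left_mono stopped_small A less.prems assms(1)) auto
    also have "\<dots> = ennreal (C * (\<theta> * (2 ^ CARD('n) * 4) powr \<epsilon>) + 4 powr \<epsilon>) * (ennpowr ?A \<epsilon> * ?W)"
    proof -
      have 1: "ennpowr (2 ^ CARD('n) * ?T) \<epsilon> = ennreal ((2 ^ CARD('n) * 4) powr \<epsilon>) * ennpowr ?A \<epsilon>"
      proof -
        have "2 ^ CARD('n) * ?T = ennreal (2 ^ CARD('n) * 4) * ?A"
          by (simp add: ennreal_mult mult.assoc flip: ennreal_power)
        then show ?thesis by (simp only: ennpowr_mult) (simp add: ennpowr_ennreal)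
      qed
      have 2: "ennpowr ?T \<epsilon> = ennreal (4 powr \<epsilon>) * ennpowr ?A \<epsilon>"
        using ennpowr_ennreal[of 4 \<epsilon>] by (simp add: ennpowr_mult)
      have "ennreal (C * (\<theta> * (2 ^ CARD('n) * 4) powr \<epsilon>) + 4 powr \<epsilon>) =
        ennreal C * (ennreal \<theta> * ennreal ((2 ^ CARD('n) * 4) powr \<epsilon>)) + ennreal (4 powr \<epsilon>)"
        using C1 \<theta> by (simp add: ennreal_plus ennreal_mult)
      then show ?thesis unfolding 1 2 by (simp only: distrib_right distrib_left mult_ac)
    qed
    also have "\<dots> \<le> ennreal C * (ennpowr ?A \<epsilon> * ?W)"
      using C by (intro mult_right_mono ennreal_leI) auto
    finally show ?thesis unfolding dyadic_energy_0[OF less.prems] .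
  qed
qed

text \<open>As the exponent tends to 0 the left side tends to \<open>\<theta>\<close>, which lies
  below the midpoint of \<open>\<theta>\<close> and 1.\<close>

lemma exponent_exists:
  assumes "0 \<le> \<theta>" "\<theta> < 1" "0 < (B::real)"
  obtains \<epsilon> where "0 < \<epsilon>" "\<theta> * B powr \<epsilon> \<le> (1 + \<theta>) / 2"
proof (cases "\<theta> = 0")
  case True
  then show ?thesis using that[of 1] by simp
next
  case False
  have "((\<lambda>e. \<theta> * B powr e) \<longlongrightarrow> \<theta> * B powr 0) (at_right 0)"
    using assms by (intro tendsto_intros) auto
  then have "\<forall>\<^sub>F e in at_right 0. \<theta> * B powr e < (1 + \<theta>) / 2"
    using assms by (intro order_tendstoD) auto
  then obtain e where "0 < e" "\<theta> * B powr e < (1 + \<theta>) / 2"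
    using eventually_happens'[OF trivial_limit_at_right_real eventually_conj[OF eventually_at_right_less]] by blast
  then show ?thesis using that[of e] by simp
qed

section \<open>The bilinear form of the reverse Hoelder inequality\<close>

lemma cube_Jensen:
  fixes x0 :: "real^'n"
  assumes [measurable]: "a \<in> borel_measurable lebesgue" and P: "1 < P" and l: "0 < l"
  shows "(\<integral>\<^sup>+x\<in>cube x0 l. a x \<partial>lebesgue) \<le>
    ennreal (l ^ CARD('n)) * ennpowr (cube_avg (\<lambda>x. ennpowr (a x) P) x0 l) (1 / P)"
proof -
  define P' where "P' = P / (P - 1)"
  have PP: "1 / P + 1 / P' = 1" using P by (simp add: P'_def field_simps)
  let ?W = "\<integral>\<^sup>+x\<in>cube x0 l. ennpowr (a x) P \<partial>lebesgue"
  have 1: "ennpowr (a x * indicator (cube x0 l) x) P = ennpowr (a x) P * indicator (cube x0 l) x" for x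
    by (simp split: split_indicator)
  have 2: "ennpowr (indicator (cube x0 l) x) P' = indicator (cube x0 l) x" for x
    using ennpowr_ennreal[of 1 P'] by (simp split: split_indicator)
  have "(\<integral>\<^sup>+x\<in>cube x0 l. a x \<partial>lebesgue) = (\<integral>\<^sup>+x. (a x * indicator (cube x0 l) x) * indicator (cube x0 l) x \<partial>lebesgue)"
    by (intro nn_integral_cong) (simp split: split_indicator)
  also have "\<dots> \<le> ennpowr ?W (1 / P) * ennpowr (\<integral>\<^sup>+x. indicator (cube x0 l) x \<partial>lebesgue) (1 / P')"
    using Hoelder_nn_integral[of "\<lambda>x. a x * indicator (cube x0 l) x" lebesgue "indicator (cube x0 l)" P P', OF _ _ P PP]
    unfolding 1 2 by simp
  also have "(\<integral>\<^sup>+x. indicator (cube x0 l) x \<partial>lebesgue) = ennreal (l ^ CARD('n))"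
    using l by (subst nn_integral_indicator) (auto simp: emeasure_lborel_cube)
  also have "?W = ennreal (l ^ CARD('n)) * cube_avg (\<lambda>x. ennpowr (a x) P) x0 l"
    by (rule cube_avg_times[OF l, symmetric])
  also have "ennpowr (ennreal (l ^ CARD('n)) * cube_avg (\<lambda>x. ennpowr (a x) P) x0 l) (1 / P) * ennpowr (ennreal (l ^ CARD('n))) (1 / P')
    = ennpowr (ennreal (l ^ CARD('n))) (1 / P + 1 / P') * ennpowr (cube_avg (\<lambda>x. ennpowr (a x) P) x0 l) (1 / P)"
    by (simp only: ennpowr_mult ennpowr_add mult_ac)
  finally show ?thesis unfolding PP by simp
qed

text \<open>The factor 3 absorbs the oscillation \<open>c \<le> g\<close> of \<open>g\<close> on the smallest cubes.\<close>

lemma dyadic_bilinear: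
  fixes x0 :: "real^'n" and g :: "real^'n \<Rightarrow> real"
  assumes [measurable]: "a \<in> borel_measurable lebesgue" "g \<in> borel_measurable lebesgue"
    and P: "1 < P" and \<epsilon>: "0 < \<epsilon>" and q: "1 < q" "1 / q + 1 / (P * (1 + \<epsilon>)) = 1" and c: "0 < c"
  shows "0 < l \<Longrightarrow> (\<And>x. c \<le> g x) \<Longrightarrow>
     (\<And>x y. x \<in> cube x0 l \<Longrightarrow> y \<in> cube x0 l \<Longrightarrow> (\<And>i. \<bar>x $ i - y $ i\<bar> \<le> l / 2 ^ k) \<Longrightarrow> g x \<le> g y + c) \<Longrightarrow>
    (\<integral>\<^sup>+x\<in>cube x0 l. ennreal (g x) * a x \<partial>lebesgue) \<le>
      ennpowr (\<integral>\<^sup>+x\<in>cube x0 l. ennpowr (ennreal (3 * g x)) q \<partial>lebesgue) (1 / q) *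
      ennpowr (dyadic_energy (\<lambda>x. ennpowr (a x) P) (1 + \<epsilon>) k x0 l) (1 / (P * (1 + \<epsilon>)))"
proof (induction k arbitrary: x0 l)
  case (0 x0 l)
  let ?A = "cube_avg (\<lambda>x. ennpowr (a x) P) x0 l" and ?L = "ennreal (l ^ CARD('n))"
  \<comment> \<open>A constant between \<open>g\<close> and \<open>3 * g\<close> on the cube:
    \<open>g x0 \<le> g x + c\<close> and \<open>c \<le> g x\<close> give
    \<open>G \<le> g x + 2 * c \<le> 3 * g x\<close>.\<close>
  define G where "G = g x0 + c"
  have x0: "x0 \<in> cube x0 l" using 0(1) by (simp add: cube_def)
  have near: "\<bar>x $ i - y $ i\<bar> \<le> l / 2 ^ 0" if "x \<in> cube x0 l" "y \<in> cube x0 l" for x y i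
    using that by (simp add: cube_def abs_le_iff) (smt (verit, best))
  have up: "g x \<le> G" and low: "G \<le> 3 * g x" if "x \<in> cube x0 l" for x
    using 0(3)[OF that x0 near[OF that x0]] 0(3)[OF x0 that near[OF x0 that]] 0(2)[of x]
    by (auto simp: G_def)
  have G0: "0 \<le> G" using 0(2)[of x0] c by (simp add: G_def)
  have "(\<integral>\<^sup>+x\<in>cube x0 l. ennreal (g x) * a x \<partial>lebesgue) \<le> (\<integral>\<^sup>+x. ennreal G * (a x * indicator (cube x0 l) x) \<partial>lebesgue)"
    using up by (intro nn_integral_mono) (auto split: split_indicator intro!: mult_right_mono ennreal_leI)
  also have "\<dots> = ennreal G * (\<integral>\<^sup>+x\<in>cube x0 l. a x \<partial>lebesgue)"
    by (rule nn_integral_cmult) simp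
  also have "\<dots> \<le> ennreal G * (?L * ennpowr ?A (1 / P))"
    by (intro mult_left_mono cube_Jensen P 0) auto
  also have "\<dots> = ennpowr (ennpowr (ennreal G) q * ?L) (1 / q) * ennpowr (?L * ennpowr ?A (1 + \<epsilon>)) (1 / (P * (1 + \<epsilon>)))"
    using ennpowr_add[of ?L "1 / q" "1 / (P * (1 + \<epsilon>))"] q P \<epsilon> unfolding q
    by (simp add: ennpowr_mult ennpowr_ennpowr mult_ac)
  also have "\<dots> \<le> ennpowr (\<integral>\<^sup>+x\<in>cube x0 l. ennpowr (ennreal (3 * g x)) q \<partial>lebesgue) (1 / q) *
    ennpowr (?L * ennpowr ?A (1 + \<epsilon>)) (1 / (P * (1 + \<epsilon>)))"
  proof (intro mult_right_mono ennpowr_mono)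
    have "ennpowr (ennreal G) q * ?L = (\<integral>\<^sup>+x. ennpowr (ennreal G) q * indicator (cube x0 l) x \<partial>lebesgue)"
      using 0 by (subst nn_integral_cmult_indicator) (auto simp: emeasure_lborel_cube)
    also have "\<dots> \<le> (\<integral>\<^sup>+x\<in>cube x0 l. ennpowr (ennreal (3 * g x)) q \<partial>lebesgue)"
      using low q by (intro nn_integral_mono) (auto split: split_indicator intro!: ennpowr_mono ennreal_leI)
    finally show "ennpowr (ennreal G) q * ?L \<le> \<dots>" .
  qed (use q in auto)
  finally show ?case by simp
next
  case (Suc k x0 l)
  let ?c = "\<lambda>b. child x0 l b"
  have "(\<integral>\<^sup>+x\<in>cube x0 l. ennreal (g x) * a x \<partial>lebesgue) =
     (\<Sum>b\<in>UNIV. \<integral>\<^sup>+x\<in>cube (?c b) (l / 2). ennreal (g x) * a x \<partial>lebesgue)"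
    using Suc.prems(1) by (intro nn_integral_children) auto
  also have "\<dots> \<le> (\<Sum>b\<in>UNIV.
     ennpowr (\<integral>\<^sup>+x\<in>cube (?c b) (l / 2). ennpowr (ennreal (3 * g x)) q \<partial>lebesgue) (1 / q) *
      ennpowr (dyadic_energy (\<lambda>x. ennpowr (a x) P) (1 + \<epsilon>) k (?c b) (l / 2)) (1 / (P * (1 + \<epsilon>))))"
  proof (intro sum_mono Suc.IH)
    fix b x y
    assume "x \<in> cube (?c b) (l / 2)" "y \<in> cube (?c b) (l / 2)" and d: "\<And>i. \<bar>x $ i - y $ i\<bar> \<le> l / 2 / 2 ^ k"
    then have xy: "x \<in> cube x0 l" "y \<in> cube x0 l" using child_subset[OF Suc.prems(1), of x0 b] by auto
    show "g x \<le> g y + c"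
      by (rule Suc.prems(3)[OF xy]) (use d in simp)
  qed (use Suc.prems in auto)
  \<comment> \<open>The discrete Hoelder inequality glues the children without loss, so the factor 3
    is paid only once, at the smallest cubes.\<close>
  also have "\<dots> \<le> ennpowr (\<Sum>b\<in>UNIV. \<integral>\<^sup>+x\<in>cube (?c b) (l / 2). ennpowr (ennreal (3 * g x)) q \<partial>lebesgue) (1 / q) *
      ennpowr (\<Sum>b\<in>UNIV. dyadic_energy (\<lambda>x. ennpowr (a x) P) (1 + \<epsilon>) k (?c b) (l / 2)) (1 / (P * (1 + \<epsilon>)))"
    by (intro Hoelder_sum q) auto
  also have "(\<Sum>b\<in>UNIV. \<integral>\<^sup>+x\<in>cube (?c b) (l / 2). ennpowr (ennreal (3 * g x)) q \<partial>lebesgue) =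
    (\<integral>\<^sup>+x\<in>cube x0 l. ennpowr (ennreal (3 * g x)) q \<partial>lebesgue)"
    using Suc.prems(1) by (intro nn_integral_children[symmetric]) auto
  finally show ?case by simp
qed

text \<open>Uniform continuity gives a generation at which \<open>g\<close> oscillates by at most
  \<open>c\<close>. Since \<open>E\<close> bounds the energies of all generations by one constant,
  the choice of generation leaves no trace in the result.\<close>

lemma bilinear_continuous:
  fixes x0 :: "real^'n" and g :: "real^'n \<Rightarrow> real"
  assumes a [measurable]: "a \<in> borel_measurable lebesgue" and g: "continuous_on UNIV g"
    and P: "1 < P" and \<epsilon>: "0 < \<epsilon>" and q: "1 < q" "1 / q + 1 / (P * (1 + \<epsilon>)) = 1"
    and c: "0 < c" "\<And>x. c \<le> g x" and l: "0 < l" and C: "0 \<le> C"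
    and E: "\<And>k. dyadic_energy (\<lambda>x. ennpowr (a x) P) (1 + \<epsilon>) k x0 l \<le>
      ennreal C * dyadic_energy (\<lambda>x. ennpowr (a x) P) (1 + \<epsilon>) 0 x0 l"
  shows "(\<integral>\<^sup>+x\<in>cube x0 l. ennreal (g x) * a x \<partial>lebesgue) \<le>
    ennreal (3 * C powr (1 / (P * (1 + \<epsilon>)))) * ennreal (l ^ CARD('n)) *
    ennpowr (cube_avg (\<lambda>x. ennpowr (a x) P) x0 l) (1 / P) *
    ennpowr (cube_avg (\<lambda>x. ennpowr (ennreal (g x)) q) x0 l) (1 / q)"
proof -
  have [measurable]: "g \<in> borel_measurable lebesgue"
    using g by (intro measurable_completion) (simp add: borel_measurable_continuous_onI)
  let ?L = "ennreal (l ^ CARD('n))" and ?A = "cube_avg (\<lambda>x. ennpowr (a x) P) x0 l"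
    and ?G = "cube_avg (\<lambda>x. ennpowr (ennreal (g x)) q) x0 l"
  have "uniformly_continuous_on (cbox x0 (x0 + vec l)) g"
    by (intro compact_uniformly_continuous continuous_on_subset[OF g]) auto
  then obtain d where d: "d > 0" "\<And>x y. x \<in> cbox x0 (x0 + vec l) \<Longrightarrow> y \<in> cbox x0 (x0 + vec l) \<Longrightarrow>
     dist y x < d \<Longrightarrow> dist (g y) (g x) < c"
    using c(1) unfolding uniformly_continuous_on_def by metis
  \<comment> \<open>At side \<open>l / 2 ^ k\<close> the distance of two points is at most the sum
    of \<open>CARD('n)\<close> coordinate differences, hence below \<open>d\<close>.\<close>
  obtain k where k: "real CARD('n) * l / d < 2 ^ k"
    using real_arch_pow[of 2 "real CARD('n) * l / d"] by auto
  have osc: "g x \<le> g y + c" if xy: "x \<in> cube x0 l" "y \<in> cube x0 l" and "\<And>i. \<bar>x $ i - y $ i\<bar> \<le> l / 2 ^ k" for x y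
  proof -
    have "dist x y \<le> (\<Sum>i\<in>UNIV. \<bar>(x - y) $ i\<bar>)" unfolding dist_norm by (rule norm_le_l1_cart)
    also have "\<dots> \<le> (\<Sum>i\<in>(UNIV :: 'n set). l / 2 ^ k)" using that by (intro sum_mono) simp
    also have "\<dots> = real CARD('n) * l / 2 ^ k" by simp
    also have "\<dots> < d" using k d(1) by (simp add: field_simps)
    finally have "dist (g x) (g y) < c"
      using d(2)[of y x] xy cube_between(2)[of x0 l] by blast
    then show ?thesis by (simp add: dist_real_def)
  qed
  have "(\<integral>\<^sup>+x\<in>cube x0 l. ennreal (g x) * a x \<partial>lebesgue) \<le>
    ennpowr (\<integral>\<^sup>+x\<in>cube x0 l. ennpowr (ennreal (3 * g x)) q \<partial>lebesgue) (1 / q) *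
    ennpowr (dyadic_energy (\<lambda>x. ennpowr (a x) P) (1 + \<epsilon>) k x0 l) (1 / (P * (1 + \<epsilon>)))"
    by (rule dyadic_bilinear[OF a _ P \<epsilon> q c(1) l c(2) osc]) auto
  also have "\<dots> \<le> ennpowr (\<integral>\<^sup>+x\<in>cube x0 l. ennpowr (ennreal (3 * g x)) q \<partial>lebesgue) (1 / q) *
    ennpowr (ennreal C * dyadic_energy (\<lambda>x. ennpowr (a x) P) (1 + \<epsilon>) 0 x0 l) (1 / (P * (1 + \<epsilon>)))"
    using P \<epsilon> by (intro mult_left_mono ennpowr_mono E) auto
  also have "(\<integral>\<^sup>+x\<in>cube x0 l. ennpowr (ennreal (3 * g x)) q \<partial>lebesgue) = ennpowr (ennreal 3) q * (?L * ?G)"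
    unfolding cube_avg_times[OF l] by (simp add: ennreal_mult' ennpowr_mult mult.assoc nn_integral_cmult)
  also have "ennpowr (ennpowr (ennreal 3) q * (?L * ?G)) (1 / q) = ennreal 3 * (ennpowr ?L (1 / q) * ennpowr ?G (1 / q))"
    using q by (simp only: ennpowr_mult ennpowr_ennpowr) simp
  also have "ennpowr (ennreal C * dyadic_energy (\<lambda>x. ennpowr (a x) P) (1 + \<epsilon>) 0 x0 l) (1 / (P * (1 + \<epsilon>))) =
     ennreal (C powr (1 / (P * (1 + \<epsilon>)))) * (ennpowr ?L (1 / (P * (1 + \<epsilon>))) * ennpowr ?A (1 / P))"
    using P \<epsilon> C by (simp add: ennpowr_mult ennpowr_ennpowr ennpowr_ennreal)
  also have "ennreal 3 * (ennpowr ?L (1 / q) * ennpowr ?G (1 / q)) *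
      (ennreal (C powr (1 / (P * (1 + \<epsilon>)))) * (ennpowr ?L (1 / (P * (1 + \<epsilon>))) * ennpowr ?A (1 / P))) =
    (ennreal 3 * ennreal (C powr (1 / (P * (1 + \<epsilon>))))) * ennpowr ?L (1 / q + 1 / (P * (1 + \<epsilon>))) * ennpowr ?A (1 / P) * ennpowr ?G (1 / q)"
    by (simp only: ennpowr_add mult_ac)
  finally show ?thesis unfolding q by (simp add: ennreal_mult)
qed

lemma tendsto_ennpowr:
  assumes "(f \<longlongrightarrow> ennreal x) F" "0 \<le> x" "0 < b"
  shows "((\<lambda>i. ennpowr (f i) b) \<longlongrightarrow> ennpowr (ennreal x) b) F"
proof -
  have "((\<lambda>i. enn2real (f i)) \<longlongrightarrow> x) F" using assms by (intro tendsto_enn2real) auto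
  then have "((\<lambda>i. ennreal (enn2real (f i) powr b)) \<longlongrightarrow> ennreal (x powr b)) F"
    using assms by (intro tendsto_ennrealI tendsto_powr') auto
  moreover have "\<forall>\<^sub>F i in F. f i < top"
    using assms by (intro order_tendstoD(2)[OF assms(1)]) simp
  then have "\<forall>\<^sub>F i in F. ennreal (enn2real (f i) powr b) = ennpowr (f i) b"
    by eventually_elim (auto simp: ennpowr_def)
  ultimately show ?thesis using assms(2) by (simp add: ennpowr_ennreal filterlim_cong)
qed

text \<open>A measurable function is almost everywhere a limit of continuous ones. The right side
  converges by dominated convergence, because \<open>g\<close> is bounded; on the left Fatou's lemma
  is used, because \<open>a\<close> is merely measurable.\<close>

lemma bilinear_bounded:
  fixes x0 :: "real^'n" and g :: "real^'n \<Rightarrow> real"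
  assumes a [measurable]: "a \<in> borel_measurable lebesgue" and g [measurable]: "g \<in> borel_measurable lebesgue"
    and q: "1 < q" and B: "\<And>x. 0 \<le> g x" "\<And>x. g x \<le> B" and l: "0 < l" and K: "K < top"
    and cont: "\<And>g c. continuous_on UNIV g \<Longrightarrow> 0 < c \<Longrightarrow> (\<And>x. c \<le> g x) \<Longrightarrow>
      (\<integral>\<^sup>+x\<in>cube x0 l. ennreal (g x) * a x \<partial>lebesgue) \<le>
      K * ennpowr (cube_avg (\<lambda>x. ennpowr (ennreal (g x)) q) x0 l) (1 / q)"
  shows "(\<integral>\<^sup>+x\<in>cube x0 l. ennreal (g x) * a x \<partial>lebesgue) \<le>
      K * ennpowr (cube_avg (\<lambda>x. ennpowr (ennreal (g x)) q) x0 l) (1 / q)"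
proof -
  have "g measurable_on UNIV" using g by (intro lebesgue_measurable_imp_measurable_on) simp_all
  then obtain N G where N: "negligible N" and G: "\<And>n::nat. continuous_on UNIV (G n)"
    and lim: "\<And>x. x \<notin> N \<Longrightarrow> (\<lambda>n. G n x) \<longlonglongrightarrow> g x"
    unfolding measurable_on_def by auto
  have B0: "0 \<le> B" using order_trans[OF B] by blast
  \<comment> \<open>The clamp makes the approximants positive, as \<open>cont\<close> demands, and
    uniformly bounded; it disappears in the limit since \<open>0 \<le> g \<le> B\<close>. The upper
    end \<open>B + 1\<close> never falls below \<open>1 / (n + 1)\<close>.\<close>
  define h where "h n x = max (1 / (real n + 1)) (min (B + 1) (G n x))" for n x
  have hc: "continuous_on UNIV (h n)" for n unfolding h_def by (intro continuous_intros G)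
  have [measurable]: "h n \<in> borel_measurable lebesgue" for n
    using hc by (intro measurable_completion) (simp add: borel_measurable_continuous_onI)
  have n1: "0 < 1 / (real n + 1)" "1 / (real n + 1) \<le> B + 1" for n
    using B0 by (auto intro: order_trans[of _ 1])
  have hb: "0 < 1 / (real n + 1)" "1 / (real n + 1) \<le> h n x" "0 \<le> h n x" "h n x \<le> B + 1" for n x
    using n1[of n] unfolding h_def by (linarith | intro max.cobounded1 max.boundedI | force)+
  have ae: "AE x in lebesgue. x \<notin> N"
    using N by (intro AE_I'[of N]) (auto simp: negligible_iff_null_sets)
  have hlim: "(\<lambda>n. h n x) \<longlonglongrightarrow> g x" if "x \<notin> N" for x
  proof -
    have "(\<lambda>n. h n x) \<longlonglongrightarrow> max 0 (min (B + 1) (g x))"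
      unfolding h_def using lim[OF that] LIMSEQ_Suc[OF lim_1_over_n]
      by (intro tendsto_intros) (auto simp: add.commute)
    also have "max 0 (min (B + 1) (g x)) = g x" using B[of x] by auto
    finally show ?thesis .
  qed
  let ?J = "\<lambda>g. cube_avg (\<lambda>x. ennpowr (ennreal (g x)) q) x0 l"
  have Jlim: "(\<lambda>n. ?J (h n)) \<longlonglongrightarrow> ?J g"
    unfolding cube_avg_def divide_ennreal_def mult.commute[of _ "inverse (ennreal (l ^ CARD('n)))"]
  proof (intro ennreal_tendsto_cmult nn_integral_dominated_convergence[where w = "\<lambda>x. ennreal ((B + 1) powr q) * indicator (cube x0 l) x"])
    show "AE x in lebesgue. ennpowr (ennreal (h n x)) q * indicator (cube x0 l) x \<le> ennreal ((B + 1) powr q) * indicator (cube x0 l) x" for n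
      using hb[of n] q by (intro AE_I2) (auto split: split_indicator simp: ennpowr_ennreal intro!: ennreal_leI powr_mono2)
    show "(\<integral>\<^sup>+x. ennreal ((B + 1) powr q) * indicator (cube x0 l) x \<partial>lebesgue) < \<infinity>"
      using l by (subst nn_integral_cmult_indicator) (auto simp: emeasure_lborel_cube ennreal_mult_less_top)
    show "AE x in lebesgue. (\<lambda>n. ennpowr (ennreal (h n x)) q * indicator (cube x0 l) x) \<longlonglongrightarrow> ennpowr (ennreal (g x)) q * indicator (cube x0 l) x"
      using ae
    proof eventually_elim
      case (elim x)
      have "(\<lambda>n. ennpowr (ennreal (h n x)) q) \<longlonglongrightarrow> ennpowr (ennreal (g x)) q"
        using hlim[OF elim] q B by (intro tendsto_ennpowr tendsto_ennrealI) auto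
      then show ?case by (simp split: split_indicator)
    qed
  qed (use l in \<open>auto simp: inverse_ennreal\<close>)
  have Jfin: "?J g < top"
  proof -
    have "?J g \<le> (\<integral>\<^sup>+x. ennreal (B powr q) * indicator (cube x0 l) x \<partial>lebesgue) / ennreal (l ^ CARD('n))"
      unfolding cube_avg_def using B q
      by (intro divide_right_mono_ennreal nn_integral_mono)
        (auto split: split_indicator simp: ennpowr_ennreal intro!: ennreal_leI powr_mono2)
    also have "\<dots> < top"
      using l by (subst nn_integral_cmult_indicator)
        (auto simp: emeasure_lborel_cube ennreal_divide_eq_top_iff ennreal_mult_eq_top_iff less_top[symmetric])
    finally show ?thesis .
  qed
  have "(\<integral>\<^sup>+x\<in>cube x0 l. ennreal (g x) * a x \<partial>lebesgue) \<le>
    (\<integral>\<^sup>+x. liminf (\<lambda>n. ennreal (h n x) * a x * indicator (cube x0 l) x) \<partial>lebesgue)"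
  proof (intro nn_integral_mono_AE)
    show "AE x in lebesgue. ennreal (g x) * a x * indicator (cube x0 l) x \<le> liminf (\<lambda>n. ennreal (h n x) * a x * indicator (cube x0 l) x)"
      using ae
    proof eventually_elim
      case (elim x)
      show ?case
      \<comment> \<open>Multiplication by \<open>top\<close> is discontinuous at 0, so the limit
        cannot be taken factor by factor; positivity of \<open>h n x\<close> makes every product
        equal to \<open>top\<close> instead.\<close>
      proof (cases "a x = top")
        case True
        have "0 < h n x" for n using hb(1)[of n] hb(2)[of n x] by linarith
        then have "ennreal (h n x) * a x = top" for n
          using True by (simp add: ennreal_mult_top ennreal_eq_0_iff not_le)
        then show ?thesis by (cases "x \<in> cube x0 l") (simp_all add: Liminf_const)
      next
        case False
        then have "(\<lambda>n. a x * ennreal (h n x)) \<longlonglongrightarrow> a x * ennreal (g x)"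
          using hlim[OF elim] by (intro ennreal_tendsto_cmult tendsto_ennrealI) (auto simp: less_top)
        then show ?thesis
          by (cases "x \<in> cube x0 l") (simp_all add: lim_imp_Liminf mult.commute)
      qed
    qed
  qed
  also have "\<dots> \<le> liminf (\<lambda>n. \<integral>\<^sup>+x\<in>cube x0 l. ennreal (h n x) * a x \<partial>lebesgue)"
    by (rule nn_integral_liminf) auto
  also have "\<dots> \<le> liminf (\<lambda>n. K * ennpowr (?J (h n)) (1 / q))"
    using hb by (intro Liminf_mono always_eventually allI cont[OF hc hb(1)[of n for n]]) auto
  also have "\<dots> = K * ennpowr (?J g) (1 / q)"
  proof (intro lim_imp_Liminf ennreal_tendsto_cmult K)
    show "(\<lambda>n. ennpowr (?J (h n)) (1 / q)) \<longlonglongrightarrow> ennpowr (?J g) (1 / q)"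
      using tendsto_ennpowr[of "\<lambda>n. ?J (h n)" "enn2real (?J g)" sequentially "1 / q"] Jlim Jfin q
      by simp
  qed simp
  finally show ?thesis .
qed

text \<open>The self-improvement raises the exponent of \<open>a\<close> from \<open>P\<close> to
  \<open>P * (1 + \<epsilon>)\<close>, so \<open>g\<close> is measured with the conjugate
  \<open>q\<close> of the latter, strictly below the conjugate of \<open>P\<close>. Both
  \<open>q\<close> and \<open>K\<close> are fixed before \<open>a\<close>, which makes the estimate
  uniform over all weights with the same \<open>\<theta>\<close>. Unbounded \<open>g\<close> are
  truncated and recovered by monotone convergence.\<close>

lemma Ainfty_bilinear:
  fixes P \<theta> :: real
  assumes P: "1 < P" and \<theta>: "0 \<le> \<theta>" "\<theta> < 1"
  obtains q K :: real where "1 < q" "q < P / (P - 1)" "0 \<le> K"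
    "\<And>(a :: real^'n \<Rightarrow> ennreal) (g :: real^'n \<Rightarrow> real) x0 l.
      a \<in> borel_measurable lebesgue \<Longrightarrow> g \<in> borel_measurable lebesgue \<Longrightarrow> (\<And>x. 0 \<le> g x) \<Longrightarrow>
      Ainfty \<theta> (\<lambda>x. ennpowr (a x) P) \<Longrightarrow> 0 < l \<Longrightarrow>
      (\<integral>\<^sup>+x\<in>cube x0 l. ennreal (g x) * a x \<partial>lebesgue) \<le>
        ennreal K * ennreal (l ^ CARD('n)) * ennpowr (cube_avg (\<lambda>x. ennpowr (a x) P) x0 l) (1 / P) *
        ennpowr (cube_avg (\<lambda>x. ennpowr (ennreal (g x)) q) x0 l) (1 / q)"
proof -
  obtain \<epsilon> where \<epsilon>: "0 < \<epsilon>" "\<theta> * (2 ^ CARD('n) * 4) powr \<epsilon> \<le> (1 + \<theta>) / 2"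
    using exponent_exists[OF \<theta>, of "2 ^ CARD('n) * 4"] by auto
  define C where "C = 4 powr \<epsilon> * 2 / (1 - \<theta>)"
  have C0: "0 \<le> C" using \<theta> by (simp add: C_def)
  define q' where "q' = P * (1 + \<epsilon>)"
  have q': "P < q'" using P \<epsilon> by (simp add: q'_def)
  define q where "q = q' / (q' - 1)"
  have q: "1 < q" "1 / q + 1 / (P * (1 + \<epsilon>)) = 1" "q < P / (P - 1)"
    using q' P unfolding q'_def[symmetric] by (auto simp: q_def field_simps)
  define K where "K = 3 * C powr (1 / (P * (1 + \<epsilon>)))"
  have "(\<integral>\<^sup>+x\<in>cube x0 l. ennreal (g x) * a x \<partial>lebesgue) \<le>
        ennreal K * ennreal (l ^ CARD('n)) * ennpowr (cube_avg (\<lambda>x. ennpowr (a x) P) x0 l) (1 / P) *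
        ennpowr (cube_avg (\<lambda>x. ennpowr (ennreal (g x)) q) x0 l) (1 / q)"
    if a [measurable]: "a \<in> borel_measurable lebesgue" and g [measurable]: "g \<in> borel_measurable lebesgue"
      and g0: "\<And>x. 0 \<le> g x"
      and A: "Ainfty \<theta> (\<lambda>x. ennpowr (a x) P)" and l: "0 < l"
    for a :: "real^'n \<Rightarrow> ennreal" and g x0 l
  proof -
    let ?w = "\<lambda>x. ennpowr (a x) P"
    let ?K = "ennreal K * ennreal (l ^ CARD('n)) * ennpowr (cube_avg ?w x0 l) (1 / P)"
    have E: "dyadic_energy ?w (1 + \<epsilon>) k x0 l \<le> ennreal C * dyadic_energy ?w (1 + \<epsilon>) 0 x0 l" for k
      unfolding C_def by (rule dyadic_energy_bound[OF _ A \<theta> \<epsilon> l]) simp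
    have fin: "(\<integral>\<^sup>+x\<in>cube x0 l. ?w x \<partial>lebesgue) < top"
      using A l by (auto simp: Ainfty_def)
    have Kfin: "?K < top"
      using fin l by (simp add: cube_avg_def ennreal_mult_eq_top_iff ennreal_divide_eq_top_iff less_top[symmetric])
    have bdd: "(\<integral>\<^sup>+x\<in>cube x0 l. ennreal (min (g x) (real N)) * a x \<partial>lebesgue) \<le>
      ?K * ennpowr (cube_avg (\<lambda>x. ennpowr (ennreal (min (g x) (real N))) q) x0 l) (1 / q)" for N :: nat
    proof (rule bilinear_bounded[OF a _ q(1) _ _ l Kfin, where B = "real N"])
      show "(\<integral>\<^sup>+x\<in>cube x0 l. ennreal (k x) * a x \<partial>lebesgue) \<le>
        ?K * ennpowr (cube_avg (\<lambda>x. ennpowr (ennreal (k x)) q) x0 l) (1 / q)"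
        if "continuous_on UNIV k" "0 < c" "\<And>x. c \<le> k x" for k c
        unfolding K_def by (rule bilinear_continuous[OF a that(1) P \<epsilon>(1) q(1,2) that(2,3) l C0 E])
    qed (use g0 in auto)
    have mono: "cube_avg (\<lambda>x. ennpowr (ennreal (min (g x) (real N))) q) x0 l \<le> cube_avg (\<lambda>x. ennpowr (ennreal (g x)) q) x0 l" for N
      unfolding cube_avg_def using q(1)
      by (intro divide_right_mono_ennreal nn_integral_mono mult_right_mono ennpowr_mono ennreal_leI) auto
    have "(\<integral>\<^sup>+x\<in>cube x0 l. ennreal (g x) * a x \<partial>lebesgue) =
      (\<integral>\<^sup>+x. (SUP N. ennreal (min (g x) (real N)) * a x * indicator (cube x0 l) x) \<partial>lebesgue)"
    proof (intro nn_integral_cong)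
      fix x
      obtain N0 :: nat where N0: "g x \<le> real N0" using real_arch_simple by blast
      show "ennreal (g x) * a x * indicator (cube x0 l) x = (SUP N. ennreal (min (g x) (real N)) * a x * indicator (cube x0 l) x)"
      proof (intro antisym SUP_least)
        show "ennreal (g x) * a x * indicator (cube x0 l) x \<le> (SUP N. ennreal (min (g x) (real N)) * a x * indicator (cube x0 l) x)"
          using N0 by (intro SUP_upper2[of N0]) (auto simp: min_absorb1)
      qed (auto intro!: mult_right_mono ennreal_leI)
    qed
    also have "\<dots> = (SUP N. \<integral>\<^sup>+x\<in>cube x0 l. ennreal (min (g x) (real N)) * a x \<partial>lebesgue)"
      by (intro nn_integral_monotone_convergence_SUP)
        (auto simp: incseq_def le_fun_def intro!: mult_right_mono ennreal_leI)
    also have "\<dots> \<le> ?K * ennpowr (cube_avg (\<lambda>x. ennpowr (ennreal (g x)) q) x0 l) (1 / q)"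
      using q(1) by (intro SUP_least order_trans[OF bdd] mult_left_mono ennpowr_mono mono) auto
    finally show ?thesis .
  qed
  moreover have "0 \<le> K" by (simp add: K_def)
  ultimately show ?thesis using that[OF q(1,3)] by blast
qed

subsection \<open>Functional analysis\<close>

text \<open>Baire's theorem will be applied to a seminorm on \<open>'a cdual\<close>, so the dual
  has to be complete. The limit is formed pointwise; letting \<open>m\<close> tend to infinity in
  the Cauchy estimate then gives convergence in norm.\<close>

instance cblinfun :: (complex_normed_vector, complex_banach) complex_banach
proof
  fix X :: "nat \<Rightarrow> ('a \<Rightarrow>\<^sub>C\<^sub>L 'b)" assume X: "Cauchy X"
  have apply_minus: "cblinfun_apply (S - T) x = cblinfun_apply S x - cblinfun_apply T x" for S T :: "'a \<Rightarrow>\<^sub>C\<^sub>L 'b" and x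
    unfolding minus_cblinfun_def uminus_cblinfun_def
    by transfer (metis (no_types) add.inverse_inverse diff_conv_add_uminus of_real_1 of_real_minus scaleC_of_real scaleR_minus1_left)
  have norm_le: "norm (cblinfun_apply T x) \<le> norm T * norm x" for T :: "'a \<Rightarrow>\<^sub>C\<^sub>L 'b" and x
    by transfer (auto simp: bounded_clinear_def onorm)
  have normI: "norm T \<le> b" if "\<And>x. norm (cblinfun_apply T x) \<le> b * norm x" "0 \<le> b" for T :: "'a \<Rightarrow>\<^sub>C\<^sub>L 'b" and b
    using that by transfer (auto intro: onorm_bound)
  have c: "Cauchy (\<lambda>n. cblinfun_apply (X n) x)" for x
  proof (rule metric_CauchyI)
    fix e :: real assume "e > 0"
    then have "e / (norm x + 1) > 0" by (simp add: add_nonneg_pos)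
    then obtain M where M: "\<forall>m\<ge>M. \<forall>n\<ge>M. dist (X m) (X n) < e / (norm x + 1)"
      using X unfolding Cauchy_def by blast
    have "dist (cblinfun_apply (X m) x) (cblinfun_apply (X n) x) < e" if "m \<ge> M" "n \<ge> M" for m n
    proof -
      have "dist (cblinfun_apply (X m) x) (cblinfun_apply (X n) x) \<le> dist (X m) (X n) * norm x"
        using norm_le[of "X m - X n" x] by (simp add: dist_norm apply_minus)
      also have "\<dots> \<le> dist (X m) (X n) * (norm x + 1)" by (intro mult_left_mono) auto
      also have "\<dots> < e / (norm x + 1) * (norm x + 1)"
        using M that by (intro mult_strict_right_mono) (auto simp: add_nonneg_pos)
      also have "\<dots> = e" by (simp add: add_nonneg_eq_0_iff)
      finally show ?thesis .
    qed
    then show "\<exists>M. \<forall>m\<ge>M. \<forall>n\<ge>M. dist (cblinfun_apply (X m) x) (cblinfun_apply (X n) x) < e" by blast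
  qed
  define L where "L x = lim (\<lambda>n. cblinfun_apply (X n) x)" for x
  have L: "(\<lambda>n. cblinfun_apply (X n) x) \<longlonglongrightarrow> L x" for x
    unfolding L_def using c[of x] by (simp add: Cauchy_convergent_iff convergent_LIMSEQ_iff)
  have lin: "bounded_linear (cblinfun_apply (X n))" for n by (rule bounded_linear_cblinfun_apply)
  obtain B where B: "\<And>n. norm (X n) \<le> B"
    using Cauchy_Bseq[OF X] by (auto simp: Bseq_def)
  have "bounded_clinear L"
    unfolding bounded_clinear_def
  proof (intro conjI allI bounded_linear_intro[where K = B])
    fix x y
    have "(\<lambda>n. cblinfun_apply (X n) (x + y)) \<longlonglongrightarrow> L x + L y"
      using tendsto_add[OF L[of x] L[of y]] by (simp add: linear_add bounded_linear.linear[OF lin])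
    then show "L (x + y) = L x + L y" using L LIMSEQ_unique by blast
  next
    fix r x
    have "(\<lambda>n. cblinfun_apply (X n) (r *\<^sub>R x)) \<longlonglongrightarrow> r *\<^sub>R L x"
      using tendsto_scaleR[OF tendsto_const L[of x], of r] by (simp add: linear_scale bounded_linear.linear[OF lin])
    then show "L (r *\<^sub>R x) = r *\<^sub>R L x" using L LIMSEQ_unique by blast
  next
    fix x
    show "norm (L x) \<le> norm x * B"
    proof (rule LIMSEQ_le_const2[OF tendsto_norm[OF L]])
      show "\<exists>N. \<forall>n\<ge>N. norm (cblinfun_apply (X n) x) \<le> norm x * B"
        using order_trans[OF norm_le mult_right_mono[OF B]] by (metis mult.commute norm_ge_zero)
    qed
  next
    fix c x
    have "bounded_linear (\<lambda>y::'b. c *\<^sub>C y)"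
    proof (rule bounded_linear_intro[where K = "cmod c"])
      show "c *\<^sub>C r *\<^sub>R y = r *\<^sub>R c *\<^sub>C y" for r and y :: 'b
        by (simp only: scaleC_of_real[symmetric] scaleC_scaleC mult.commute)
    qed (simp_all add: scaleC_add_right norm_scaleC mult.commute)
    then have "(\<lambda>n. c *\<^sub>C cblinfun_apply (X n) x) \<longlonglongrightarrow> c *\<^sub>C L x"
      using L by (rule bounded_linear.tendsto)
    moreover have "c *\<^sub>C cblinfun_apply (X n) x = cblinfun_apply (X n) (c *\<^sub>C x)" for n
      using bounded_clinear_cblinfun_apply[of "X n"] by (simp add: bounded_clinear_def)
    ultimately have "(\<lambda>n. cblinfun_apply (X n) (c *\<^sub>C x)) \<longlonglongrightarrow> c *\<^sub>C L x" by simp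
    then show "L (c *\<^sub>C x) = c *\<^sub>C L x" by (rule LIMSEQ_unique[OF L])
  qed
  then obtain T where T: "cblinfun_apply T = L" using CBlinfun_inverse by blast
  have "X \<longlonglongrightarrow> T"
  proof (rule metric_LIMSEQ_I)
    fix e :: real assume "e > 0"
    then have "e / 2 > 0" by simp
    then obtain M where M: "\<forall>m\<ge>M. \<forall>n\<ge>M. dist (X m) (X n) < e / 2"
      using X unfolding Cauchy_def by blast
    have "norm (X n - T) \<le> e / 2" if n: "n \<ge> M" for n
    proof (rule normI)
      fix x
      have "norm (cblinfun_apply (X n) x - L x) \<le> e / 2 * norm x"
      proof (rule LIMSEQ_le_const2[OF tendsto_norm[OF tendsto_diff[OF tendsto_const L]]])
        have "norm (cblinfun_apply (X n) x - cblinfun_apply (X m) x) \<le> e / 2 * norm x" if "m \<ge> M" for m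
        proof -
          have "norm (cblinfun_apply (X n) x - cblinfun_apply (X m) x) \<le> norm (X n - X m) * norm x"
            using norm_le[of "X n - X m" x] by (simp add: apply_minus)
          also have "\<dots> \<le> e / 2 * norm x"
            using M n that by (intro mult_right_mono) (auto simp: dist_norm less_imp_le)
          finally show ?thesis .
        qed
        then show "\<exists>N. \<forall>m\<ge>N. norm (cblinfun_apply (X n) x - cblinfun_apply (X m) x) \<le> e / 2 * norm x" by blast
      qed
      then show "norm (cblinfun_apply (X n - T) x) \<le> e / 2 * norm x" by (simp add: apply_minus T)
    qed (use \<open>e > 0\<close> in simp)
    then have "dist (X n) T < e" if "n \<ge> M" for n
      using that \<open>e > 0\<close> by (fastforce simp: dist_norm intro: le_less_trans[of _ "e / 2"])
    then show "\<exists>M. \<forall>n\<ge>M. dist (X n) T < e" by blast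
  qed
  then show "convergent X" by (auto simp: convergent_def)
qed

section \<open>The Hahn--Banach theorem\<close>

definition sublinear :: "('a::real_vector \<Rightarrow> real) \<Rightarrow> bool"
  where "sublinear q \<longleftrightarrow> (\<forall>x y. q (x + y) \<le> q x + q y) \<and> (\<forall>t>0. \<forall>x. q (t *\<^sub>R x) \<le> t * q x)"

lemma sublinear_0: "sublinear q \<Longrightarrow> q 0 = 0"
proof -
  assume q: "sublinear q"
  have "q (0 + 0) \<le> q 0 + q 0" using q unfolding sublinear_def by blast
  moreover have "q ((1/2) *\<^sub>R 0) \<le> 1/2 * q 0" using q unfolding sublinear_def
    by (metis half_gt_zero zero_less_one)
  ultimately show ?thesis by simp
qed

lemma sublinear_minus_le: "sublinear q \<Longrightarrow> - q (- x) \<le> q x"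
proof -
  assume q: "sublinear q"
  have "q (x + - x) \<le> q x + q (- x)" using q unfolding sublinear_def by blast
  then show ?thesis using sublinear_0[OF q] by simp
qed

lemma sublinear_scale:
  assumes q: "sublinear q" and t: "0 \<le> t"
  shows "q (t *\<^sub>R x) = t * q x"
proof (cases "t = 0")
  case False
  with t have t: "t > 0" by simp
  have "q (inverse t *\<^sub>R (t *\<^sub>R x)) \<le> inverse t * q (t *\<^sub>R x)"
    using q t unfolding sublinear_def by (meson inverse_positive_iff_positive)
  then have "t * q x \<le> q (t *\<^sub>R x)" using t by (simp add: field_simps)
  moreover have "q (t *\<^sub>R x) \<le> t * q x" using q t unfolding sublinear_def by blast
  ultimately show ?thesis by simp
qed (simp add: sublinear_0[OF q])

text \<open>Lowering \<open>q\<close> as far as possible in the direction \<open>- y\<close> without leaving the sublinear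
  functionals; a minimal sublinear functional is a fixed point for every \<open>y\<close> and hence linear.\<close>

lemma sublinear_shift:
  assumes q: "sublinear q"
  obtains q' where "sublinear q'" "q' \<le> q" "q' (- y) \<le> - q y"
proof -
  define q' where "q' x = (INF t\<in>{0..}. q (x + t *\<^sub>R y) - t * q y)" for x
  have sub: "q (x + z) \<le> q x + q z" for x z using q unfolding sublinear_def by blast
  have low: "- q (- x) \<le> q (x + t *\<^sub>R y) - t * q y" if "0 \<le> t" for x t
    using sub[of "x + t *\<^sub>R y" "- x"] sublinear_scale[OF q that, of y] by simp
  have bdd: "bdd_below ((\<lambda>t. q (x + t *\<^sub>R y) - t * q y) ` {0..})" for x
    using low by (intro bdd_belowI2) auto
  have upper: "q' x \<le> q (x + t *\<^sub>R y) - t * q y" if "0 \<le> t" for x t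
    unfolding q'_def using that by (intro cINF_lower bdd) auto
  have "sublinear q'"
    unfolding sublinear_def
  proof (intro conjI allI impI)
    fix x z
    have "q' (x + z) - (q (z + s *\<^sub>R y) - s * q y) \<le> q (x + t *\<^sub>R y) - t * q y" if "0 \<le> s" "0 \<le> t" for s t
      using upper[of "s + t" "x + z"] that sub[of "x + t *\<^sub>R y" "z + s *\<^sub>R y"] by (simp add: algebra_simps)
    then have "q' (x + z) - (q (z + s *\<^sub>R y) - s * q y) \<le> q' x" if "0 \<le> s" for s
      unfolding q'_def[of x] using that by (intro cINF_greatest) auto
    then have "q' (x + z) - q' x \<le> q (z + s *\<^sub>R y) - s * q y" if "0 \<le> s" for s
      using that by (simp add: algebra_simps)
    then have "q' (x + z) - q' x \<le> q' z"
      unfolding q'_def[of z] by (intro cINF_greatest) auto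
    then show "q' (x + z) \<le> q' x + q' z" by simp
  next
    fix c :: real and x assume c: "0 < c"
    have "q' (c *\<^sub>R x) / c \<le> q (x + t *\<^sub>R y) - t * q y" if "0 \<le> t" for t
    proof -
      have "q' (c *\<^sub>R x) \<le> q (c *\<^sub>R (x + t *\<^sub>R y)) - c * t * q y"
        using upper[of "c * t" "c *\<^sub>R x"] that c by (simp add: scaleR_add_right)
      also have "q (c *\<^sub>R (x + t *\<^sub>R y)) = c * q (x + t *\<^sub>R y)" using c by (intro sublinear_scale q) simp
      finally show ?thesis using c by (simp add: field_simps)
    qed
    then have "q' (c *\<^sub>R x) / c \<le> q' x" unfolding q'_def[of x] by (intro cINF_greatest) auto
    then show "q' (c *\<^sub>R x) \<le> c * q' x" using c by (simp add: field_simps)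
  qed
  moreover have "q' \<le> q" using upper[of 0] by (simp add: le_fun_def)
  moreover have "q' (- y) \<le> - q y" using upper[of 1 "- y"] sublinear_0[OF q] by simp
  ultimately show ?thesis by (rule that)
qed

text \<open>Zorn's lemma for the reversed pointwise order. The pointwise infimum bounds a chain from
  below; it is finite because every \<open>q \<le> p\<close> satisfies
  \<open>- p (- x) \<le> q x\<close>.\<close>

lemma minimal_sublinear:
  fixes p :: "'a::real_vector \<Rightarrow> real"
  assumes p: "sublinear p"
  obtains q where "sublinear q" "q \<le> p" "\<And>q'. sublinear q' \<Longrightarrow> q' \<le> q \<Longrightarrow> q' = q"
proof -
  let ?A = "{q. sublinear q \<and> q \<le> p}"
  have "\<exists>m\<in>?A. \<forall>a\<in>?A. a \<le> m \<longrightarrow> a = m"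
  proof (rule predicate_Zorn)
    show "partial_order_on ?A (relation_of (\<lambda>m a. a \<le> m) ?A)"
      by (auto simp: partial_order_on_def preorder_on_def relation_of_def refl_on_def trans_def antisym_def)
  next
    fix C assume C: "C \<in> Chains (relation_of (\<lambda>m a. a \<le> m) ?A)"
    show "\<exists>u\<in>?A. \<forall>a\<in>C. u \<le> a"
    proof (cases "C = {}")
      case True
      then show ?thesis using p by auto
    next
      case False
      have CA: "sublinear q" "q \<le> p" if "q \<in> C" for q
        using C that by (auto simp: Chains_def relation_of_def)
      have tot: "q \<le> q' \<or> q' \<le> q" if "q \<in> C" "q' \<in> C" for q q'
        using C that by (auto simp: Chains_def relation_of_def)
      define u where "u x = (INF q\<in>C. q x)" for x
      have "- p (- x) \<le> q x" if "q \<in> C" for q x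
        using sublinear_minus_le[OF CA(1)[OF that], of x] le_funD[OF CA(2)[OF that], of "- x"] by simp
      then have bdd: "bdd_below ((\<lambda>q. q x) ` C)" for x by (intro bdd_belowI2) auto
      have upper: "u x \<le> q x" if "q \<in> C" for q x
        unfolding u_def using that by (intro cINF_lower bdd)
      have "sublinear u"
        unfolding sublinear_def
      proof (intro conjI allI impI)
        fix x y
        \<comment> \<open>Two members of a chain are comparable, and subadditivity of the smaller
          one bounds the infimum at \<open>x + y\<close>. Infima over \<open>q\<close> and
          \<open>q'\<close> can then be taken independently.\<close>
        have "u (x + y) - q y \<le> q' x" if "q \<in> C" "q' \<in> C" for q q'
        proof (cases "q \<le> q'")
          case True
          then have "q (x + y) \<le> q' x + q y"
            using CA(1)[OF that(1)] le_funD[OF True, of x] unfolding sublinear_def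
            by (meson add_le_cancel_right order_trans)
          then show ?thesis using upper[OF that(1), of "x + y"] by simp
        next
          case False
          then have "q' \<le> q" using tot that by blast
          then have "q' (x + y) \<le> q' x + q y"
            using CA(1)[OF that(2)] le_funD[OF \<open>q' \<le> q\<close>, of y] unfolding sublinear_def
            by (meson add_le_cancel_left order_trans)
          then show ?thesis using upper[OF that(2), of "x + y"] by simp
        qed
        then have "u (x + y) - q y \<le> u x" if "q \<in> C" for q
          unfolding u_def[of x] using that False by (intro cINF_greatest) auto
        then have "u (x + y) - u x \<le> q y" if "q \<in> C" for q
          using that by (simp add: algebra_simps)
        then have "u (x + y) - u x \<le> u y"
          unfolding u_def[of y] using False by (intro cINF_greatest) auto
        then show "u (x + y) \<le> u x + u y" by simp
      next
        fix t :: real and x assume t: "0 < t"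
        have "u (t *\<^sub>R x) / t \<le> q x" if "q \<in> C" for q
          using upper[OF that, of "t *\<^sub>R x"] sublinear_scale[OF CA(1)[OF that], of t x] t by (simp add: field_simps)
        then have "u (t *\<^sub>R x) / t \<le> u x" unfolding u_def[of x] using False by (intro cINF_greatest) auto
        then show "u (t *\<^sub>R x) \<le> t * u x" using t by (simp add: field_simps)
      qed
      moreover have "u \<le> a" if "a \<in> C" for a using upper[OF that] by (simp add: le_fun_def)
      moreover have "u \<le> p" using False calculation(2) CA(2) by (meson all_not_in_conv order_trans)
      ultimately show ?thesis by blast
    qed
  qed
  then show ?thesis using that by (metis (no_types, lifting) mem_Collect_eq order_trans)
qed

text \<open>Nothing is extended from a subspace. A shift in the direction \<open>v\<close> gives
  \<open>p' (- v) \<le> - p v\<close>, which every linear \<open>f \<le> p'\<close> inherits, and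
  this forces \<open>f v = p v\<close>. Minimality makes \<open>f\<close> odd, and an odd sublinear
  functional is linear.\<close>

theorem Hahn_Banach_real:
  fixes p :: "'a::real_vector \<Rightarrow> real"
  assumes p: "sublinear p"
  obtains f where "linear f" "f \<le> p" "f v = p v"
proof -
  obtain p' where p': "sublinear p'" "p' \<le> p" "p' (- v) \<le> - p v"
    by (rule sublinear_shift[OF p])
  obtain f where f: "sublinear f" "f \<le> p'" and min: "\<And>q'. sublinear q' \<Longrightarrow> q' \<le> f \<Longrightarrow> q' = f"
    using minimal_sublinear[OF p'(1)] by blast
  have neg: "f (- y) = - f y" for y
  proof -
    obtain q where "sublinear q" "q \<le> f" "q (- y) \<le> - f y"
      by (rule sublinear_shift[OF f(1)])
    then have "f (- y) \<le> - f y" using min by blast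
    then show ?thesis using sublinear_minus_le[OF f(1), of "- y"] by simp
  qed
  have "linear f"
  proof (rule linearI)
    fix x y
    have "f (x + y + - y) \<le> f (x + y) + f (- y)" "f (x + y) \<le> f x + f y"
      using f(1) unfolding sublinear_def by blast+
    then show "f (x + y) = f x + f y" by (simp add: neg)
  next
    fix r x
    show "f (r *\<^sub>R x) = r *\<^sub>R f x"
    proof (cases "0 \<le> r")
      case False
      then have "f ((- r) *\<^sub>R (- x)) = - r * f (- x)" by (intro sublinear_scale f) simp
      then show ?thesis by (simp add: neg)
    qed (simp add: sublinear_scale[OF f(1)])
  qed
  moreover have "f \<le> p" using f(2) p'(2) by simp
  moreover have "p v \<le> f v" using le_funD[OF f(2), of "- v"] p'(3) by (simp add: neg)
  then have "f v = p v" using le_funD[OF \<open>f \<le> p\<close>, of v] by simp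
  ultimately show ?thesis by (rule that)
qed

lemma scaleC_simps [simp]:
  fixes x :: "'a::complex_normed_vector"
  shows "c *\<^sub>C (0::'a) = 0" "0 *\<^sub>C x = 0" "1 *\<^sub>C x = x" "c *\<^sub>C (- x) = - (c *\<^sub>C x)"
    "c *\<^sub>C (x - y) = c *\<^sub>C x - c *\<^sub>C y"
proof -
  show 0: "c *\<^sub>C (0::'a) = 0" using norm_scaleC[of c "0::'a"] by simp
  show "0 *\<^sub>C x = 0" using norm_scaleC[of 0 x] by simp
  show "1 *\<^sub>C x = x" using scaleC_of_real[of 1 x] by simp
  show neg: "c *\<^sub>C (- x) = - (c *\<^sub>C x)" for x :: 'a
    using scaleC_add_right[of c x "- x"] 0 minus_unique[of "c *\<^sub>C x" "c *\<^sub>C (- x)"] by simp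
  show "c *\<^sub>C (x - y) = c *\<^sub>C x - c *\<^sub>C y"
    using scaleC_add_right[of c x "- y"] neg[of y] by simp
qed

theorem Hahn_Banach_seminorm:
  fixes \<rho> :: "'a::complex_normed_vector \<Rightarrow> real"
  assumes add: "\<And>x y. \<rho> (x + y) \<le> \<rho> x + \<rho> y" and scale: "\<And>c x. \<rho> (c *\<^sub>C x) = cmod c * \<rho> x"
    and bd: "\<And>x. \<rho> x \<le> B * norm x"
  obtains \<phi> :: "'a cdual" where "cblinfun_apply \<phi> v = of_real (\<rho> v)" "\<And>x. cmod (cblinfun_apply \<phi> x) \<le> \<rho> x"
proof -
  have "sublinear \<rho>"
    unfolding sublinear_def using add scale[of "of_real t" for t] by (auto simp: scaleC_of_real)
  then obtain f where f: "linear f" "f \<le> \<rho>" "f v = \<rho> v"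
    by (rule Hahn_Banach_real)
  \<comment> \<open>A complex-linear functional is determined by its real part in this way.\<close>
  define F where "F x = Complex (f x) (- f (\<i> *\<^sub>C x))" for x
  have FC: "F (c *\<^sub>C x) = c * F x" for c x
  proof -
    have "c *\<^sub>C y = Re c *\<^sub>R y + Im c *\<^sub>R (\<i> *\<^sub>C y)" for y :: 'a
      by (subst complex_eq[of c]) (simp only: scaleC_add_left scaleC_of_real[symmetric] scaleC_scaleC mult.commute)
    then have fc: "f (c *\<^sub>C y) = Re c * f y + Im c * f (\<i> *\<^sub>C y)" for y
      by (simp add: linear_add[OF f(1)] linear_scale[OF f(1)])
    have "f (\<i> *\<^sub>C (c *\<^sub>C x)) = f (c *\<^sub>C (\<i> *\<^sub>C x))" by (simp only: scaleC_scaleC mult.commute)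
    also have "\<dots> = Re c * f (\<i> *\<^sub>C x) + Im c * f (\<i> *\<^sub>C \<i> *\<^sub>C x)" by (rule fc)
    also have "\<i> *\<^sub>C \<i> *\<^sub>C x = - x" using scaleC_of_real[of "- 1" x] by (simp add: scaleC_scaleC)
    finally have "f (\<i> *\<^sub>C (c *\<^sub>C x)) = Re c * f (\<i> *\<^sub>C x) - Im c * f x" by (simp add: linear_neg f)
    then show ?thesis by (simp add: F_def fc complex_eq_iff)
  qed
  have Fadd: "F (x + y) = F x + F y" for x y
    by (simp add: F_def complex_eq_iff scaleC_add_right linear_add f)
  have Fle: "cmod (F x) \<le> \<rho> x" for x
  proof (cases "F x = 0")
    case True
    have "0 \<le> \<rho> x" using add[of x "- x"] scale[of "- 1" x] scale[of 0 x] scaleC_of_real[of "- 1" x] by simp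
    then show ?thesis using True by simp
  next
    case False
    \<comment> \<open>A unimodular factor that rotates \<open>F x\<close> onto the positive real
      axis, where \<open>F\<close> coincides with \<open>f\<close>.\<close>
    define c where "c = cnj (F x) / cmod (F x)"
    have c: "cmod c = 1" using False by (simp add: c_def norm_divide)
    have "c * F x = of_real (cmod (F x))"
      using False complex_norm_square[of "F x"] by (simp add: c_def power2_eq_square field_simps)
    then have "cmod (F x) = Re (F (c *\<^sub>C x))" by (simp add: FC)
    also have "\<dots> = f (c *\<^sub>C x)" by (simp add: F_def)
    also have "\<dots> \<le> \<rho> (c *\<^sub>C x)" using f(2) by (simp add: le_fun_def)
    also have "\<dots> = \<rho> x" using c scale by simp
    finally show ?thesis .
  qed
  have "bounded_clinear F"
    unfolding bounded_clinear_def
  proof (intro conjI allI bounded_linear_intro[where K = B])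
    show "F (r *\<^sub>R x) = r *\<^sub>R F x" for r x
      using FC[of "of_real r" x] by (simp add: scaleC_of_real scaleR_conv_of_real)
    show "norm (F x) \<le> norm x * B" for x using order_trans[OF Fle bd] by (simp add: mult.commute)
  qed (simp_all add: Fadd FC scaleC_complex_def)
  then obtain \<phi> where \<phi>: "cblinfun_apply \<phi> = F" using CBlinfun_inverse by blast
  \<comment> \<open>The real part already attains the bound on the modulus, which leaves no room for
    an imaginary part.\<close>
  have "Re (F v) = \<rho> v" by (simp add: F_def f(3))
  moreover have "cmod (F v) \<le> \<rho> v" by (rule Fle)
  ultimately have "(Im (F v))\<^sup>2 \<le> 0"
    using cmod_power2[of "F v"] power_mono[of "cmod (F v)" "\<rho> v" 2] by simp
  then have "Im (F v) = 0" by simp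
  then have "F v = of_real (\<rho> v)" using \<open>Re (F v) = \<rho> v\<close> by (simp add: complex_eq_iff)
  then show ?thesis using that[of \<phi>] Fle \<phi> by simp
qed

text \<open>Uniform boundedness: the closed sublevel sets cover the space, so by Baire one contains
  a ball around some \<open>x0\<close>. There
  \<open>N y \<le> N (x0 + y) + N x0 \<le> 2 * k\<close>, and homogeneity extends the bound to all
  vectors.\<close>

lemma closed_seminorm_bounded:
  fixes N :: "'a::banach \<Rightarrow> ennreal"
  assumes add: "\<And>x y. N (x + y) \<le> N x + N y" and scale: "\<And>t x. N (t *\<^sub>R x) = ennreal \<bar>t\<bar> * N x"
    and closed: "\<And>k::nat. closed {x. N x \<le> of_nat k}" and fin: "\<And>x. N x < top"
  obtains B where "0 \<le> B" "\<And>x. N x \<le> ennreal (B * norm x)"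
proof -
  have mc: "Metric_space.mcomplete (UNIV :: 'a set) dist"
    unfolding Met_TC.mcomplete_def Met_TC.MCauchy_def
    by (auto simp: Cauchy_def dest!: Cauchy_convergent[unfolded Cauchy_def convergent_def])
  have "\<exists>k. interior {x. N x \<le> of_nat k} \<noteq> {}"
  proof (rule ccontr)
    assume "\<not> ?thesis"
    then have "Met_TC.mtopology interior_of \<Union>(range (\<lambda>k. {x. N x \<le> of_nat k})) = {}"
      using closed by (intro Met_TC.metric_Baire_category_alt mc) (auto simp: euclidean_interior_of)
    moreover have "\<Union>(range (\<lambda>k. {x. N x \<le> of_nat k})) = UNIV"
    proof (intro set_eqI iffI)
      fix x
      obtain k where "N x < of_nat k" using ennreal_Ex_less_of_nat[of "N x"] fin by auto
      then show "x \<in> \<Union>(range (\<lambda>k. {x. N x \<le> of_nat k}))" by (auto intro: less_imp_le)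
    qed simp
    ultimately show False by (simp add: euclidean_interior_of)
  qed
  then obtain k x0 where "x0 \<in> interior {x. N x \<le> of_nat k}" by blast
  then obtain r where r: "r > 0" "cball x0 r \<subseteq> {x. N x \<le> of_nat k}"
    by (meson interior_subset open_contains_cball open_interior subset_trans)
  have neg: "N (- x) = N x" for x using scale[of "- 1" x] by simp
  have N0: "N 0 = 0" using scale[of 0 0] by simp
  have small: "N y \<le> ennreal (2 * real k)" if "norm y \<le> r" for y
  proof -
    have "N (x0 + y) \<le> of_nat k" "N x0 \<le> of_nat k"
      using r that by (auto simp: dist_norm subset_iff)
    moreover have "N ((x0 + y) + - x0) \<le> N (x0 + y) + N (- x0)" by (rule add)
    ultimately have "N y \<le> of_nat k + of_nat k"
      unfolding neg by (simp add: add_mono order_trans)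
    then show ?thesis by (simp add: ennreal_of_nat_eq_real_of_nat flip: ennreal_plus)
  qed
  have "N x \<le> ennreal (2 * real k / r * norm x)" for x
  proof (cases "x = 0")
    case False
    define t where "t = norm x / r"
    have t: "t > 0" using False r by (simp add: t_def)
    have "N x = N (t *\<^sub>R (inverse t *\<^sub>R x))" using t by simp
    also have "\<dots> = ennreal t * N (inverse t *\<^sub>R x)" using t by (simp only: scale) simp
    also have "\<dots> \<le> ennreal t * ennreal (2 * real k)"
      using t r by (intro mult_left_mono small) (auto simp: t_def)
    also have "\<dots> = ennreal (2 * real k / r * norm x)"
      using t by (simp add: t_def mult.commute flip: ennreal_mult)
    finally show ?thesis .
  qed (simp add: N0)
  then show ?thesis using that[of "2 * real k / r"] r by simp
qed

subsection \<open>Strong measurability and shells\<close>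

lemma is_cube_iff: "is_cube Q \<longleftrightarrow> (\<exists>a l. 0 < l \<and> Q = cube a l)"
  by (auto simp: is_cube_def cube_def)

text \<open>Simple functions have finite range, so composing them with \<open>h\<close> preserves
  measurability in every target; separability of the domain of \<open>h\<close> does not enter,
  because only the limit of scalar-like compositions in a metric space is taken.\<close>

lemma strongly_measurable_continuous:
  fixes h :: "'a::real_normed_vector \<Rightarrow> 'b::metric_space"
  assumes "strongly_measurable f" "continuous_on UNIV h"
  shows "(\<lambda>x. h (f x)) \<in> borel_measurable lebesgue"
proof -
  obtain s where s: "\<And>k::nat. simple_function lebesgue (s k)" "\<And>x. (\<lambda>k. s k x) \<longlonglongrightarrow> f x"
    using assms(1) unfolding strongly_measurable_def by blast
  have "(\<lambda>x. h (s k x)) \<in> borel_measurable lebesgue" for k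
    using simple_function_compose[OF s(1)[of k], of h] by (intro borel_measurable_simple_function) (simp add: comp_def)
  moreover have "(\<lambda>k. h (s k x)) \<longlonglongrightarrow> h (f x)" for x
    using continuous_on_tendsto_compose[OF assms(2) s(2)] by simp
  ultimately show ?thesis by (rule borel_measurable_LIMSEQ_metric)
qed

lemma strongly_measurable_norm:
  "strongly_measurable f \<Longrightarrow> (\<lambda>x. norm (f x)) \<in> borel_measurable lebesgue"
  by (rule strongly_measurable_continuous[OF _ continuous_on_norm[OF continuous_on_id]])

lemma strongly_measurable_simple:
  "simple_function lebesgue s \<Longrightarrow> strongly_measurable s"
  unfolding strongly_measurable_def by (intro exI[of _ "\<lambda>_. s"]) auto

lemma strongly_measurable_diff:
  assumes "strongly_measurable f" "strongly_measurable g"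
  shows "strongly_measurable (\<lambda>x. f x - g x)"
proof -
  obtain s where s: "\<And>k::nat. simple_function lebesgue (s k)" "\<And>x. (\<lambda>k. s k x) \<longlonglongrightarrow> f x"
    using assms(1) unfolding strongly_measurable_def by blast
  obtain t where t: "\<And>k::nat. simple_function lebesgue (t k)" "\<And>x. (\<lambda>k. t k x) \<longlonglongrightarrow> g x"
    using assms(2) unfolding strongly_measurable_def by blast
  show ?thesis
    unfolding strongly_measurable_def
  proof (intro exI[of _ "\<lambda>k x. s k x - t k x"] conjI allI)
    show "simple_function lebesgue (\<lambda>x. s k x - t k x)" for k
      by (rule simple_function_compose2[OF s(1) t(1)])
    show "(\<lambda>k. s k x - t k x) \<longlonglongrightarrow> f x - g x" for x by (intro tendsto_diff s t)
  qed
qed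

lemma norm_cblinfun_apply: "norm (cblinfun_apply T x) \<le> norm T * norm x"
  by transfer (auto simp: bounded_clinear_def onorm)

text \<open>Strong measurability of \<open>V\<close> concerns one fixed vector at a time. For a
  simple argument the function splits over its finitely many values; the general case follows since
  each \<open>V x\<close> is continuous.\<close>

lemma strongly_measurable_operator_norm:
  fixes V :: "real^'n \<Rightarrow> ('a::complex_normed_vector \<Rightarrow>\<^sub>C\<^sub>L 'b::complex_normed_vector)"
  assumes V: "\<And>e. strongly_measurable (\<lambda>x. V x e)" and f: "strongly_measurable f"
  shows "(\<lambda>x. norm (V x (f x))) \<in> borel_measurable lebesgue"
proof -
  obtain s where s: "\<And>k::nat. simple_function lebesgue (s k)" "\<And>x. (\<lambda>k. s k x) \<longlonglongrightarrow> f x"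
    using f unfolding strongly_measurable_def by blast
  have "(\<lambda>x. norm (V x (s k x))) \<in> borel_measurable lebesgue" for k
  proof -
    have fin: "finite (range (s k))" using s(1)[of k] by (simp add: simple_function_def)
    have meas: "s k -` {e} \<in> sets lebesgue" for e
      using simple_functionD(2)[OF s(1)[of k], of "{e}"] by simp
    have "norm (V x (s k x)) = (\<Sum>e\<in>range (s k). indicator (s k -` {e}) x * norm (V x e))" for x
    proof -
      have "(\<Sum>e\<in>range (s k). indicator (s k -` {e}) x * norm (V x e)) =
         (\<Sum>e\<in>range (s k). if e = s k x then norm (V x e) else 0)"
        by (intro sum.cong) (auto simp: indicator_def)
      also have "\<dots> = norm (V x (s k x))" using fin by (subst sum.delta) auto
      finally show ?thesis by simp
    qed
    moreover have "(\<lambda>x. \<Sum>e\<in>range (s k). indicator (s k -` {e}) x * norm (V x e)) \<in> borel_measurable lebesgue"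
      using V meas by (intro borel_measurable_sum borel_measurable_times borel_measurable_indicator strongly_measurable_norm)
    ultimately show ?thesis by simp
  qed
  moreover have "(\<lambda>k. norm (V x (s k x))) \<longlonglongrightarrow> norm (V x (f x))" for x
    by (intro tendsto_norm bounded_linear.tendsto[OF bounded_linear_cblinfun_apply] s)
  ultimately show ?thesis by (rule borel_measurable_LIMSEQ_metric)
qed

text \<open>Hoelder's inequality is applied to both terms of
  \<open>f * (f + g) powr (p - 1) + g * (f + g) powr (p - 1)\<close>; \<open>fin\<close> permits
  cancelling the common factor.\<close>

lemma Minkowski_nn_integral:
  fixes f g :: "'a \<Rightarrow> ennreal"
  assumes [measurable]: "f \<in> borel_measurable M" "g \<in> borel_measurable M" and p: "1 < p"
    and fin: "(\<integral>\<^sup>+x. ennpowr (f x + g x) p \<partial>M) < top"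
  shows "ennpowr (\<integral>\<^sup>+x. ennpowr (f x + g x) p \<partial>M) (1 / p) \<le>
    ennpowr (\<integral>\<^sup>+x. ennpowr (f x) p \<partial>M) (1 / p) + ennpowr (\<integral>\<^sup>+x. ennpowr (g x) p \<partial>M) (1 / p)"
proof -
  define p' where "p' = p / (p - 1)"
  have pp: "1 / p + 1 / p' = 1" "(p - 1) * p' = p" "1 < p'" using p by (auto simp: p'_def field_simps)
  let ?J = "\<integral>\<^sup>+x. ennpowr (f x + g x) p \<partial>M"
  let ?F = "ennpowr (\<integral>\<^sup>+x. ennpowr (f x) p \<partial>M) (1 / p)" and ?G = "ennpowr (\<integral>\<^sup>+x. ennpowr (g x) p \<partial>M) (1 / p)"
  have H: "(\<integral>\<^sup>+x. h x * ennpowr (f x + g x) (p - 1) \<partial>M) \<le>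
     ennpowr (\<integral>\<^sup>+x. ennpowr (h x) p \<partial>M) (1 / p) * ennpowr ?J (1 / p')"
    if [measurable]: "h \<in> borel_measurable M" for h
    using Hoelder_nn_integral[of h M "\<lambda>x. ennpowr (f x + g x) (p - 1)" p p', OF _ _ p pp(1)]
    by (simp add: ennpowr_ennpowr pp(2))
  have "?J = (\<integral>\<^sup>+x. f x * ennpowr (f x + g x) (p - 1) + g x * ennpowr (f x + g x) (p - 1) \<partial>M)"
    using ennpowr_add[of _ 1 "p - 1"] by (intro nn_integral_cong) (simp add: distrib_right)
  also have "\<dots> = (\<integral>\<^sup>+x. f x * ennpowr (f x + g x) (p - 1) \<partial>M) + (\<integral>\<^sup>+x. g x * ennpowr (f x + g x) (p - 1) \<partial>M)"
    by (intro nn_integral_add) auto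
  also have "\<dots> \<le> ?F * ennpowr ?J (1 / p') + ?G * ennpowr ?J (1 / p')"
    by (intro add_mono H) auto
  also have "\<dots> = ennpowr ?J (1 / p') * (?F + ?G)"
    unfolding mult.commute[of "ennpowr ?J (1 / p')" "?F + ?G"] by (rule distrib_right[symmetric])
  finally have "?J \<le> ennpowr ?J (1 / p') * (?F + ?G)" .
  moreover have "?J = ennpowr ?J (1 / p') * ennpowr ?J (1 / p)"
    using ennpowr_add[of ?J "1 / p'" "1 / p"] pp(1) by (simp add: add.commute)
  ultimately have *: "ennpowr ?J (1 / p') * ennpowr ?J (1 / p) \<le> ennpowr ?J (1 / p') * (?F + ?G)"
    by simp
  show ?thesis
  proof (cases "?J = 0")
    case False
    then show ?thesis using * fin by (simp add: ennreal_mult_le_mult_iff)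
  qed simp
qed

section \<open>Cubes around a point and sums over shells\<close>

definition centered_cube :: "real^'n \<Rightarrow> real \<Rightarrow> (real^'n) set"
  where "centered_cube x R = cube (x - vec R) (2 * R)"

lemma mem_centered_cube: "y \<in> centered_cube x R \<longleftrightarrow> (\<forall>i. - R \<le> y $ i - x $ i \<and> y $ i - x $ i < R)"
  by (auto simp: centered_cube_def cube_def algebra_simps)

lemma cube_avg_le_hl_max:
  fixes x :: "real^'n"
  assumes h: "h \<in> borel_measurable borel" and R: "0 < R"
  shows "cube_avg h (x - vec R) (2 * R) \<le> ennreal (real CARD('n) ^ CARD('n)) * hl_max h x"
proof -
  let ?n = "CARD('n)"
  have n: "real ?n > 0" by simp
  \<comment> \<open>The coordinate sum gives \<open>n * R\<close>; doubling the radius provides a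
    strict inequality for the open ball. The constant \<open>n ^ n\<close> is the quotient of
    \<open>(2 * n * R) ^ n\<close> and \<open>(2 * R) ^ n\<close>.\<close>
  have sub: "cube (x - vec R) (2 * R) \<subseteq> ball x (2 * real ?n * R)"
  proof
    fix y assume y: "y \<in> cube (x - vec R) (2 * R)"
    have "dist y x \<le> (\<Sum>i\<in>UNIV. \<bar>(y - x) $ i\<bar>)" unfolding dist_norm by (rule norm_le_l1_cart)
    also have "\<dots> \<le> (\<Sum>i\<in>(UNIV :: 'n set). R)"
    proof (intro sum_mono)
      fix i
      have "- R \<le> y $ i - x $ i \<and> y $ i - x $ i < R"
        using y mem_centered_cube[of y x R] by (simp add: centered_cube_def)
      then show "\<bar>(y - x) $ i\<bar> \<le> R" by (simp add: abs_le_iff)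
    qed
    also have "\<dots> = real ?n * R" by simp
    also have "\<dots> < 2 * real ?n * R" using R n by simp
    finally show "y \<in> ball x (2 * real ?n * R)" by (simp add: dist_commute)
  qed
  have "(\<integral>\<^sup>+y\<in>cube (x - vec R) (2 * R). h y \<partial>lebesgue) = (\<integral>\<^sup>+y\<in>cube (x - vec R) (2 * R). h y \<partial>lborel)"
    by (rule nn_integral_completion)
  also have "\<dots> \<le> (\<integral>\<^sup>+y\<in>ball x (2 * real ?n * R). h y \<partial>lborel)"
    by (rule nn_integral_set_mono[OF sub])
  also have "\<dots> = (\<integral>\<^sup>+y\<in>ball x (2 * real ?n * R). h y \<partial>lborel) / ennreal ((2 * real ?n * R) ^ ?n) * ennreal ((2 * real ?n * R) ^ ?n)"
    using R by (simp add: ennreal_divide_times ennreal_times_divide mult_divide_eq_ennreal)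
  also have "\<dots> \<le> hl_max h x * ennreal ((2 * real ?n * R) ^ ?n)"
    unfolding hl_max_def using R by (intro mult_right_mono SUP_upper2[of "2 * real ?n * R"]) auto
  also have "\<dots> = ennreal ((2 * R) ^ ?n) * (ennreal (real ?n ^ ?n) * hl_max h x)"
  proof -
    have eq: "(2 * real ?n * R) ^ ?n = (2 * R) ^ ?n * real ?n ^ ?n"
      by (simp only: power_mult_distrib mult_ac)
    have "ennreal ((2 * real ?n * R) ^ ?n) = ennreal ((2 * R) ^ ?n) * ennreal (real ?n ^ ?n)"
      unfolding eq using R by (intro ennreal_mult) auto
    then show ?thesis by (simp only: mult_ac)
  qed
  finally show ?thesis unfolding cube_avg_def using R by (intro divide_le_posI_ennreal) auto
qed

text \<open>The exponent \<open>2n + 1\<close> beats the growth \<open>4\<^sup>n\<^sup>k\<close> of the integrals over the \<open>k\<close>-th shell, where the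
  volume of the shell and the growth of the dual seminorm contribute \<open>2\<^sup>n\<^sup>k\<close> each.\<close>

definition decays :: "(real^'n \<Rightarrow> complex) \<Rightarrow> real^'n \<Rightarrow> real \<Rightarrow> real \<Rightarrow> bool"
  where "decays \<Phi> x l S \<longleftrightarrow> (\<forall>y. cmod (\<Phi> y) \<le> S \<and>
    (\<forall>i. cmod (\<Phi> y) * (\<bar>y $ i - x $ i\<bar> / l) ^ Suc (2 * CARD('n)) \<le> S))"

text \<open>Take the least cube containing \<open>y\<close>. Outside its predecessor some coordinate
  differs by at least \<open>2 ^ (k - 1) * l\<close>, so the decay applies with
  \<open>k - 1\<close>; the factor \<open>2 ^ M\<close> makes up for the shifted index.\<close>

lemma decays_shell_sum:
  fixes \<Phi> :: "real^'n \<Rightarrow> complex"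
  assumes \<Phi>: "decays \<Phi> x l S" and l: "0 < l"
  defines "M \<equiv> Suc (2 * CARD('n))"
  shows "ennreal (cmod (\<Phi> y)) \<le> (\<Sum>k. ennreal (S * 2 ^ M * (1 / 2 ^ M) ^ k) * indicator (centered_cube x (2 ^ k * l)) y)"
proof -
  have S: "0 \<le> S" using \<Phi> unfolding decays_def by (meson norm_ge_zero order_trans)
  have "\<exists>k. y \<in> centered_cube x (2 ^ k * l)"
  proof -
    obtain k where k: "norm (y - x) / l < 2 ^ k" using real_arch_pow[of 2 "norm (y - x) / l"] by auto
    have "\<bar>(y - x) $ i\<bar> < 2 ^ k * l" for i
      using component_le_norm_cart[of "y - x" i] k l by (simp add: field_simps)
    then have "- (2 ^ k * l) \<le> y $ i - x $ i \<and> y $ i - x $ i < 2 ^ k * l" for i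
      unfolding vector_minus_component abs_less_iff by (metis less_imp_le minus_less_iff)
    then show ?thesis unfolding mem_centered_cube by blast
  qed
  then obtain k where k: "y \<in> centered_cube x (2 ^ k * l)" and least: "\<And>j. j < k \<Longrightarrow> y \<notin> centered_cube x (2 ^ j * l)"
    using LeastI_ex[of "\<lambda>k. y \<in> centered_cube x (2 ^ k * l)"] not_less_Least by blast
  have term_le: "f k \<le> (\<Sum>k. f k)" for f :: "nat \<Rightarrow> ennreal"
    using sum_le_suminf[of f "{k}"] by simp
  have "cmod (\<Phi> y) \<le> S * 2 ^ M * (1 / 2 ^ M) ^ k"
  proof (cases k)
    case 0
    have "cmod (\<Phi> y) \<le> S" using \<Phi> by (simp add: decays_def)
    also have "S * 1 \<le> S * 2 ^ M" using S by (intro mult_left_mono) auto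
    finally show ?thesis using 0 by simp
  next
    case (Suc j)
    then have "y \<notin> centered_cube x (2 ^ j * l)" using least by simp
    then obtain i where "\<not> (- (2 ^ j * l) \<le> y $ i - x $ i \<and> y $ i - x $ i < 2 ^ j * l)"
      unfolding mem_centered_cube by blast
    then have "2 ^ j * l \<le> \<bar>y $ i - x $ i\<bar>" by linarith
    then have "2 ^ j \<le> \<bar>y $ i - x $ i\<bar> / l" using l by (simp add: field_simps)
    then have "(2 ^ j) ^ M \<le> (\<bar>y $ i - x $ i\<bar> / l) ^ M" by (intro power_mono) auto
    then have "cmod (\<Phi> y) * (2 ^ j) ^ M \<le> cmod (\<Phi> y) * (\<bar>y $ i - x $ i\<bar> / l) ^ M" by (intro mult_left_mono) auto
    also have "\<dots> \<le> S" using \<Phi> unfolding decays_def M_def by blast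
    finally have "cmod (\<Phi> y) \<le> S / (2 ^ j) ^ M" by (simp add: field_simps)
    also have "\<dots> = S * 2 ^ M * (1 / 2 ^ M) ^ k"
      unfolding Suc by (simp add: power_divide flip: power_mult)
    finally show ?thesis .
  qed
  then have "ennreal (cmod (\<Phi> y)) \<le> ennreal (S * 2 ^ M * (1 / 2 ^ M) ^ k) * indicator (centered_cube x (2 ^ k * l)) y"
    using k by (simp add: ennreal_leI)
  also have "\<dots> \<le> (\<Sum>k. ennreal (S * 2 ^ M * (1 / 2 ^ M) ^ k) * indicator (centered_cube x (2 ^ k * l)) y)"
    by (rule term_le)
  finally show ?thesis .
qed

text \<open>With \<open>M = 2 * n + 1\<close> the decay \<open>2 ^ (- M * k)\<close> times the
  growth \<open>4 ^ (n * k)\<close> is \<open>2 ^ (- k)\<close>. The geometric series has sum 2, and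
  \<open>2 ^ M * 2 = 4 ^ (n + 1)\<close>.\<close>

lemma decays_nn_integral:
  fixes \<Phi> :: "real^'n \<Rightarrow> complex"
  assumes \<Phi>: "decays \<Phi> x l S" and l: "0 < l" and u [measurable]: "u \<in> borel_measurable lebesgue"
    and D: "\<And>k. (\<integral>\<^sup>+y\<in>centered_cube x (2 ^ k * l). u y \<partial>lebesgue) \<le> D * ennreal (4 ^ (CARD('n) * k))"
  shows "(\<integral>\<^sup>+y. ennreal (cmod (\<Phi> y)) * u y \<partial>lebesgue) \<le> ennreal (S * 4 ^ Suc CARD('n)) * D"
proof -
  let ?M = "Suc (2 * CARD('n))"
  let ?c = "\<lambda>k::nat. S * 2 ^ ?M * (1 / 2 ^ ?M) ^ k"
  have S: "0 \<le> S" using \<Phi> unfolding decays_def by (meson norm_ge_zero order_trans)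
  have cc [measurable]: "centered_cube x R \<in> sets lebesgue" for R :: real by (simp add: centered_cube_def)
  have "(\<integral>\<^sup>+y. ennreal (cmod (\<Phi> y)) * u y \<partial>lebesgue) \<le>
    (\<integral>\<^sup>+y. (\<Sum>k. ennreal (?c k) * indicator (centered_cube x (2 ^ k * l)) y) * u y \<partial>lebesgue)"
    by (intro nn_integral_mono mult_right_mono decays_shell_sum \<Phi> l) auto
  also have "\<dots> = (\<integral>\<^sup>+y. (\<Sum>k. ennreal (?c k) * (u y * indicator (centered_cube x (2 ^ k * l)) y)) \<partial>lebesgue)"
    by (intro nn_integral_cong) (simp add: mult_ac flip: ennreal_suminf_cmult)
  also have "\<dots> = (\<Sum>k. \<integral>\<^sup>+y. ennreal (?c k) * (u y * indicator (centered_cube x (2 ^ k * l)) y) \<partial>lebesgue)"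
    by (rule nn_integral_suminf) measurable
  also have "\<dots> = (\<Sum>k. ennreal (?c k) * (\<integral>\<^sup>+y\<in>centered_cube x (2 ^ k * l). u y \<partial>lebesgue))"
    by (intro suminf_cong nn_integral_cmult) measurable
  also have "\<dots> \<le> (\<Sum>k. ennreal (?c k) * (D * ennreal (4 ^ (CARD('n) * k))))"
    by (intro suminf_le mult_left_mono D) auto
  also have "\<dots> = (\<Sum>k. (D * ennreal (S * 2 ^ ?M)) * ennreal ((1 / 2) ^ k))"
  proof (intro suminf_cong)
    fix k
    have "(1 / 2 ^ ?M) ^ k * 4 ^ (CARD('n) * k) = (1 / 2 :: real) ^ k"
    proof -
      have "(4 :: real) ^ (CARD('n) * k) = (2 ^ (2 * CARD('n))) ^ k"
        by (simp add: power_mult)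
      then show ?thesis by (simp add: power_divide power_mult_distrib)
    qed
    then have "?c k * 4 ^ (CARD('n) * k) = S * 2 ^ ?M * (1 / 2) ^ k" by (simp add: mult.assoc)
    moreover have "ennreal (?c k) * (D * ennreal (4 ^ (CARD('n) * k))) = D * ennreal (?c k * 4 ^ (CARD('n) * k))"
      using S by (subst ennreal_mult) (auto simp: mult_ac)
    moreover have "D * ennreal (S * 2 ^ ?M * (1 / 2) ^ k) = D * ennreal (S * 2 ^ ?M) * ennreal ((1 / 2) ^ k)"
      using S by (subst ennreal_mult) (auto simp: mult_ac)
    ultimately show "ennreal (?c k) * (D * ennreal (4 ^ (CARD('n) * k))) = (D * ennreal (S * 2 ^ ?M)) * ennreal ((1 / 2) ^ k)"
      by (simp only:)
  qed
  also have "\<dots> = (D * ennreal (S * 2 ^ ?M)) * ennreal 2"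
  proof -
    have "(\<lambda>k. (1 / 2 :: real) ^ k) sums 2" using geometric_sums[of "1 / 2 :: real"] by simp
    then have "(\<Sum>k. ennreal ((1 / 2) ^ k)) = ennreal 2"
      by (intro suminf_ennreal_eq) auto
    then show ?thesis by simp
  qed
  also have "\<dots> = ennreal (S * 2 ^ ?M * 2) * D"
    using S by (subst ennreal_mult[of "S * 2 ^ ?M" 2]) (auto simp: mult_ac)
  also have "S * 2 ^ ?M * 2 = S * 4 ^ Suc CARD('n)" by (simp add: power_mult)
  finally show ?thesis .
qed

subsection \<open>The seminorms of an operator weight\<close>

lemma is_cinverse_unique: "is_cinverse T S \<Longrightarrow> is_cinverse T S' \<Longrightarrow> S = S'"
  unfolding is_cinverse_def by (metis cblinfun_eqI)

lemma cinv_apply: "cinvertible T \<Longrightarrow> cinv T (T e) = e"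
proof -
  assume "cinvertible T"
  then obtain S where S: "is_cinverse T S" by (auto simp: cinvertible_def)
  then have "(THE S. is_cinverse T S) = S"
    by (intro the_equality) (auto intro: is_cinverse_unique)
  then show ?thesis using S \<open>cinvertible T\<close> unfolding cinv_def by (simp add: is_cinverse_def[of T S])
qed

lemma dual_weight_apply: "cinvertible (V x) \<Longrightarrow> dual_weight V x e' (V x e) = e' e"
  by (simp add: dual_weight_def cadjoint_apply cinv_apply)

lemma cblinfun_add: "cblinfun_apply T (x + y) = cblinfun_apply T x + cblinfun_apply T y"
  using bounded_clinear_cblinfun_apply[of T] by (simp add: bounded_clinear_def linear_add bounded_linear.linear)

lemma cblinfun_scaleC: "cblinfun_apply T (c *\<^sub>C x) = c *\<^sub>C cblinfun_apply T x"
  using bounded_clinear_cblinfun_apply[of T] by (simp add: bounded_clinear_def)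

lemma cblinfun_zero [simp]: "cblinfun_apply T 0 = 0"
  using cblinfun_scaleC[of T 0 0] by simp

lemma cblinfun_diff: "cblinfun_apply T (x - y) = cblinfun_apply T x - cblinfun_apply T y"
  using bounded_linear_cblinfun_apply[of T] by (simp add: bounded_linear.linear linear_diff)

definition rho :: "(real^'n \<Rightarrow> ('a::complex_normed_vector \<Rightarrow>\<^sub>C\<^sub>L 'a)) \<Rightarrow> real \<Rightarrow> real^'n \<Rightarrow> real \<Rightarrow> 'a \<Rightarrow> ennreal"
  where "rho V p a l e = ennpowr (cube_avg (\<lambda>x. ennpowr (ennreal (norm (V x e))) p) a l) (1 / p)"

lemma avg_norm_cube: "0 < l \<Longrightarrow> avg_norm V p (cube a l) = rho V p a l"
  unfolding avg_norm_def rho_def cube_avg_def by (auto simp: emeasure_lborel_cube ennpowr_ennreal)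

lemma weight_measurable:
  assumes "p_weight p V"
  shows "(\<lambda>x. norm (V x e)) \<in> borel_measurable lebesgue"
  using assms by (intro strongly_measurable_norm) (simp add: p_weight_def weight_def)

lemma rho_finite:
  assumes V: "p_weight p V" and l: "0 < l"
  shows "rho V p a l e < top"
proof -
  have eq: "ennpowr (ennreal (norm (indicator (cube a l) x *\<^sub>R V x e))) p =
    ennpowr (ennreal (norm (V x e))) p * indicator (cube a l) x" for x
    by (simp split: split_indicator)
  have "Lp_norm p (\<lambda>x. ennreal (norm (indicator (cube a l) x *\<^sub>R V x e))) < \<infinity>"
    using V l is_cube_iff unfolding p_weight_def by blast
  then have "(\<integral>\<^sup>+x\<in>cube a l. ennpowr (ennreal (norm (V x e))) p \<partial>lebesgue) < top"
    by (simp only: Lp_norm_def eq infinity_ennreal_def ennpowr_less_top_iff)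
  then show ?thesis
    using l by (simp add: rho_def cube_avg_def ennreal_divide_eq_top_iff less_top[symmetric])
qed

lemma rho_scaleC: "0 < p \<Longrightarrow> 0 < l \<Longrightarrow> p_weight p V \<Longrightarrow> rho V p a l (c *\<^sub>C e) = ennreal (cmod c) * rho V p a l e"
proof -
  assume p: "0 < p" "0 < l" "p_weight p V"
  have [measurable]: "(\<lambda>x. norm (V x e)) \<in> borel_measurable lebesgue" by (rule weight_measurable[OF p(3)])
  have "cube_avg (\<lambda>x. ennpowr (ennreal (norm (V x (c *\<^sub>C e)))) p) a l =
     ennpowr (ennreal (cmod c)) p * cube_avg (\<lambda>x. ennpowr (ennreal (norm (V x e))) p) a l"
    unfolding cube_avg_def
    by (simp add: cblinfun_scaleC norm_scaleC ennreal_mult ennpowr_mult mult.assoc nn_integral_cmult ennreal_times_divide)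
  then show ?thesis using p by (simp add: rho_def ennpowr_mult ennpowr_cancel)
qed

lemma rho_add:
  fixes V :: "real^'n \<Rightarrow> ('a::complex_normed_vector \<Rightarrow>\<^sub>C\<^sub>L 'a)"
  assumes p: "1 < p" and l: "0 < l" and V: "p_weight p V"
  shows "rho V p a l (x + y) \<le> rho V p a l x + rho V p a l y"
proof -
  have [measurable]: "(\<lambda>x. norm (V x e)) \<in> borel_measurable lebesgue" for e by (rule weight_measurable[OF V])
  \<comment> \<open>The normalised measure on the cube turns averages into integrals, to which
    Minkowski's inequality applies.\<close>
  define \<mu> where "\<mu> = density lebesgue (\<lambda>z. indicator (cube a l) z / ennreal (l ^ CARD('n)))"
  have \<mu>: "cube_avg f a l = (\<integral>\<^sup>+z. f z \<partial>\<mu>)" if [measurable]: "f \<in> borel_measurable lebesgue" for f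
  proof -
    have "(\<integral>\<^sup>+z. f z \<partial>\<mu>) = (\<integral>\<^sup>+z. indicator (cube a l) z / ennreal (l ^ CARD('n)) * f z \<partial>lebesgue)"
      unfolding \<mu>_def by (rule nn_integral_density) measurable
    also have "\<dots> = (\<integral>\<^sup>+z. inverse (ennreal (l ^ CARD('n))) * (f z * indicator (cube a l) z) \<partial>lebesgue)"
      by (simp add: divide_ennreal_def mult_ac)
    also have "\<dots> = inverse (ennreal (l ^ CARD('n))) * (\<integral>\<^sup>+z\<in>cube a l. f z \<partial>lebesgue)"
      by (rule nn_integral_cmult) measurable
    finally show ?thesis by (simp add: cube_avg_def divide_ennreal_def mult.commute)
  qed
  have set_mu [measurable_cong]: "sets \<mu> = sets lebesgue" by (simp add: \<mu>_def)
  have r: "rho V p a l e = ennpowr (\<integral>\<^sup>+z. ennpowr (ennreal (norm (V z e))) p \<partial>\<mu>) (1 / p)" for e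
    by (simp add: rho_def \<mu>)
  let ?I = "\<integral>\<^sup>+z. ennpowr (ennreal (norm (V z x)) + ennreal (norm (V z y))) p \<partial>\<mu>"
  \<comment> \<open>A crude bound via \<open>u + v \<le> 2 * max u v\<close>; it only supplies the
    finiteness required by Minkowski's inequality.\<close>
  have conv: "ennpowr (u + v) p \<le> ennreal (2 powr p) * (ennpowr u p + ennpowr v p)" for u v
  proof -
    have two: "max u v * ennreal 2 = max u v + max u v" by (metis ennreal_numeral mult_2_right zero_le_numeral)
    have "ennpowr (u + v) p \<le> ennpowr (max u v * ennreal 2) p"
      unfolding two using p by (intro ennpowr_mono add_mono) auto
    also have "\<dots> = ennreal (2 powr p) * ennpowr (max u v) p"
      by (simp add: ennpowr_mult ennpowr_ennreal mult.commute del: ennreal_numeral)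
    also have "\<dots> \<le> ennreal (2 powr p) * (ennpowr u p + ennpowr v p)"
      by (intro mult_left_mono) (auto simp: max_def add_increasing add_increasing2)
    finally show ?thesis .
  qed
  have "?I \<le> (\<integral>\<^sup>+z. ennreal (2 powr p) * (ennpowr (ennreal (norm (V z x))) p + ennpowr (ennreal (norm (V z y))) p) \<partial>\<mu>)"
    by (intro nn_integral_mono conv)
  also have "\<dots> = ennreal (2 powr p) * ((\<integral>\<^sup>+z. ennpowr (ennreal (norm (V z x))) p \<partial>\<mu>) + (\<integral>\<^sup>+z. ennpowr (ennreal (norm (V z y))) p \<partial>\<mu>))"
    by (simp add: nn_integral_cmult nn_integral_add)
  also have "\<dots> < top"
    using rho_finite[OF V l, of a x] rho_finite[OF V l, of a y] unfolding r by (simp add: ennreal_mult_less_top)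
  finally have fin: "?I < top" .
  have "rho V p a l (x + y) \<le> ennpowr ?I (1 / p)"
    unfolding r using p
    by (intro ennpowr_mono nn_integral_mono) (auto simp: cblinfun_add norm_triangle_ineq simp flip: ennreal_plus intro!: ennreal_leI)
  also have "\<dots> \<le> rho V p a l x + rho V p a l y"
    unfolding r by (intro Minkowski_nn_integral p fin) measurable
  finally show ?thesis .
qed

text \<open>Lower semicontinuity by Fatou's lemma: for each \<open>x\<close> the operator
  \<open>V x\<close> is continuous, so the integrands converge pointwise.\<close>

lemma rho_closed:
  fixes V :: "real^'n \<Rightarrow> ('a::complex_normed_vector \<Rightarrow>\<^sub>C\<^sub>L 'a)"
  assumes p: "1 < p" and l: "0 < l" and V: "p_weight p V"
  shows "closed {e. rho V p a l e \<le> t}"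
  unfolding closed_sequential_limits
proof safe
  fix e :: "nat \<Rightarrow> 'a" and e0 assume e: "\<forall>n. e n \<in> {e. rho V p a l e \<le> t}" and lim: "e \<longlonglongrightarrow> e0"
  have [measurable]: "(\<lambda>x. norm (V x e)) \<in> borel_measurable lebesgue" for e by (rule weight_measurable[OF V])
  let ?I = "\<lambda>e. \<integral>\<^sup>+x\<in>cube a l. ennpowr (ennreal (norm (V x e))) p \<partial>lebesgue"
  let ?b = "ennpowr t p * ennreal (l ^ CARD('n))"
  have iff: "rho V p a l e \<le> t \<longleftrightarrow> ?I e \<le> ?b" for e
  proof -
    have "rho V p a l e \<le> t \<longleftrightarrow> ennpowr (rho V p a l e) p \<le> ennpowr t p"
      using p by (simp add: ennpowr_le_iff)
    also have "ennpowr (rho V p a l e) p = cube_avg (\<lambda>x. ennpowr (ennreal (norm (V x e))) p) a l"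
      using p by (simp add: rho_def ennpowr_ennpowr)
    also have "cube_avg (\<lambda>x. ennpowr (ennreal (norm (V x e))) p) a l \<le> ennpowr t p \<longleftrightarrow> ?I e \<le> ?b"
    proof
      assume "cube_avg (\<lambda>x. ennpowr (ennreal (norm (V x e))) p) a l \<le> ennpowr t p"
      then have "cube_avg (\<lambda>x. ennpowr (ennreal (norm (V x e))) p) a l * ennreal (l ^ CARD('n)) \<le> ?b"
        by (intro mult_right_mono) auto
      then show "?I e \<le> ?b" using cube_avg_times[OF l, of "\<lambda>x. ennpowr (ennreal (norm (V x e))) p" a] by (simp add: mult.commute)
    next
      assume "?I e \<le> ?b"
      then show "cube_avg (\<lambda>x. ennpowr (ennreal (norm (V x e))) p) a l \<le> ennpowr t p"
        unfolding cube_avg_def using l by (intro divide_le_posI_ennreal) (auto simp: mult.commute)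
    qed
    finally show ?thesis .
  qed
  have "?I e0 = (\<integral>\<^sup>+x. liminf (\<lambda>n. ennpowr (ennreal (norm (V x (e n)))) p * indicator (cube a l) x) \<partial>lebesgue)"
  proof (intro nn_integral_cong)
    fix x
    have "(\<lambda>n. norm (V x (e n))) \<longlonglongrightarrow> norm (V x e0)"
      by (intro tendsto_norm bounded_linear.tendsto[OF bounded_linear_cblinfun_apply] lim)
    then have "(\<lambda>n. ennpowr (ennreal (norm (V x (e n)))) p) \<longlonglongrightarrow> ennpowr (ennreal (norm (V x e0))) p"
      using p by (intro tendsto_ennpowr tendsto_ennrealI) auto
    then show "ennpowr (ennreal (norm (V x e0))) p * indicator (cube a l) x =
       liminf (\<lambda>n. ennpowr (ennreal (norm (V x (e n)))) p * indicator (cube a l) x)"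
      by (cases "x \<in> cube a l") (simp_all add: lim_imp_Liminf)
  qed
  also have "\<dots> \<le> liminf (\<lambda>n. ?I (e n))"
    by (rule nn_integral_liminf) measurable
  also have "\<dots> \<le> ?b"
    using e iff by (intro Liminf_le always_eventually) auto
  finally show "rho V p a l e0 \<le> t" using iff by blast
qed

text \<open>A \<open>p_weight\<close> provides finiteness vector by vector; Baire's theorem turns
  this into one constant for all vectors, depending on the cube.\<close>

lemma rho_bounded:
  fixes V :: "real^'n \<Rightarrow> ('a::complex_banach \<Rightarrow>\<^sub>C\<^sub>L 'a)"
  assumes p: "1 < p" and l: "0 < l" and V: "p_weight p V"
  obtains B where "0 \<le> B" "\<And>e. rho V p a l e \<le> ennreal (B * norm e)"
proof (rule closed_seminorm_bounded[of "rho V p a l"])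
  show "rho V p a l (t *\<^sub>R x) = ennreal \<bar>t\<bar> * rho V p a l x" for t x
    using rho_scaleC[OF _ l V, of a "of_real t" x] p by (simp add: scaleC_of_real)
qed (use rho_add[OF p l V] rho_closed[OF p l V] rho_finite[OF V l] that in auto)

section \<open>Consequences of the A_p condition\<close>

locale Ap_setting =
  fixes V :: "real^'n \<Rightarrow> ('a::complex_banach \<Rightarrow>\<^sub>C\<^sub>L 'a)" and p p' :: real and C :: real
  assumes p: "1 < p" and p'_def: "p' = p / (p - 1)"
    and V: "p_weight p V" and V': "p_weight p' (dual_weight V)" and C: "1 \<le> C"
    and Ap: "\<And>Q e'. is_cube Q \<Longrightarrow>
      avg_norm (dual_weight V) p' Q e' \<le> ennreal C * dual_norm (avg_norm V p Q) e'"
begin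

lemma p': "1 < p'" "1 / p' + 1 / p = 1"
  using p by (auto simp: p'_def field_simps)

abbreviation dnorm :: "'a cdual \<Rightarrow> real^'n \<Rightarrow> real"
  where "dnorm e' x \<equiv> norm (dual_weight V x e')"

lemma dnorm_measurable [measurable]: "dnorm e' \<in> borel_measurable lebesgue"
  by (rule weight_measurable[OF V'])

lemma norm_V_measurable [measurable]: "(\<lambda>x. norm (V x e)) \<in> borel_measurable lebesgue"
  by (rule weight_measurable[OF V])

lemma invertible_AE: "AE x in lebesgue. cinvertible (V x)"
  using V by (simp add: p_weight_def weight_def)

text \<open>This says \<open>\<rho>\<^sup>*(e') \<le> T\<close>, but without the quotients in \<open>dual_norm\<close>.\<close>

definition functional_bound :: "'a cdual \<Rightarrow> ennreal \<Rightarrow> real^'n \<Rightarrow> real \<Rightarrow> bool"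
  where "functional_bound e' T a l \<longleftrightarrow> (\<forall>e. ennreal (cmod (e' e)) \<le> T * rho V p a l e)"

lemma Ap_cube:
  assumes l: "0 < l" and T: "functional_bound e' T a l"
  shows "rho (dual_weight V) p' a l e' \<le> ennreal C * T"
proof -
  have "is_cube (cube a l)" using l is_cube_iff by blast
  then have "rho (dual_weight V) p' a l e' \<le> ennreal C * dual_norm (rho V p a l) e'"
    using Ap[of "cube a l" e'] by (simp add: avg_norm_cube[OF l])
  also have "\<dots> \<le> ennreal C * T"
  proof (intro mult_left_mono)
    show "dual_norm (rho V p a l) e' \<le> T"
      unfolding dual_norm_def
    proof (intro SUP_least)
      fix e
      have *: "ennreal (cmod (e' e)) \<le> T * rho V p a l e" using T by (simp add: functional_bound_def)
      show "ennreal (cmod (e' e)) / rho V p a l e \<le> T"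
      \<comment> \<open>On a degenerate vector the bound \<open>T * 0 = 0\<close> forces
        \<open>e' e = 0\<close>, and the quotient in \<open>dual_norm\<close> is
        \<open>0 / 0 = 0\<close>.\<close>
      proof (cases "rho V p a l e = 0")
        case False
        then have "0 < rho V p a l e" by (simp add: zero_less_iff_neq_zero)
        then show ?thesis using * by (intro divide_le_posI_ennreal) (simp_all add: mult.commute)
      qed (use * in simp)
    qed
  qed simp
  finally show ?thesis .
qed

text \<open>Almost everywhere \<open>e' e\<close> is the pairing of the dual weight applied to
  \<open>e'\<close> with \<open>V x e\<close>; integrate over \<open>F\<close> and use Hoelder. Only
  the factor with \<open>V\<close> is enlarged to the whole cube, so the mass of the dual weight on
  the subset \<open>F\<close> is retained.\<close>

lemma cube_Hoelder:
  fixes e' :: "'a cdual"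
  assumes F [measurable]: "F \<in> sets lebesgue" and sub: "F \<subseteq> cube a l" and l: "0 < l"
  shows "ennreal (cmod (e' e)) * emeasure lebesgue F \<le>
    ennpowr (\<integral>\<^sup>+x\<in>F. ennpowr (ennreal (dnorm e' x)) p' \<partial>lebesgue) (1 / p') *
    (ennpowr (ennreal (l ^ CARD('n))) (1 / p) * rho V p a l e)"
proof -
  have "ennreal (cmod (e' e)) * emeasure lebesgue F = (\<integral>\<^sup>+x. ennreal (cmod (e' e)) * indicator F x \<partial>lebesgue)"
    by (rule nn_integral_cmult_indicator[symmetric]) measurable
  also have "\<dots> \<le> (\<integral>\<^sup>+x. (ennreal (dnorm e' x) * indicator F x) * (ennreal (norm (V x e)) * indicator F x) \<partial>lebesgue)"
  proof (intro nn_integral_mono_AE)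
    show "AE x in lebesgue. ennreal (cmod (e' e)) * indicator F x \<le>
      (ennreal (dnorm e' x) * indicator F x) * (ennreal (norm (V x e)) * indicator F x)"
      using invertible_AE
    proof eventually_elim
      case (elim x)
      have "cmod (e' e) \<le> dnorm e' x * norm (V x e)"
        using norm_cblinfun_apply[of "dual_weight V x e'" "V x e"] dual_weight_apply[of V x e' e] elim by simp
      then show ?case by (auto simp: split: split_indicator simp flip: ennreal_mult intro!: ennreal_leI)
    qed
  qed
  also have "\<dots> \<le> ennpowr (\<integral>\<^sup>+x. ennpowr (ennreal (dnorm e' x) * indicator F x) p' \<partial>lebesgue) (1 / p') *
    ennpowr (\<integral>\<^sup>+x. ennpowr (ennreal (norm (V x e)) * indicator F x) p \<partial>lebesgue) (1 / p)"
    by (rule Hoelder_nn_integral[OF _ _ p']) measurable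
  also have "\<dots> = ennpowr (\<integral>\<^sup>+x\<in>F. ennpowr (ennreal (dnorm e' x)) p' \<partial>lebesgue) (1 / p') *
    ennpowr (\<integral>\<^sup>+x\<in>F. ennpowr (ennreal (norm (V x e))) p \<partial>lebesgue) (1 / p)"
  proof -
    have "ennpowr (u * indicator F x) s = ennpowr u s * indicator F x" for u s x
      by (simp split: split_indicator)
    then show ?thesis by simp
  qed
  also have "\<dots> \<le> ennpowr (\<integral>\<^sup>+x\<in>F. ennpowr (ennreal (dnorm e' x)) p' \<partial>lebesgue) (1 / p') *
    ennpowr (\<integral>\<^sup>+x\<in>cube a l. ennpowr (ennreal (norm (V x e))) p \<partial>lebesgue) (1 / p)"
    using p by (intro mult_left_mono ennpowr_mono nn_integral_set_mono sub) auto
  also have "ennpowr (\<integral>\<^sup>+x\<in>cube a l. ennpowr (ennreal (norm (V x e))) p \<partial>lebesgue) (1 / p) =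
    ennpowr (ennreal (l ^ CARD('n))) (1 / p) * rho V p a l e"
    by (simp add: rho_def ennpowr_mult flip: cube_avg_times[OF l, of _ a])
  finally show ?thesis .
qed

text \<open>The converse of the A_p inequality, which is just Hoelder. It supplies every functional
  with a finite bound on every cube.\<close>

lemma functional_bound_dual:
  assumes l: "0 < l"
  shows "functional_bound e' (rho (dual_weight V) p' a l e') a l"
  unfolding functional_bound_def
proof
  fix e
  let ?L = "ennreal (l ^ CARD('n))"
  have "ennreal (cmod (e' e)) * ?L \<le>
    ennpowr (\<integral>\<^sup>+x\<in>cube a l. ennpowr (ennreal (dnorm e' x)) p' \<partial>lebesgue) (1 / p') *
    (ennpowr ?L (1 / p) * rho V p a l e)"
    using cube_Hoelder[OF cube_lebesgue subset_refl l, of e' e a] l by (simp add: emeasure_lborel_cube)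
  also have "\<dots> = ennpowr ?L (1 / p' + 1 / p) * (rho (dual_weight V) p' a l e' * rho V p a l e)"
    unfolding cube_avg_times[OF l, symmetric] by (simp only: rho_def ennpowr_mult ennpowr_add mult_ac)
  also have "\<dots> = (rho (dual_weight V) p' a l e' * rho V p a l e) * ?L" by (simp add: p' mult.commute)
  finally have "?L * ennreal (cmod (e' e)) \<le> ?L * (rho (dual_weight V) p' a l e' * rho V p a l e)"
    by (simp add: mult.commute)
  then show "ennreal (cmod (e' e)) \<le> rho (dual_weight V) p' a l e' * rho V p a l e"
    using l by (simp add: ennreal_mult_le_mult_iff)
qed

text \<open>The factor \<open>4 / 3\<close> compensates for subsets filling three quarters of a
  cube, \<open>C\<close> is the A_p constant, and the exponent appears because the weight is the
  \<open>p'\<close>-th power.\<close>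

definition "Ainfty_const = (4 / 3 * C) powr p'"

lemma Ainfty_const: "1 < Ainfty_const"
  unfolding Ainfty_const_def using C p' by (intro gr_one_powr) auto

text \<open>\<open>cube_Hoelder\<close> on \<open>F\<close> bounds the dual seminorm of
  \<open>e'\<close> on the cube by \<open>T\<close>, the average of the dual weight over
  \<open>F\<close> alone. The A_p condition converts this back into a bound for the average over the
  whole cube.\<close>

lemma large_subset:
  assumes F [measurable]: "F \<in> sets lebesgue" and sub: "F \<subseteq> cube a l" and l: "0 < l"
    and big: "ennreal (3 / 4 * l ^ CARD('n)) \<le> emeasure lebesgue F"
  shows "(\<integral>\<^sup>+x\<in>cube a l. ennpowr (ennreal (dnorm e' x)) p' \<partial>lebesgue) \<le>
    ennreal Ainfty_const * (\<integral>\<^sup>+x\<in>F. ennpowr (ennreal (dnorm e' x)) p' \<partial>lebesgue)"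
proof -
  let ?L = "ennreal (l ^ CARD('n))"
  let ?W = "\<lambda>F. \<integral>\<^sup>+x\<in>F. ennpowr (ennreal (dnorm e' x)) p' \<partial>lebesgue"
  define T where "T = ennreal (4 / 3) * ennpowr (?W F / ?L) (1 / p')"
  have WF: "?W F = ?L * (?W F / ?L)"
    using l mult_divide_eq_ennreal[of ?L "?W F"] by (simp add: ennreal_times_divide mult.commute)
  have "functional_bound e' T a l"
    unfolding functional_bound_def
  proof
    fix e
    have L34: "ennreal (3 / 4 * l ^ CARD('n)) = ?L * ennreal (3 / 4)"
      using l by (subst ennreal_mult[symmetric]) (auto simp: mult.commute)
    have "ennreal (cmod (e' e)) * (?L * ennreal (3 / 4)) \<le> ennreal (cmod (e' e)) * emeasure lebesgue F"
      using big unfolding L34 by (intro mult_left_mono) auto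
    also have "\<dots> \<le> ennpowr (?W F) (1 / p') * (ennpowr ?L (1 / p) * rho V p a l e)"
      by (rule cube_Hoelder[OF F sub l])
    also have "\<dots> = ennpowr ?L (1 / p' + 1 / p) * (ennpowr (?W F / ?L) (1 / p') * rho V p a l e)"
      by (subst WF) (simp only: ennpowr_mult ennpowr_add mult_ac)
    also have "\<dots> = ?L * (ennpowr (?W F / ?L) (1 / p') * rho V p a l e)" by (simp add: p')
    finally have "?L * (ennreal (cmod (e' e)) * ennreal (3 / 4)) \<le> ?L * (ennpowr (?W F / ?L) (1 / p') * rho V p a l e)"
      by (simp only: mult_ac)
    then have "ennreal (cmod (e' e)) * ennreal (3 / 4) \<le> ennpowr (?W F / ?L) (1 / p') * rho V p a l e"
      using l by (simp add: ennreal_mult_le_mult_iff del: ennreal_divide_numeral)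
    then have "ennreal (4 / 3) * (ennreal (cmod (e' e)) * ennreal (3 / 4)) \<le> ennreal (4 / 3) * (ennpowr (?W F / ?L) (1 / p') * rho V p a l e)"
      by (rule mult_left_mono) simp
    also have "ennreal (4 / 3) * (ennreal (cmod (e' e)) * ennreal (3 / 4)) = ennreal (cmod (e' e))"
      by (subst ennreal_mult[symmetric], simp, simp, subst ennreal_mult[symmetric]) auto
    finally show "ennreal (cmod (e' e)) \<le> T * rho V p a l e" unfolding T_def by (simp only: mult.assoc)
  qed
  then have "rho (dual_weight V) p' a l e' \<le> ennreal C * T" by (rule Ap_cube[OF l])
  then have "ennpowr (rho (dual_weight V) p' a l e') p' \<le> ennpowr (ennreal C * T) p'"
    using p' by (intro ennpowr_mono) auto
  also have "ennpowr (rho (dual_weight V) p' a l e') p' = ?W (cube a l) / ?L"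
    using p' by (simp add: rho_def ennpowr_ennpowr cube_avg_def)
  also have "ennpowr (ennreal C * T) p' = ennreal Ainfty_const * (?W F / ?L)"
  proof -
    have "ennreal C * T = ennreal (4 / 3 * C) * ennpowr (?W F / ?L) (1 / p')"
      unfolding T_def using C by (subst ennreal_mult) (simp, simp, simp only: mult_ac)
    then show ?thesis using C p' by (simp add: ennpowr_mult ennpowr_ennpowr Ainfty_const_def ennpowr_ennreal del: ennreal_divide_numeral)
  qed
  finally have "?W (cube a l) / ?L * ?L \<le> ennreal Ainfty_const * (?W F / ?L) * ?L"
    by (rule mult_right_mono) simp
  also have "\<dots> = ennreal Ainfty_const * ?W F" by (subst (2) WF) (simp only: mult_ac)
  also have "?W (cube a l) / ?L * ?L = ?W (cube a l)"
    using l by (simp add: ennreal_divide_times ennreal_times_divide mult_divide_eq_ennreal)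
  finally show ?thesis .
qed

lemma dual_finite:
  assumes "0 < l"
  shows "(\<integral>\<^sup>+x\<in>cube a l. ennpowr (ennreal (dnorm e' x)) p' \<partial>lebesgue) < top"
proof -
  have "cube_avg (\<lambda>x. ennpowr (ennreal (dnorm e' x)) p') a l < top"
    using rho_finite[OF V' assms, of a e'] by (simp add: rho_def)
  then have "ennreal (l ^ CARD('n)) * cube_avg (\<lambda>x. ennpowr (ennreal (dnorm e' x)) p') a l < top"
    by (simp add: ennreal_mult_less_top)
  then show ?thesis by (simp only: cube_avg_times[OF assms])
qed

text \<open>The complement of a small set is large. With masses \<open>u\<close> on the set and
  \<open>v\<close> on its complement, \<open>u + v \<le> D * v\<close> rearranges to
  \<open>u \<le> (1 - 1 / D) * (u + v)\<close>. The constant does not involve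
  \<open>e'\<close>.\<close>

lemma Ainfty_dual: "Ainfty (1 - 1 / Ainfty_const) (\<lambda>x. ennpowr (ennreal (dnorm e' x)) p')"
  unfolding Ainfty_def
proof (intro allI impI conjI ballI dual_finite)
  fix a :: "real^'n" and l :: real and E :: "(real^'n) set"
  assume l: "0 < l" and E [measurable]: "E \<in> sets lebesgue" and sub: "E \<subseteq> cube a l"
    and small: "4 * emeasure lebesgue E \<le> ennreal (l ^ CARD('n))"
  let ?W = "\<lambda>F. \<integral>\<^sup>+x\<in>F. ennpowr (ennreal (dnorm e' x)) p' \<partial>lebesgue"
  let ?F = "cube a l - E"
  have split: "?W (cube a l) = ?W E + ?W ?F"
    using sub by (subst nn_integral_add[symmetric]) (auto intro!: nn_integral_cong split: split_indicator)
  have "?W E + ?W ?F < top" unfolding split[symmetric] by (rule dual_finite[OF l])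
  then have fin: "?W E < top" "?W ?F < top" by simp_all
  have "emeasure lebesgue E + emeasure lebesgue ?F = emeasure lebesgue (E \<union> ?F)"
    by (rule plus_emeasure) auto
  moreover have "E \<union> ?F = cube a l" using sub by blast
  ultimately have m: "ennreal (l ^ CARD('n)) = emeasure lebesgue E + emeasure lebesgue ?F"
    using emeasure_cube[of l a] l by (simp only: less_imp_le)
  then obtain mE mF where mE: "emeasure lebesgue E = ennreal mE" "0 \<le> mE" and mF: "emeasure lebesgue ?F = ennreal mF" "0 \<le> mF"
    by (cases "emeasure lebesgue E"; cases "emeasure lebesgue ?F") auto
  have "l ^ CARD('n) = mE + mF" using m l mE mF by (simp flip: ennreal_plus)
  moreover have "4 * mE \<le> l ^ CARD('n)"
  proof -
    have "ennreal (4 * mE) \<le> ennreal (l ^ CARD('n))"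
      using small mE by (simp add: ennreal_mult)
    then show ?thesis using l by (subst (asm) ennreal_le_iff) auto
  qed
  ultimately have "ennreal (3 / 4 * l ^ CARD('n)) \<le> emeasure lebesgue ?F"
    unfolding mF(1) by (intro ennreal_leI) linarith
  then have "?W (cube a l) \<le> ennreal Ainfty_const * ?W ?F"
    by (intro large_subset l) auto
  then have le: "?W E + ?W ?F \<le> ennreal Ainfty_const * ?W ?F" unfolding split .
  obtain u v where u: "?W E = ennreal u" "0 \<le> u" and v: "?W ?F = ennreal v" "0 \<le> v"
    using fin by (cases "?W E"; cases "?W ?F") auto
  have D: "1 < Ainfty_const" by (rule Ainfty_const)
  have "u + v \<le> Ainfty_const * v"
    using le D unfolding u v using u(2) v(2) by (simp flip: ennreal_plus ennreal_mult)
  then have "u \<le> (1 - 1 / Ainfty_const) * (u + v)" using D by (simp add: field_simps)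
  then show "?W E \<le> ennreal (1 - 1 / Ainfty_const) * ?W (cube a l)"
    unfolding split u v using D u(2) v(2) by (simp flip: ennreal_plus ennreal_mult add: ennreal_leI)
qed

text \<open>Enlarging the cube lowers the average of the \<open>p\<close>-th power by at most the
  volume ratio. Its \<open>p\<close>-th root is replaced by the ratio itself, which keeps integer
  exponents; the kernels decay fast enough for this.\<close>

lemma functional_bound_mono:
  assumes l: "0 < l" "l \<le> L" and sub: "cube a l \<subseteq> cube c L" and T: "functional_bound e' T a l"
  shows "functional_bound e' (T * ennreal ((L / l) ^ CARD('n))) c L"
  unfolding functional_bound_def
proof
  fix e
  let ?I = "\<lambda>a l. \<integral>\<^sup>+x\<in>cube a l. ennpowr (ennreal (norm (V x e))) p \<partial>lebesgue"
  let ?r = "(L / l) ^ CARD('n)"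
  have r: "1 \<le> ?r" using l by (intro one_le_power) auto
  have L: "0 < L" using l by simp
  have "cube_avg (\<lambda>x. ennpowr (ennreal (norm (V x e))) p) a l \<le> ennreal ?r * cube_avg (\<lambda>x. ennpowr (ennreal (norm (V x e))) p) c L"
    unfolding cube_avg_def[of _ a l]
  proof (rule divide_le_posI_ennreal)
    have "?I a l \<le> ?I c L" by (rule nn_integral_set_mono[OF sub])
    also have "\<dots> = ennreal (L ^ CARD('n)) * cube_avg (\<lambda>x. ennpowr (ennreal (norm (V x e))) p) c L"
      by (rule cube_avg_times[OF L, symmetric])
    also have "ennreal (L ^ CARD('n)) = ennreal (l ^ CARD('n)) * ennreal ?r"
      using l by (subst ennreal_mult[symmetric]) (auto simp: power_divide)
    finally show "?I a l \<le> ennreal (l ^ CARD('n)) * (ennreal ?r * cube_avg (\<lambda>x. ennpowr (ennreal (norm (V x e))) p) c L)"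
      by (simp only: mult.assoc)
  qed (use l in simp)
  then have "rho V p a l e \<le> ennpowr (ennreal ?r * cube_avg (\<lambda>x. ennpowr (ennreal (norm (V x e))) p) c L) (1 / p)"
    unfolding rho_def using p by (intro ennpowr_mono) auto
  also have "\<dots> = ennreal (?r powr (1 / p)) * rho V p c L e"
    using r by (simp add: ennpowr_mult rho_def ennpowr_ennreal)
  also have "\<dots> \<le> ennreal ?r * rho V p c L e"
    using r p powr_mono[of "1 / p" 1 ?r] by (intro mult_right_mono ennreal_leI) auto
  finally have "T * rho V p a l e \<le> T * (ennreal ?r * rho V p c L e)" by (rule mult_left_mono) simp
  moreover have "ennreal (cmod (e' e)) \<le> T * rho V p a l e" using T by (simp add: functional_bound_def)
  ultimately show "ennreal (cmod (e' e)) \<le> T * ennreal ?r * rho V p c L e"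
    unfolding mult.assoc by (rule order_trans[rotated])
qed

end

subsection \<open>The weak integral\<close>

lemma norm_le_functionals:
  fixes v :: "'a::complex_normed_vector"
  assumes "\<And>e' :: 'a cdual. cmod (cblinfun_apply e' v) \<le> c * norm e'" "0 \<le> c"
  shows "norm v \<le> c"
proof -
  obtain \<phi> :: "'a cdual" where \<phi>: "\<phi> v = of_real (norm v)" "\<And>x. cmod (\<phi> x) \<le> norm x"
    using Hahn_Banach_seminorm[of "norm :: 'a \<Rightarrow> real" 1 v] by (auto simp: norm_triangle_ineq norm_scaleC)
  have "norm \<phi> \<le> 1"
    unfolding norm_cblinfun.rep_eq using \<phi>(2) by (intro onorm_bound) auto
  have "norm v = cmod (\<phi> v)" using \<phi>(1) by simp
  also have "\<dots> \<le> c * norm \<phi>" by (rule assms(1))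
  also have "\<dots> \<le> c * 1" using \<open>norm \<phi> \<le> 1\<close> assms(2) by (intro mult_left_mono)
  finally show ?thesis by simp
qed

lemma simple_pairing:
  fixes s :: "real^'n \<Rightarrow> 'a::complex_normed_vector"
  assumes s: "simple_function lebesgue s" and \<Phi>: "integrable lebesgue \<Phi>"
  shows "\<exists>v. \<forall>e' :: 'a cdual. integrable lebesgue (\<lambda>x. \<Phi> x * cblinfun_apply e' (s x)) \<and>
    cblinfun_apply e' v = (LINT x|lebesgue. \<Phi> x * cblinfun_apply e' (s x))"
proof -
  have fin: "finite (range s)" using s by (simp add: simple_function_def)
  have meas [measurable]: "s -` {e} \<in> sets lebesgue" for e
    using simple_functionD(2)[OF s, of "{e}"] by simp
  have int: "integrable lebesgue (\<lambda>x. indicator (s -` {e}) x *\<^sub>R \<Phi> x)" for e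
    by (rule integrable_mult_indicator[OF meas \<Phi>])
  define v where "v = (\<Sum>e\<in>range s. (LINT x|lebesgue. indicator (s -` {e}) x *\<^sub>R \<Phi> x) *\<^sub>C e)"
  have *: "integrable lebesgue (\<lambda>x. \<Phi> x * e' (s x)) \<and> e' v = (LINT x|lebesgue. \<Phi> x * e' (s x))" for e' :: "'a cdual"
  proof -
    have eq: "\<Phi> x * e' (s x) = (\<Sum>e\<in>range s. (indicator (s -` {e}) x *\<^sub>R \<Phi> x) * e' e)" for x
    proof -
      have "(\<Sum>e\<in>range s. (indicator (s -` {e}) x *\<^sub>R \<Phi> x) * e' e) =
         (\<Sum>e\<in>range s. if e = s x then \<Phi> x * e' e else 0)"
        by (intro sum.cong) (auto simp: indicator_def)
      also have "\<dots> = \<Phi> x * e' (s x)" using fin by (subst sum.delta) auto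
      finally show ?thesis by simp
    qed
    have lin: "linear (cblinfun_apply e')"
      using bounded_linear_cblinfun_apply by (rule bounded_linear.linear)
    have "e' v = (\<Sum>e\<in>range s. (LINT x|lebesgue. indicator (s -` {e}) x *\<^sub>R \<Phi> x) * e' e)"
      unfolding v_def linear_sum[OF lin] by (simp add: cblinfun_scaleC scaleC_complex_def)
    also have "\<dots> = (\<Sum>e\<in>range s. (LINT x|lebesgue. (indicator (s -` {e}) x *\<^sub>R \<Phi> x) * e' e))"
      by (intro sum.cong integral_mult_left_zero[symmetric]) simp
    also have "\<dots> = (LINT x|lebesgue. (\<Sum>e\<in>range s. (indicator (s -` {e}) x *\<^sub>R \<Phi> x) * e' e))"
      using int by (intro Bochner_Integration.integral_sum[symmetric] integrable_mult_left) auto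
    finally have "e' v = (LINT x|lebesgue. \<Phi> x * e' (s x))" by (simp only: eq[symmetric])
    moreover have "integrable lebesgue (\<lambda>x. \<Phi> x * e' (s x))"
      unfolding eq using int by (intro Bochner_Integration.integrable_sum integrable_mult_left) auto
    ultimately show ?thesis by blast
  qed
  then show ?thesis by blast
qed

lemma decays_integrable:
  fixes \<Phi> :: "real^'n \<Rightarrow> complex"
  assumes \<Phi>: "decays \<Phi> x l S" and l: "0 < l" and [measurable]: "\<Phi> \<in> borel_measurable lebesgue"
  shows "integrable lebesgue \<Phi>"
proof (rule integrableI_bounded)
  have "(\<integral>\<^sup>+y. ennreal (cmod (\<Phi> y)) * 1 \<partial>lebesgue) \<le> ennreal (S * 4 ^ Suc CARD('n)) * ennreal ((2 * l) ^ CARD('n))"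
  proof (rule decays_nn_integral[OF \<Phi> l])
    fix k
    have "(\<integral>\<^sup>+y\<in>centered_cube x (2 ^ k * l). 1 \<partial>lebesgue) = ennreal ((2 * l) ^ CARD('n) * 2 ^ (CARD('n) * k))"
      using l by (simp add: centered_cube_def emeasure_lborel_cube power_mult_distrib mult_ac flip: power_mult)
    also have "\<dots> \<le> ennreal ((2 * l) ^ CARD('n) * 4 ^ (CARD('n) * k))"
      using l by (intro ennreal_leI mult_left_mono power_mono) auto
    also have "\<dots> = ennreal ((2 * l) ^ CARD('n)) * ennreal (4 ^ (CARD('n) * k))"
      using l by (intro ennreal_mult) auto
    finally show "(\<integral>\<^sup>+y\<in>centered_cube x (2 ^ k * l). 1 \<partial>lebesgue) \<le> \<dots>" .
  qed simp
  also have "\<dots> < \<infinity>" by (simp add: ennreal_mult_less_top)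
  finally show "(\<integral>\<^sup>+y. ennreal (cmod (\<Phi> y)) \<partial>lebesgue) < \<infinity>" by simp
qed simp

section \<open>Shell estimates for the pairing with a functional\<close>

context Ap_setting
begin

lemma functional_bound_weaken: "functional_bound e' T a l \<Longrightarrow> T \<le> T' \<Longrightarrow> functional_bound e' T' a l"
  unfolding functional_bound_def by (meson mult_right_mono order_trans zero_le)

lemma functional_bound_shell:
  assumes l: "0 < l" and x: "cube a l \<subseteq> centered_cube x (2 ^ k * l)" and T: "functional_bound e' T a l"
  shows "functional_bound e' (T * ennreal (2 ^ CARD('n) * 2 ^ (CARD('n) * k))) (x - vec (2 ^ k * l)) (2 * (2 ^ k * l))"
proof -
  have "l * 1 \<le> l * (2 * 2 ^ k)" using l one_le_power[of "2::real" k] by (intro mult_left_mono) linarith+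
  then have le: "l \<le> 2 * (2 ^ k * l)" by (simp add: mult_ac)
  have "(2 * (2 ^ k * l) / l) ^ CARD('n) = 2 ^ CARD('n) * 2 ^ (CARD('n) * k)"
    using l by (simp add: power_mult_distrib mult.commute flip: power_mult)
  then show ?thesis
    using functional_bound_mono[OF l le x[unfolded centered_cube_def] T] by simp
qed

text \<open>The bilinear estimate with \<open>P = p'\<close>, whose conjugate exponent is
  \<open>p\<close>; hence \<open>q < p\<close>. As \<open>Ainfty_const\<close> is the same for all
  functionals, so are \<open>q\<close> and \<open>K\<close>.\<close>

lemma bilinear_exists:
  obtains q K :: real where "1 < q" "q < p" "0 \<le> K"
    "\<And>(e' :: 'a cdual) (g :: real^'n \<Rightarrow> real) x0 l. g \<in> borel_measurable lebesgue \<Longrightarrow> (\<And>x. 0 \<le> g x) \<Longrightarrow> 0 < l \<Longrightarrow>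
      (\<integral>\<^sup>+x\<in>cube x0 l. ennreal (dnorm e' x) * ennreal (g x) \<partial>lebesgue) \<le>
        ennreal K * ennreal (l ^ CARD('n)) * rho (dual_weight V) p' x0 l e' *
        ennpowr (cube_avg (\<lambda>x. ennpowr (ennreal (g x)) q) x0 l) (1 / q)"
proof -
  have pp: "p' / (p' - 1) = p" using p by (simp add: p'_def field_simps)
  have \<theta>: "0 \<le> 1 - 1 / Ainfty_const" "1 - 1 / Ainfty_const < 1" using Ainfty_const by simp_all
  obtain q K where q: "1 < q" "q < p" "0 \<le> K" and
   H: "\<And>(a :: real^'n \<Rightarrow> ennreal) (g :: real^'n \<Rightarrow> real) x0 l.
      a \<in> borel_measurable lebesgue \<Longrightarrow> g \<in> borel_measurable lebesgue \<Longrightarrow> (\<And>x. 0 \<le> g x) \<Longrightarrow>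
      Ainfty (1 - 1 / Ainfty_const) (\<lambda>x. ennpowr (a x) p') \<Longrightarrow> 0 < l \<Longrightarrow>
      (\<integral>\<^sup>+x\<in>cube x0 l. ennreal (g x) * a x \<partial>lebesgue) \<le>
        ennreal K * ennreal (l ^ CARD('n)) * ennpowr (cube_avg (\<lambda>x. ennpowr (a x) p') x0 l) (1 / p') *
        ennpowr (cube_avg (\<lambda>x. ennpowr (ennreal (g x)) q) x0 l) (1 / q)"
    using Ainfty_bilinear[OF p'(1) \<theta>, where ?'n = 'n] unfolding pp by blast
  show ?thesis
  proof (rule that[OF q])
    fix e' :: "'a cdual" and g :: "real^'n \<Rightarrow> real" and x0 :: "real^'n" and l :: real
    assume "g \<in> borel_measurable lebesgue" "\<And>x. 0 \<le> g x" "0 < l"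
    from H[OF _ this(1,2) Ainfty_dual this(3), of e' x0]
    show "(\<integral>\<^sup>+x\<in>cube x0 l. ennreal (dnorm e' x) * ennreal (g x) \<partial>lebesgue) \<le>
        ennreal K * ennreal (l ^ CARD('n)) * rho (dual_weight V) p' x0 l e' *
        ennpowr (cube_avg (\<lambda>x. ennpowr (ennreal (g x)) q) x0 l) (1 / q)"
      by (simp add: rho_def mult.commute[of "ennreal (dnorm e' _)"])
  qed
qed

text \<open>A bound linear in \<open>norm e'\<close>, needed for the existence and continuity of
  weak integrals. The functional is controlled on the cube at \<open>x\<close> by Baire's constant
  and from there on all shells; Hoelder with exponent \<open>p\<close> is enough. Here
  \<open>D\<close> may depend on \<open>x\<close> and \<open>l\<close>.\<close>

lemma pairing_bound:
  fixes x :: "real^'n"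
  assumes l: "0 < l"
  obtains D where "0 \<le> D" "\<And>\<Phi> S e' g. decays \<Phi> x l S \<Longrightarrow> g \<in> borel_measurable lebesgue \<Longrightarrow>
    (\<integral>\<^sup>+y. ennreal (cmod (\<Phi> y)) * (ennreal (dnorm e' y) * g y) \<partial>lebesgue) \<le> ennreal (S * D * norm e') * Lp_norm p g"
proof -
  obtain B where B: "0 \<le> B" "\<And>e'. rho (dual_weight V) p' x l e' \<le> ennreal (B * norm e')"
    using rho_bounded[OF p'(1) l V'] by metis
  let ?n = "CARD('n)"
  \<comment> \<open>The maximum with 1 allows the exponent \<open>1 / p'\<close> of the volume to be
    raised to 1.\<close>
  define D0 where "D0 = max 1 ((2 * l) ^ ?n) * (C * B * 2 ^ ?n)"
  have D0: "0 \<le> D0" using B C by (simp add: D0_def)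
  have "(\<integral>\<^sup>+y. ennreal (cmod (\<Phi> y)) * (ennreal (dnorm e' y) * g y) \<partial>lebesgue) \<le>
      ennreal (S * (4 ^ Suc ?n * D0) * norm e') * Lp_norm p g"
    if \<Phi>: "decays \<Phi> x l S" and g [measurable]: "g \<in> borel_measurable lebesgue" for \<Phi> S e' g
  proof -
    have S: "0 \<le> S" using \<Phi> unfolding decays_def by (meson norm_ge_zero order_trans)
    have T: "functional_bound e' (ennreal (B * norm e')) x l"
      by (rule functional_bound_weaken[OF functional_bound_dual[OF l] B(2)])
    have "(\<integral>\<^sup>+y. ennreal (cmod (\<Phi> y)) * (ennreal (dnorm e' y) * g y) \<partial>lebesgue) \<le>
      ennreal (S * 4 ^ Suc ?n) * (ennreal (D0 * norm e') * Lp_norm p g)"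
    proof (rule decays_nn_integral[OF \<Phi> l])
      fix k
      let ?R = "2 ^ k * l"
      let ?P = "cube (x - vec ?R) (2 * ?R)" and ?L = "ennreal ((2 * ?R) ^ ?n)"
      have R: "0 < 2 * ?R" using l by simp
      have sub: "cube x l \<subseteq> centered_cube x ?R"
      proof
        fix y assume y: "y \<in> cube x l"
        have "l * 1 \<le> l * 2 ^ k" using l by (intro mult_left_mono) auto
        then have lR: "l \<le> ?R" by (simp add: mult.commute)
        have "- ?R \<le> y $ i - x $ i \<and> y $ i - x $ i < ?R" for i
        proof -
          have "x $ i \<le> y $ i \<and> y $ i < x $ i + l" using y by (simp add: cube_def)
          then show ?thesis using lR l by linarith
        qed
        then show "y \<in> centered_cube x ?R"
          unfolding mem_centered_cube by blast
      qed
      have rho: "rho (dual_weight V) p' (x - vec ?R) (2 * ?R) e' \<le>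
        ennreal C * (ennreal (B * norm e') * ennreal (2 ^ ?n * 2 ^ (?n * k)))"
        by (rule Ap_cube[OF R functional_bound_shell[OF l sub T]])
      have ind: "ennpowr (u * indicator ?P y) s = ennpowr u s * indicator ?P y" for u s y
        by (simp split: split_indicator)
      have "(\<integral>\<^sup>+y\<in>centered_cube x ?R. (ennreal (dnorm e' y) * g y) \<partial>lebesgue) =
         (\<integral>\<^sup>+y. (ennreal (dnorm e' y) * indicator ?P y) * g y \<partial>lebesgue)"
        by (simp add: centered_cube_def mult_ac)
      also have "\<dots> \<le> ennpowr (\<integral>\<^sup>+y. ennpowr (ennreal (dnorm e' y) * indicator ?P y) p' \<partial>lebesgue) (1 / p') *
         ennpowr (\<integral>\<^sup>+y. ennpowr (g y) p \<partial>lebesgue) (1 / p)"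
        by (rule Hoelder_nn_integral[OF _ _ p']) measurable
      also have "\<dots> = ennpowr ?L (1 / p') * rho (dual_weight V) p' (x - vec ?R) (2 * ?R) e' * Lp_norm p g"
        unfolding ind Lp_norm_def rho_def cube_avg_times[OF R, symmetric] by (simp only: ennpowr_mult)
      also have "\<dots> \<le> ennreal (max 1 ((2 * l) ^ ?n) * 2 ^ (?n * k)) *
         (ennreal C * (ennreal (B * norm e') * ennreal (2 ^ ?n * 2 ^ (?n * k)))) * Lp_norm p g"
      proof (intro mult_right_mono mult_mono rho)
        have "ennpowr ?L (1 / p') = ennreal (((2 * ?R) ^ ?n) powr (1 / p'))"
          using l by (intro ennpowr_ennreal) auto
        also have "\<dots> \<le> ennreal (max 1 ((2 * l) ^ ?n) * 2 ^ (?n * k))"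
        proof (intro ennreal_leI)
          have eq: "(2 * ?R) ^ ?n = (2 * l) ^ ?n * 2 ^ (?n * k)"
            by (simp add: power_mult_distrib mult.commute[of ?n k] mult_ac flip: power_mult)
          have "((2 * ?R) ^ ?n) powr (1 / p') \<le> (max 1 ((2 * l) ^ ?n) * 2 ^ (?n * k)) powr (1 / p')"
            unfolding eq using l p' by (intro powr_mono2 mult_right_mono) auto
          also have "\<dots> \<le> (max 1 ((2 * l) ^ ?n) * 2 ^ (?n * k)) powr 1"
          proof (rule powr_mono)
            show "1 \<le> max 1 ((2 * l) ^ ?n) * 2 ^ (?n * k)"
              using mult_mono[of 1 "max 1 ((2 * l) ^ ?n)" 1 "2 ^ (?n * k)"] by simp
          qed (use p' in simp)
          finally show "((2 * ?R) ^ ?n) powr (1 / p') \<le> max 1 ((2 * l) ^ ?n) * 2 ^ (?n * k)"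
            by (simp add: abs_mult)
        qed
        finally show "ennpowr ?L (1 / p') \<le> \<dots>" .
      qed auto
      also have "\<dots> = ennreal (D0 * norm e') * Lp_norm p g * ennreal (4 ^ (?n * k))"
      proof -
        have four: "(4 :: real) ^ (?n * k) = 2 ^ (?n * k) * 2 ^ (?n * k)"
          by (simp flip: power_mult_distrib)
        have "(max 1 ((2 * l) ^ ?n) * 2 ^ (?n * k)) * (C * ((B * norm e') * (2 ^ ?n * 2 ^ (?n * k)))) = (D0 * norm e') * 4 ^ (?n * k)"
          unfolding four D0_def by (simp only: mult_ac)
        moreover have "ennreal (max 1 ((2 * l) ^ ?n) * 2 ^ (?n * k)) * (ennreal C * (ennreal (B * norm e') * ennreal (2 ^ ?n * 2 ^ (?n * k))))
          = ennreal ((max 1 ((2 * l) ^ ?n) * 2 ^ (?n * k)) * (C * ((B * norm e') * (2 ^ ?n * 2 ^ (?n * k)))))"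
          using B C by (simp only: ennreal_mult mult_nonneg_nonneg norm_ge_zero max.coboundedI1 zero_le_one zero_le_power zero_le_numeral order_trans[OF zero_le_one C])
        moreover have "ennreal ((D0 * norm e') * 4 ^ (?n * k)) = ennreal (D0 * norm e') * ennreal (4 ^ (?n * k))"
          using D0 by (intro ennreal_mult) auto
        ultimately show ?thesis by (simp only: mult_ac)
      qed
      finally show "(\<integral>\<^sup>+y\<in>centered_cube x ?R. (ennreal (dnorm e' y) * g y) \<partial>lebesgue) \<le> \<dots>" .
    qed measurable
    also have "\<dots> = ennreal (S * (4 ^ Suc ?n * D0) * norm e') * Lp_norm p g"
    proof -
      have "ennreal (S * (4 ^ Suc ?n * D0) * norm e') = ennreal (S * 4 ^ Suc ?n) * ennreal (D0 * norm e')"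
        using S D0 by (subst ennreal_mult[symmetric]) (auto simp: mult_ac)
      then show ?thesis by (simp only: mult.assoc)
    qed
    finally show ?thesis .
  qed
  moreover have "0 \<le> 4 ^ Suc ?n * D0" using D0 by simp
  ultimately show ?thesis using that by blast
qed

text \<open>The counterpart of \<open>pairing_bound\<close> with constants independent of the cube:
  the bilinear estimate replaces Hoelder, and all shells share one maximal function. The factor
  \<open>l ^ CARD('n)\<close> will cancel the height of the dilated kernel. \<open>h\<close> is a
  Borel version of the \<open>q\<close>-th power of \<open>g\<close>.\<close>

lemma maximal_bound:
  obtains q K :: real where "1 < q" "q < p" "0 \<le> K"
    "\<And>\<Phi> S (e' :: 'a cdual) (g :: real^'n \<Rightarrow> real) h x a l T.
      g \<in> borel_measurable lebesgue \<Longrightarrow> (\<And>x. 0 \<le> g x) \<Longrightarrow> h \<in> borel_measurable borel \<Longrightarrow>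
      AE y in lebesgue. ennpowr (ennreal (g y)) q = h y \<Longrightarrow> decays \<Phi> x l S \<Longrightarrow> 0 < l \<Longrightarrow> x \<in> cube a l \<Longrightarrow>
      functional_bound e' T a l \<Longrightarrow>
      (\<integral>\<^sup>+y. ennreal (cmod (\<Phi> y)) * (ennreal (dnorm e' y) * ennreal (g y)) \<partial>lebesgue) \<le>
        ennreal (S * K * l ^ CARD('n)) * T * ennpowr (hl_max h x) (1 / q)"
proof -
  let ?n = "CARD('n)"
  obtain q K where q: "1 < q" "q < p" "0 \<le> K" and
    bil: "\<And>(e' :: 'a cdual) (g :: real^'n \<Rightarrow> real) x0 l. g \<in> borel_measurable lebesgue \<Longrightarrow> (\<And>x. 0 \<le> g x) \<Longrightarrow> 0 < l \<Longrightarrow>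
      (\<integral>\<^sup>+x\<in>cube x0 l. ennreal (dnorm e' x) * ennreal (g x) \<partial>lebesgue) \<le>
        ennreal K * ennreal (l ^ CARD('n)) * rho (dual_weight V) p' x0 l e' *
        ennpowr (cube_avg (\<lambda>x. ennpowr (ennreal (g x)) q) x0 l) (1 / q)"
    by (rule bilinear_exists) blast
  define N where "N = (real ?n ^ ?n) powr (1 / q)"
  \<comment> \<open>From left to right: the sum over shells, the bilinear estimate, the volume
    factor of the cubes of side \<open>2 * R\<close>, the A_p condition, the passage of
    \<open>T\<close> to these cubes, and the comparison of cubes with balls.\<close>
  define K' where "K' = 4 ^ Suc ?n * (K * (2 ^ ?n * (C * (2 ^ ?n * N))))"
  have N: "0 \<le> N" by (simp add: N_def)
  have C0: "0 \<le> C" using C by simp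
  have "(\<integral>\<^sup>+y. ennreal (cmod (\<Phi> y)) * (ennreal (dnorm e' y) * ennreal (g y)) \<partial>lebesgue) \<le>
        ennreal (S * K' * l ^ CARD('n)) * T * ennpowr (hl_max h x) (1 / q)"
    if g [measurable]: "g \<in> borel_measurable lebesgue" and g0: "\<And>x. 0 \<le> g x" and h: "h \<in> borel_measurable borel"
      and ae: "AE y in lebesgue. ennpowr (ennreal (g y)) q = h y" and \<Phi>: "decays \<Phi> x l S" and l: "0 < l"
      and x: "x \<in> cube a l" and T: "functional_bound e' T a l" for \<Phi> S e' g h x a l T
  proof -
    have S: "0 \<le> S" using \<Phi> unfolding decays_def by (meson norm_ge_zero order_trans)
    let ?H = "ennpowr (hl_max h x) (1 / q)"
    let ?c = "K * (2 ^ ?n * (C * (2 ^ ?n * N)))"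
    have c0: "0 \<le> ?c" using q C0 N by simp
    have "(\<integral>\<^sup>+y. ennreal (cmod (\<Phi> y)) * (ennreal (dnorm e' y) * ennreal (g y)) \<partial>lebesgue) \<le>
      ennreal (S * 4 ^ Suc ?n) * (ennreal (?c * l ^ ?n) * T * ?H)"
    proof (rule decays_nn_integral[OF \<Phi> l])
      fix k
      let ?R = "2 ^ k * l"
      let ?P = "cube (x - vec ?R) (2 * ?R)"
      have R: "0 < 2 * ?R" "0 < ?R" using l by simp_all
      have sub: "cube a l \<subseteq> centered_cube x ?R"
      proof
        fix y assume y: "y \<in> cube a l"
        have "l * 1 \<le> l * 2 ^ k" using l by (intro mult_left_mono) auto
        then have lR: "l \<le> ?R" by (simp add: mult.commute)
        have "- ?R \<le> y $ i - x $ i \<and> y $ i - x $ i < ?R" for i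
        proof -
          have "a $ i \<le> y $ i \<and> y $ i < a $ i + l" "a $ i \<le> x $ i \<and> x $ i < a $ i + l"
            using x y by (simp_all add: cube_def)
          then show ?thesis using lR by linarith
        qed
        then show "y \<in> centered_cube x ?R"
          unfolding mem_centered_cube by blast
      qed
      have rho: "rho (dual_weight V) p' (x - vec ?R) (2 * ?R) e' \<le>
        ennreal C * (T * ennreal (2 ^ ?n * 2 ^ (?n * k)))"
        by (rule Ap_cube[OF R(1) functional_bound_shell[OF l sub T]])
      have "cube_avg (\<lambda>y. ennpowr (ennreal (g y)) q) (x - vec ?R) (2 * ?R) = cube_avg h (x - vec ?R) (2 * ?R)"
        unfolding cube_avg_def by (intro arg_cong2[where f = "(/)"] nn_integral_cong_AE refl) (use ae in eventually_elim, simp)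
      also have "\<dots> \<le> ennreal (real ?n ^ ?n) * hl_max h x"
        by (rule cube_avg_le_hl_max[OF h R(2)])
      finally have "ennpowr (cube_avg (\<lambda>y. ennpowr (ennreal (g y)) q) (x - vec ?R) (2 * ?R)) (1 / q) \<le>
        ennpowr (ennreal (real ?n ^ ?n) * hl_max h x) (1 / q)"
        using q by (intro ennpowr_mono) auto
      also have "\<dots> = ennreal N * ?H"
        by (simp add: ennpowr_mult ennpowr_ennreal N_def)
      finally have avg: "ennpowr (cube_avg (\<lambda>y. ennpowr (ennreal (g y)) q) (x - vec ?R) (2 * ?R)) (1 / q) \<le> ennreal N * ?H" .
      have "(\<integral>\<^sup>+y\<in>centered_cube x ?R. (ennreal (dnorm e' y) * ennreal (g y)) \<partial>lebesgue) \<le>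
         ennreal K * ennreal ((2 * ?R) ^ ?n) * rho (dual_weight V) p' (x - vec ?R) (2 * ?R) e' *
          ennpowr (cube_avg (\<lambda>y. ennpowr (ennreal (g y)) q) (x - vec ?R) (2 * ?R)) (1 / q)"
        unfolding centered_cube_def by (rule bil[OF g g0 R(1)])
      also have "\<dots> \<le> ennreal K * ennreal ((2 * ?R) ^ ?n) * (ennreal C * (T * ennreal (2 ^ ?n * 2 ^ (?n * k)))) * (ennreal N * ?H)"
        by (intro mult_mono rho avg order_refl) auto
      also have "\<dots> = (ennreal K * ennreal ((2 * ?R) ^ ?n) * ennreal C * ennreal (2 ^ ?n * 2 ^ (?n * k)) * ennreal N) * T * ?H"
        by (simp only: mult_ac)
      also have "ennreal K * ennreal ((2 * ?R) ^ ?n) * ennreal C * ennreal (2 ^ ?n * 2 ^ (?n * k)) * ennreal N =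
         ennreal (K * (2 * ?R) ^ ?n * C * (2 ^ ?n * 2 ^ (?n * k)) * N)"
        using q C0 N l by (simp only: ennreal_mult mult_nonneg_nonneg zero_le_power zero_le_numeral less_imp_le[OF R(1)])
      also have "K * (2 * ?R) ^ ?n * C * (2 ^ ?n * 2 ^ (?n * k)) * N = (?c * l ^ ?n) * 4 ^ (?n * k)"
      proof -
        have four: "(4 :: real) ^ (?n * k) = 2 ^ (?n * k) * 2 ^ (?n * k)"
          by (simp flip: power_mult_distrib)
        have eq: "(2 * ?R) ^ ?n = 2 ^ ?n * (l ^ ?n * 2 ^ (?n * k))"
          by (simp add: power_mult_distrib mult.commute[of ?n k] mult_ac flip: power_mult)
        show ?thesis unfolding four eq by (simp only: mult_ac)
      qed
      also have "ennreal ((?c * l ^ ?n) * 4 ^ (?n * k)) = ennreal (?c * l ^ ?n) * ennreal (4 ^ (?n * k))"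
        using q C0 N l by (intro ennreal_mult mult_nonneg_nonneg) auto
      also have "ennreal (?c * l ^ ?n) * ennreal (4 ^ (?n * k)) * T * ?H = ennreal (?c * l ^ ?n) * T * ?H * ennreal (4 ^ (?n * k))"
        by (simp only: mult_ac)
      finally show "(\<integral>\<^sup>+y\<in>centered_cube x ?R. (ennreal (dnorm e' y) * ennreal (g y)) \<partial>lebesgue) \<le> \<dots>" .
    qed measurable
    also have "\<dots> = ennreal (S * K' * l ^ CARD('n)) * T * ?H"
    proof -
      have "ennreal (S * K' * l ^ ?n) = ennreal (S * 4 ^ Suc ?n) * ennreal (?c * l ^ ?n)"
      proof -
        have "0 \<le> ?c * l ^ ?n" using c0 l by (intro mult_nonneg_nonneg[OF c0]) simp
        moreover have "S * K' * l ^ ?n = (S * 4 ^ Suc ?n) * (?c * l ^ ?n)"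
          unfolding K'_def by (simp only: mult_ac)
        ultimately show ?thesis using S by (simp only: ennreal_mult mult_nonneg_nonneg zero_le_power zero_le_numeral)
      qed
      then show ?thesis by (simp only: mult.assoc)
    qed
    finally show ?thesis .
  qed
  moreover have "0 \<le> K'" using q C0 N by (simp add: K'_def)
  ultimately show ?thesis using that[OF q(1,2)] by blast
qed

end

section \<open>Weak integrals as vectors\<close>

lemma weak_integral_unique:
  assumes "has_weak_integral V f \<Phi> v" "has_weak_integral V f \<Phi> w"
  shows "v = w"
proof -
  have "norm (v - w) \<le> 0"
  proof (rule norm_le_functionals)
    fix e' :: "'b cdual"
    have "e' v = e' w" using assms unfolding has_weak_integral_def by metis
    then show "cmod (e' (v - w)) \<le> 0 * norm e'" by (simp add: cblinfun_diff)
  qed simp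
  then show ?thesis by simp
qed

lemma weak_pairing_eq: "has_weak_integral V f \<Phi> v \<Longrightarrow> weak_pairing V f \<Phi> = v"
  unfolding weak_pairing_def by (rule the_equality) (auto intro: weak_integral_unique)

lemma has_weak_integral_add:
  assumes "has_weak_integral V f \<Phi> v" "has_weak_integral V f \<Psi> w"
  shows "has_weak_integral V f (\<lambda>x. \<Phi> x + \<Psi> x) (v + w)"
  using assms unfolding has_weak_integral_def
  by (auto simp: cblinfun_add distrib_right Bochner_Integration.integral_add)

lemma has_weak_integral_scaleC:
  assumes "has_weak_integral V f \<Phi> v"
  shows "has_weak_integral V f (\<lambda>x. c * \<Phi> x) (c *\<^sub>C v)"
  using assms unfolding has_weak_integral_def
  by (auto simp: cblinfun_scaleC scaleC_complex_def mult.assoc)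

context Ap_setting
begin

definition nV :: "(real^'n \<Rightarrow> 'a) \<Rightarrow> real^'n \<Rightarrow> real"
  where "nV f x = norm (V x (f x))"

lemma nV_measurable: "strongly_measurable f \<Longrightarrow> nV f \<in> borel_measurable lebesgue"
  unfolding nV_def using V by (intro strongly_measurable_operator_norm) (auto simp: p_weight_def weight_def)

lemma dual_AE: "AE x in lebesgue. dual_weight V x e' (V x (f x)) = cblinfun_apply e' (f x)"
  using invertible_AE by eventually_elim (rule dual_weight_apply)

lemma dual_pairing_measurable:
  assumes "strongly_measurable f"
  shows "(\<lambda>x. dual_weight V x e' (V x (f x))) \<in> borel_measurable lebesgue"
proof (rule borel_measurable_AE)
  show "(\<lambda>x. cblinfun_apply e' (f x)) \<in> borel_measurable lebesgue"
    using linear_continuous_on[OF bounded_linear_cblinfun_apply[of e']]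
    by (intro strongly_measurable_continuous[OF assms])
  show "AE x in lebesgue. cblinfun_apply e' (f x) = dual_weight V x e' (V x (f x))"
    using dual_AE[of e' f] by eventually_elim simp
qed

lemma dual_pairing_le: "cmod (\<Phi> x * dual_weight V x e' (V x (f x))) \<le> cmod (\<Phi> x) * (dnorm e' x * nV f x)"
  unfolding nV_def norm_mult by (intro mult_left_mono norm_cblinfun_apply) auto

lemma weak_integral_le:
  assumes "has_weak_integral V f \<Phi> v"
  shows "ennreal (cmod (cblinfun_apply e' v)) \<le>
    (\<integral>\<^sup>+x. ennreal (cmod (\<Phi> x)) * (ennreal (dnorm e' x) * ennreal (nV f x)) \<partial>lebesgue)"
proof -
  have "ennreal (cmod (e' v)) \<le> (\<integral>\<^sup>+x. norm (\<Phi> x * dual_weight V x e' (V x (f x))) \<partial>lebesgue)"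
    using assms unfolding has_weak_integral_def by (simp add: integral_norm_bound_ennreal)
  also have "\<dots> \<le> (\<integral>\<^sup>+x. ennreal (cmod (\<Phi> x)) * (ennreal (dnorm e' x) * ennreal (nV f x)) \<partial>lebesgue)"
    using dual_pairing_le[of \<Phi> _ e' f]
    by (intro nn_integral_mono) (simp add: ennreal_mult[symmetric] ennreal_leI nV_def)
  finally show ?thesis .
qed

text \<open>Weak integrals of simple functions are finite sums. They form a Cauchy sequence of
  vectors because \<open>pairing_bound\<close> controls the errors uniformly over functionals of
  norm at most 1; completeness of the space gives the vector.\<close>

lemma weak_integral_exists:
  assumes f: "f \<in> wLp_space p V" and \<Phi>: "decays \<Phi> x l S" and l: "0 < l"
    and \<Phi>m [measurable]: "\<Phi> \<in> borel_measurable lebesgue"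
  shows "\<exists>v. has_weak_integral V f \<Phi> v"
proof -
  have fm: "strongly_measurable f" and ffin: "wLp_norm p V f < top"
    using f by (auto simp: wLp_space_def)
  have S: "0 \<le> S" using \<Phi> unfolding decays_def by (meson norm_ge_zero order_trans)
  obtain D where D: "0 \<le> D" "\<And>\<Phi> S e' g. decays \<Phi> x l S \<Longrightarrow> g \<in> borel_measurable lebesgue \<Longrightarrow>
    (\<integral>\<^sup>+y. ennreal (cmod (\<Phi> y)) * (ennreal (dnorm e' y) * g y) \<partial>lebesgue) \<le> ennreal (S * D * norm e') * Lp_norm p g"
    by (rule pairing_bound[OF l, of x]) blast
  obtain s where s: "\<And>k::nat. simple_function lebesgue (s k)" "\<And>x. (\<lambda>k. s k x) \<longlonglongrightarrow> f x"
    using fm unfolding strongly_measurable_def by blast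
  have [measurable]: "nV f \<in> borel_measurable lebesgue" by (rule nV_measurable[OF fm])
  have [measurable]: "nV (\<lambda>x. f x - s k x) \<in> borel_measurable lebesgue" for k
    by (intro nV_measurable strongly_measurable_diff fm strongly_measurable_simple s)
  \<comment> \<open>This truncation keeps \<open>|V (f - t k)|\<close> below \<open>|V f|\<close>, so that dominated convergence applies.\<close>
  define t where "t k x = (if nV (\<lambda>x. f x - s k x) x \<le> nV f x then s k x else 0)" for k x
  have t: "simple_function lebesgue (t k)" for k
    unfolding t_def by (intro simple_function_If s simple_function_const) measurable
  have tm [measurable]: "nV (\<lambda>x. f x - t k x) \<in> borel_measurable lebesgue" for k
    by (intro nV_measurable strongly_measurable_diff fm strongly_measurable_simple t)
  have tle: "nV (\<lambda>x. f x - t k x) x \<le> nV f x" for k x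
    by (simp add: t_def nV_def)
  have slim: "(\<lambda>k. nV (\<lambda>x. f x - s k x) x) \<longlonglongrightarrow> 0" for x
  proof -
    have "(\<lambda>k. V x (f x - s k x)) \<longlonglongrightarrow> V x (f x - f x)"
      by (intro bounded_linear.tendsto[OF bounded_linear_cblinfun_apply] tendsto_diff tendsto_const s)
    from tendsto_norm[OF this] show ?thesis by (simp add: nV_def)
  qed
  \<comment> \<open>Where \<open>nV f x = 0\<close> the truncation makes the error vanish; elsewhere
    the approximants \<open>s k\<close> are eventually accepted.\<close>
  have tlim: "(\<lambda>k. nV (\<lambda>x. f x - t k x) x) \<longlonglongrightarrow> 0" for x
  proof (cases "nV f x = 0")
    case True
    then have "nV (\<lambda>x. f x - t k x) x = 0" for k using tle[of k x] by (simp add: nV_def)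
    then show ?thesis by simp
  next
    case False
    then have "nV f x > 0" by (simp add: nV_def)
    then have "\<forall>\<^sub>F k in sequentially. nV (\<lambda>x. f x - s k x) x < nV f x"
      by (rule order_tendstoD(2)[OF slim])
    then have "\<forall>\<^sub>F k in sequentially. nV (\<lambda>x. f x - s k x) x = nV (\<lambda>x. f x - t k x) x"
      by eventually_elim (simp add: t_def nV_def)
    then show ?thesis using slim[of x] by (simp cong: filterlim_cong)
  qed
  define \<delta> where "\<delta> k = Lp_norm p (\<lambda>x. ennreal (nV (\<lambda>x. f x - t k x) x))" for k
  have Ifin: "(\<integral>\<^sup>+x. ennpowr (ennreal (nV f x)) p \<partial>lebesgue) < top"
    using ffin unfolding wLp_norm_def Lp_norm_def nV_def by simp
  have \<delta>lim: "\<delta> \<longlonglongrightarrow> 0"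
  proof -
    have "(\<lambda>k. \<integral>\<^sup>+x. ennpowr (ennreal (nV (\<lambda>x. f x - t k x) x)) p \<partial>lebesgue) \<longlonglongrightarrow> (\<integral>\<^sup>+x. 0 \<partial>(lebesgue :: (real^'n) measure))"
    proof (rule nn_integral_dominated_convergence[where w = "\<lambda>x. ennpowr (ennreal (nV f x)) p"])
      show "AE x in lebesgue. (\<lambda>k. ennpowr (ennreal (nV (\<lambda>x. f x - t k x) x)) p) \<longlonglongrightarrow> 0"
        using tendsto_ennpowr[OF tendsto_ennrealI[OF tlim], of p] p by simp
      show "AE x in lebesgue. ennpowr (ennreal (nV (\<lambda>x. f x - t k x) x)) p \<le> ennpowr (ennreal (nV f x)) p" for k
        using p tle by (intro AE_I2 ennpowr_mono ennreal_leI) auto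
    qed (use Ifin in auto)
    then show ?thesis
      unfolding \<delta>_def Lp_norm_def using tendsto_ennpowr[of _ 0 sequentially "1 / p"] p by simp
  qed
  have \<delta>fin: "\<delta> k < top" for k
  proof -
    have "\<delta> k \<le> wLp_norm p V f"
      unfolding \<delta>_def wLp_norm_def Lp_norm_def nV_def[symmetric] using p tle
      by (intro ennpowr_mono nn_integral_mono ennreal_leI) auto
    then show ?thesis using ffin by (rule le_less_trans)
  qed
  define d where "d k = enn2real (\<delta> k)" for k
  have d: "\<delta> k = ennreal (d k)" "0 \<le> d k" for k using \<delta>fin[of k] by (simp_all add: d_def)
  have dlim: "d \<longlonglongrightarrow> 0"
    unfolding d_def using tendsto_enn2real[of \<delta> 0 sequentially] \<delta>lim by simp
  define J where "J e' = (LINT x|lebesgue. \<Phi> x * dual_weight V x e' (V x (f x)))" for e'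
  have Jint: "integrable lebesgue (\<lambda>x. \<Phi> x * dual_weight V x e' (V x (f x)))" for e'
  proof (rule integrableI_bounded)
    show "(\<lambda>x. \<Phi> x * dual_weight V x e' (V x (f x))) \<in> borel_measurable lebesgue"
      by (intro borel_measurable_times \<Phi>m dual_pairing_measurable fm)
    have "(\<integral>\<^sup>+x. norm (\<Phi> x * dual_weight V x e' (V x (f x))) \<partial>lebesgue) \<le>
      (\<integral>\<^sup>+x. ennreal (cmod (\<Phi> x)) * (ennreal (dnorm e' x) * ennreal (nV f x)) \<partial>lebesgue)"
      using dual_pairing_le[of \<Phi> _ e' f]
      by (intro nn_integral_mono) (simp add: ennreal_mult[symmetric] ennreal_leI nV_def)
    also have "\<dots> \<le> ennreal (S * D * norm e') * Lp_norm p (\<lambda>x. ennreal (nV f x))"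
      by (rule D(2)[OF \<Phi>]) measurable
    also have "\<dots> < top" using ffin by (simp add: wLp_norm_def nV_def ennreal_mult_less_top)
    finally show "(\<integral>\<^sup>+x. norm (\<Phi> x * dual_weight V x e' (V x (f x))) \<partial>lebesgue) < \<infinity>" by simp
  qed
  have "\<exists>v. \<forall>e' :: 'a cdual. integrable lebesgue (\<lambda>x. \<Phi> x * cblinfun_apply e' (t k x)) \<and>
    cblinfun_apply e' v = (LINT x|lebesgue. \<Phi> x * cblinfun_apply e' (t k x))" for k
    by (rule simple_pairing[OF t decays_integrable[OF \<Phi> l \<Phi>m]])
  then obtain v where vint: "\<And>k (e' :: 'a cdual). integrable lebesgue (\<lambda>x. \<Phi> x * cblinfun_apply e' (t k x))"
    and v: "\<And>k (e' :: 'a cdual). cblinfun_apply e' (v k) = (LINT x|lebesgue. \<Phi> x * cblinfun_apply e' (t k x))"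
    by metis
  have close: "cmod (cblinfun_apply e' (v k) - J e') \<le> S * D * norm e' * d k" for k and e' :: "'a cdual"
  proof -
    let ?F = "\<lambda>x. \<Phi> x * cblinfun_apply e' (t k x) - \<Phi> x * dual_weight V x e' (V x (f x))"
    have "ennreal (cmod (e' (v k) - J e')) = ennreal (norm (LINT x|lebesgue. ?F x))"
      unfolding v J_def using vint Jint by simp
    also have "\<dots> \<le> (\<integral>\<^sup>+x. norm (?F x) \<partial>lebesgue)"
      using vint[of e' k] Jint[of e'] by (intro integral_norm_bound_ennreal) auto
    also have "\<dots> \<le> (\<integral>\<^sup>+x. ennreal (cmod (\<Phi> x)) * (ennreal (dnorm e' x) * ennreal (nV (\<lambda>x. f x - t k x) x)) \<partial>lebesgue)"
    proof (intro nn_integral_mono_AE)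
      show "AE x in lebesgue. ennreal (norm (?F x)) \<le> ennreal (cmod (\<Phi> x)) * (ennreal (dnorm e' x) * ennreal (nV (\<lambda>x. f x - t k x) x))"
        using dual_AE[of e' f] dual_AE[of e' "\<lambda>x. f x - t k x"]
      proof eventually_elim
        case (elim x)
        have "norm (?F x) = cmod (\<Phi> x * dual_weight V x e' (V x (f x - t k x)))"
          unfolding elim by (simp add: cblinfun_diff norm_minus_commute norm_mult flip: right_diff_distrib)
        also have "\<dots> \<le> cmod (\<Phi> x) * (dnorm e' x * nV (\<lambda>x. f x - t k x) x)"
          by (rule dual_pairing_le)
        finally show ?case by (simp add: ennreal_mult[symmetric] ennreal_leI nV_def)
      qed
    qed
    also have "\<dots> \<le> ennreal (S * D * norm e') * \<delta> k"
      unfolding \<delta>_def by (rule D(2)[OF \<Phi>]) measurable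
    also have "\<dots> = ennreal (S * D * norm e' * d k)"
      unfolding d(1) using S D(1) d(2)[of k] by (subst ennreal_mult) auto
    finally show ?thesis
      using S D(1) d(2)[of k] by (subst (asm) ennreal_le_iff) auto
  qed
  \<comment> \<open>Since \<open>close\<close> is linear in \<open>norm e'\<close>, Hahn--Banach
    turns it into a norm estimate.\<close>
  have diff: "norm (v k - v m) \<le> S * D * d k + S * D * d m" for k m
  proof (rule norm_le_functionals)
    fix e' :: "'a cdual"
    have "cmod (e' (v k - v m)) = cmod ((e' (v k) - J e') - (e' (v m) - J e'))" by (simp add: cblinfun_diff)
    also have "\<dots> \<le> cmod (e' (v k) - J e') + cmod (e' (v m) - J e')" by (rule norm_triangle_ineq4)
    also have "\<dots> \<le> S * D * norm e' * d k + S * D * norm e' * d m" by (intro add_mono close)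
    finally show "cmod (e' (v k - v m)) \<le> (S * D * d k + S * D * d m) * norm e'" by (simp add: algebra_simps)
  qed (use S D(1) d(2) in auto)
  have SDlim: "(\<lambda>k. S * D * d k) \<longlonglongrightarrow> 0" using tendsto_mult_right_zero[OF dlim] by simp
  have "Cauchy v"
  proof (rule metric_CauchyI)
    fix \<epsilon> :: real assume "0 < \<epsilon>"
    then have "\<forall>\<^sub>F k in sequentially. S * D * d k < \<epsilon> / 2"
      by (intro order_tendstoD(2)[OF SDlim]) simp
    then obtain M where M: "\<And>k. k \<ge> M \<Longrightarrow> S * D * d k < \<epsilon> / 2" unfolding eventually_sequentially by blast
    have "dist (v k) (v m) < \<epsilon>" if "k \<ge> M" "m \<ge> M" for k m
      using diff[of k m] M[OF that(1)] M[OF that(2)] by (simp add: dist_norm)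
    then show "\<exists>M. \<forall>k\<ge>M. \<forall>m\<ge>M. dist (v k) (v m) < \<epsilon>" by blast
  qed
  then obtain w where w: "v \<longlonglongrightarrow> w" using Cauchy_convergent convergent_def by blast
  have "e' w = J e'" for e' :: "'a cdual"
  proof (rule LIMSEQ_unique)
    show "(\<lambda>k. e' (v k)) \<longlonglongrightarrow> e' w" by (intro bounded_linear.tendsto[OF bounded_linear_cblinfun_apply] w)
    have "(\<lambda>k. S * D * norm e' * d k) \<longlonglongrightarrow> 0" using tendsto_mult_right_zero[OF dlim] by simp
    then have "(\<lambda>k. e' (v k) - J e') \<longlonglongrightarrow> 0"
      by (rule Lim_null_comparison[rotated]) (use close in auto)
    then show "(\<lambda>k. e' (v k)) \<longlonglongrightarrow> J e'" by (simp add: LIM_zero_iff)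
  qed
  then have "has_weak_integral V f \<Phi> w"
    unfolding has_weak_integral_def using Jint by (auto simp: J_def)
  then show ?thesis by blast
qed

lemma has_weak_integral_pairing:
  assumes "f \<in> wLp_space p V" "decays \<Phi> x l S" "0 < l" "\<Phi> \<in> borel_measurable lebesgue"
  shows "has_weak_integral V f \<Phi> (weak_pairing V f \<Phi>)"
  using weak_integral_exists[OF assms] weak_pairing_eq by metis

text \<open>Linearity in the decay constant \<open>S\<close> is what yields continuity in the
  Schwartz topology; \<open>D\<close> may depend on \<open>f\<close>.\<close>

lemma weak_integral_norm_le:
  fixes x :: "real^'n"
  assumes f: "f \<in> wLp_space p V" and l: "0 < l"
  obtains D where "0 \<le> D" "\<And>\<Phi> S v. decays \<Phi> x l S \<Longrightarrow> has_weak_integral V f \<Phi> v \<Longrightarrow> norm v \<le> S * D"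
proof -
  have fm: "strongly_measurable f" and ffin: "wLp_norm p V f < top"
    using f by (auto simp: wLp_space_def)
  have [measurable]: "nV f \<in> borel_measurable lebesgue" by (rule nV_measurable[OF fm])
  define A where "A = enn2real (wLp_norm p V f)"
  have A: "wLp_norm p V f = ennreal A" "0 \<le> A" using ffin by (simp_all add: A_def)
  obtain D where D: "0 \<le> D" "\<And>\<Phi> S e' g. decays \<Phi> x l S \<Longrightarrow> g \<in> borel_measurable lebesgue \<Longrightarrow>
    (\<integral>\<^sup>+y. ennreal (cmod (\<Phi> y)) * (ennreal (dnorm e' y) * g y) \<partial>lebesgue) \<le> ennreal (S * D * norm e') * Lp_norm p g"
    by (rule pairing_bound[OF l, of x]) blast
  have "norm v \<le> S * (D * A)" if \<Phi>: "decays \<Phi> x l S" and v: "has_weak_integral V f \<Phi> v" for \<Phi> S v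
  proof (rule norm_le_functionals)
    have S: "0 \<le> S" using \<Phi> unfolding decays_def by (meson norm_ge_zero order_trans)
    then show "0 \<le> S * (D * A)" using D(1) A(2) by simp
    fix e' :: "'a cdual"
    have "ennreal (cmod (e' v)) \<le> ennreal (S * D * norm e') * Lp_norm p (\<lambda>x. ennreal (nV f x))"
      by (rule order_trans[OF weak_integral_le[OF v] D(2)[OF \<Phi>]]) measurable
    also have "Lp_norm p (\<lambda>x. ennreal (nV f x)) = ennreal A" using A(1) by (simp add: wLp_norm_def nV_def)
    also have "ennreal (S * D * norm e') * ennreal A = ennreal (S * (D * A) * norm e')"
      using S D(1) A(2) by (subst ennreal_mult[symmetric]) (auto simp: mult_ac)
    finally show "cmod (e' v) \<le> S * (D * A) * norm e'"
      using S D(1) A(2) by (subst (asm) ennreal_le_iff) auto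
  qed
  then show ?thesis using that[of "D * A"] D(1) A(2) by simp
qed

end

subsection \<open>Schwartz functions and the Triebel--Lizorkin norm\<close>

text \<open>Jensen with exponent \<open>p / r\<close>, which is legitimate for every
  \<open>r\<close> below \<open>p\<close>, including \<open>r < 1\<close>.\<close>

lemma cube_avg_power_le:
  fixes a0 :: "real^'n"
  assumes [measurable]: "u \<in> borel_measurable lebesgue" and r: "0 < r" "r \<le> p" and l: "0 < l"
  shows "ennpowr (cube_avg (\<lambda>x. ennpowr (u x) r) a0 l) (1 / r) \<le> ennpowr (cube_avg (\<lambda>x. ennpowr (u x) p) a0 l) (1 / p)"
proof (cases "r = p")
  case False
  then have "1 < p / r" using r by simp
  then have "(\<integral>\<^sup>+x\<in>cube a0 l. ennpowr (u x) r \<partial>lebesgue) \<le>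
    ennreal (l ^ CARD('n)) * ennpowr (cube_avg (\<lambda>x. ennpowr (ennpowr (u x) r) (p / r)) a0 l) (1 / (p / r))"
    using l by (intro cube_Jensen) auto
  then have "cube_avg (\<lambda>x. ennpowr (u x) r) a0 l \<le> ennpowr (cube_avg (\<lambda>x. ennpowr (u x) p) a0 l) (r / p)"
    unfolding cube_avg_def[of "\<lambda>x. ennpowr (u x) r"] using l r
    by (intro divide_le_posI_ennreal) (auto simp: ennpowr_ennpowr)
  then have "ennpowr (cube_avg (\<lambda>x. ennpowr (u x) r) a0 l) (1 / r) \<le> ennpowr (ennpowr (cube_avg (\<lambda>x. ennpowr (u x) p) a0 l) (r / p)) (1 / r)"
    using r by (intro ennpowr_mono) auto
  then show ?thesis using r by (simp add: ennpowr_ennpowr)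
qed simp

section \<open>Decay and continuity in terms of Schwartz seminorms\<close>

definition single_power :: "nat \<Rightarrow> 'n::finite \<Rightarrow> 'n \<Rightarrow> nat"
  where "single_power M i j = (if j = i then M else 0)"

lemma monomial_simps [simp]:
  "monomial (\<lambda>_. 0) x = 1" "monomial (single_power M i) x = (x $ i) ^ M"
proof -
  have "monomial (single_power M i) x = (\<Prod>j\<in>UNIV. if j = i then (x $ i) ^ M else 1)"
    unfolding monomial_def by (intro prod.cong) (auto simp: single_power_def)
  then show "monomial (single_power M i) x = (x $ i) ^ M" by (simp add: prod.delta)
qed (simp add: monomial_def)

text \<open>Finitely many seminorms, all without derivatives, matching the exponents in
  \<open>decays\<close>; an intersection of finitely many seminorm balls therefore controls
  it.\<close>

definition decay_norm :: "(real^'n \<Rightarrow> complex) \<Rightarrow> real"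
  where "decay_norm \<psi> = schwartz_seminorm (\<lambda>_. 0) [] \<psi> +
    (\<Sum>i\<in>UNIV. schwartz_seminorm (single_power (Suc (2 * CARD('n))) i) [] \<psi>)"

lemma decays_decay_norm:
  fixes \<psi> :: "real^'n \<Rightarrow> complex"
  assumes bdd: "\<And>\<alpha>. bounded (range (\<lambda>x. monomial \<alpha> x *\<^sub>R \<psi> x))"
  shows "decays \<psi> 0 1 (decay_norm \<psi>)"
proof -
  let ?M = "Suc (2 * CARD('n))"
  have sem: "norm (monomial \<alpha> y *\<^sub>R \<psi> y) \<le> schwartz_seminorm \<alpha> [] \<psi>" for \<alpha> y
  proof -
    obtain B where "\<And>x. norm (monomial \<alpha> x *\<^sub>R \<psi> x) \<le> B" using bdd[of \<alpha>] by (auto simp: bounded_iff)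
    then have "bdd_above (range (\<lambda>x. norm (monomial \<alpha> x *\<^sub>R \<psi> x)))" by (intro bdd_aboveI2) auto
    then show ?thesis
      unfolding schwartz_seminorm_def partial_derivs_def foldr.simps id_apply by (rule cSUP_upper[OF UNIV_I])
  qed
  have nonneg: "0 \<le> schwartz_seminorm \<alpha> [] \<psi>" for \<alpha> using order_trans[OF norm_ge_zero sem] by blast
  have 0: "schwartz_seminorm (\<lambda>_. 0) [] \<psi> \<le> decay_norm \<psi>"
    unfolding decay_norm_def using nonneg by (simp add: sum_nonneg)
  have i: "schwartz_seminorm (single_power ?M i) [] \<psi> \<le> decay_norm \<psi>" for i
  proof -
    have "schwartz_seminorm (single_power ?M i) [] \<psi> \<le> (\<Sum>i\<in>UNIV. schwartz_seminorm (single_power ?M i) [] \<psi>)"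
      using nonneg by (intro member_le_sum) auto
    then show ?thesis unfolding decay_norm_def using nonneg[of "\<lambda>_. 0"] by simp
  qed
  have "cmod (\<psi> y) \<le> decay_norm \<psi>" for y
    using order_trans[OF sem[of "\<lambda>_. 0" y] 0] by simp
  moreover have "cmod (\<psi> y) * (\<bar>y $ i - 0 $ i\<bar> / 1) ^ ?M \<le> decay_norm \<psi>" for y i
    using order_trans[OF sem[of "single_power ?M i" y] i[of i]]
    by (simp only: monomial_simps norm_scaleR real_norm_def power_abs) (simp add: mult.commute)
  ultimately show ?thesis unfolding decays_def by blast
qed

lemma schwartz_bounded: "\<psi> \<in> schwartz \<Longrightarrow> bounded (range (\<lambda>x. monomial \<alpha> x *\<^sub>R \<psi> x))"
proof -
  assume "\<psi> \<in> schwartz"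
  then have "bounded (range (\<lambda>x. monomial \<alpha> x *\<^sub>R partial_derivs [] \<psi> x))"
    unfolding schwartz_def by blast
  then show ?thesis by (simp add: partial_derivs_def)
qed

lemma schwartz_continuous: "\<psi> \<in> schwartz \<Longrightarrow> continuous_on UNIV \<psi>"
proof -
  assume "\<psi> \<in> schwartz"
  then have "partial_derivs [] \<psi> differentiable at x" for x unfolding schwartz_def by blast
  then have "\<psi> differentiable at x" for x by (simp add: partial_derivs_def)
  then show ?thesis by (simp add: continuous_at_imp_continuous_on differentiable_imp_continuous_within)
qed

lemma continuous_lebesgue_measurable: "continuous_on UNIV \<psi> \<Longrightarrow> \<psi> \<in> borel_measurable lebesgue"
  for \<psi> :: "real^'n \<Rightarrow> complex"
  by (intro measurable_completion) (simp add: borel_measurable_continuous_onI)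

lemma bounded_minus_monomial:
  fixes \<psi> \<psi>' :: "real^'n \<Rightarrow> complex"
  assumes "bounded (range (\<lambda>x. monomial \<alpha> x *\<^sub>R \<psi> x))" "bounded (range (\<lambda>x. monomial \<alpha> x *\<^sub>R \<psi>' x))"
  shows "bounded (range (\<lambda>x. monomial \<alpha> x *\<^sub>R (\<psi> x - \<psi>' x)))"
  using bounded_minus_comp[OF assms] by (simp add: scaleR_diff_right)

lemma open_schwartz_ball:
  assumes "\<phi> \<in> schwartz" "0 < \<epsilon>"
  shows "openin schwartz_topology {\<psi> \<in> schwartz. schwartz_seminorm \<alpha> is (\<lambda>x. \<psi> x - \<phi> x) < \<epsilon>}"
  unfolding schwartz_topology_def using assms by (intro topology_generated_by_Basis) blast

lemma schwartz_seminorm_zero: "schwartz_seminorm \<alpha> [] (\<lambda>x. 0) = 0"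
  unfolding schwartz_seminorm_def partial_derivs_def by simp

text \<open>A generated topology has the union of its generators as carrier, and every Schwartz
  function lies in a ball around itself.\<close>

lemma topspace_schwartz0: "topspace (subtopology schwartz_topology schwartz0) = schwartz0"
proof -
  have "\<phi> \<in> topspace schwartz_topology" if "\<phi> \<in> schwartz0" for \<phi> :: "real^'n \<Rightarrow> complex"
  proof -
    have "\<phi> \<in> schwartz" using that by (simp add: schwartz0_def)
    then have "openin schwartz_topology {\<psi> \<in> schwartz. schwartz_seminorm (\<lambda>_. 0) [] (\<lambda>x. \<psi> x - \<phi> x) < 1}"
      by (rule open_schwartz_ball) simp
    from openin_subset[OF this] show ?thesis
      by (rule subsetD) (simp add: \<open>\<phi> \<in> schwartz\<close> schwartz_seminorm_zero)
  qed
  then show ?thesis by (auto simp: topspace_subtopology)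
qed

text \<open>At most one summand is nonzero, so the infinite sum is a single value or 0.\<close>

lemma infsum_indicator_disjoint:
  fixes c :: "'b set \<Rightarrow> ennreal"
  assumes uniq: "\<And>P Q. P \<in> \<D> \<Longrightarrow> Q \<in> \<D> \<Longrightarrow> x \<in> P \<Longrightarrow> x \<in> Q \<Longrightarrow> P = Q"
    and le: "\<And>Q. Q \<in> \<D> \<Longrightarrow> x \<in> Q \<Longrightarrow> c Q \<le> B"
  shows "(\<Sum>\<^sub>\<infinity>Q\<in>\<D>. indicator Q x * c Q) \<le> B"
proof (cases "\<exists>Q\<in>\<D>. x \<in> Q")
  case True
  then obtain Q where Q: "Q \<in> \<D>" "x \<in> Q" by blast
  have "(\<Sum>\<^sub>\<infinity>Q\<in>\<D>. indicator Q x * c Q) = (\<Sum>\<^sub>\<infinity>Q\<in>{Q}. indicator Q x * c Q)"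
    using uniq Q by (intro infsum_cong_neutral) (auto simp: indicator_def)
  also have "\<dots> = c Q" using Q by simp
  finally show ?thesis using le Q by simp
next
  case False
  then have "(\<Sum>\<^sub>\<infinity>Q\<in>\<D>. indicator Q x * c Q) = 0" by (intro infsum_0) (auto simp: indicator_def)
  then show ?thesis by simp
qed

section \<open>Dyadic cubes and dilated kernels\<close>

lemma dyadic_cube_eq:
  fixes k :: "real^'n"
  assumes "0 < c"
  shows "(\<lambda>y. c *\<^sub>R (y + k)) ` {y. \<forall>i. 0 \<le> y $ i \<and> y $ i < 1} = cube (c *\<^sub>R k) c"
proof (intro set_eqI iffI)
  fix x assume "x \<in> (\<lambda>y. c *\<^sub>R (y + k)) ` {y. \<forall>i. 0 \<le> y $ i \<and> y $ i < 1}"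
  then obtain y where y: "x = c *\<^sub>R (y + k)" "\<And>i. 0 \<le> y $ i \<and> y $ i < 1" by auto
  have "c * k $ i \<le> c * (y $ i + k $ i) \<and> c * (y $ i + k $ i) < c * k $ i + c" for i
    using y(2)[of i] assms by (simp add: distrib_left)
  then show "x \<in> cube (c *\<^sub>R k) c" by (simp add: cube_def y(1))
next
  fix x assume x: "x \<in> cube (c *\<^sub>R k) c"
  define y where "y = (1 / c) *\<^sub>R x - k"
  have "0 \<le> y $ i \<and> y $ i < 1" for i
  proof -
    have "c * k $ i \<le> x $ i \<and> x $ i < c * k $ i + c" using x by (simp add: cube_def)
    then show ?thesis using assms by (simp add: y_def field_simps)
  qed
  moreover have "x = c *\<^sub>R (y + k)" using assms by (simp add: y_def)
  ultimately show "x \<in> (\<lambda>y. c *\<^sub>R (y + k)) ` {y. \<forall>i. 0 \<le> y $ i \<and> y $ i < 1}" by blast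
qed

lemma dyadic_cubes_cube:
  assumes "Q \<in> dyadic_cubes j"
  obtains k where "\<forall>i. k $ i \<in> \<int>" "Q = cube ((2 powi (- j)) *\<^sub>R k) (2 powi (- j))"
proof -
  obtain k where k: "\<forall>i. k $ i \<in> \<int>" "Q = (\<lambda>y. (2 powi (- j)) *\<^sub>R (y + k)) ` {y. \<forall>i. 0 \<le> y $ i \<and> y $ i < 1}"
    using assms unfolding dyadic_cubes_def by blast
  have "Q = cube ((2 powi (- j)) *\<^sub>R k) (2 powi (- j))"
    unfolding k(2) by (rule dyadic_cube_eq) simp
  with k(1) show ?thesis by (rule that)
qed

lemma dyadic_cubes_unique:
  assumes "P \<in> dyadic_cubes j" "Q \<in> dyadic_cubes j" "x \<in> P" "x \<in> Q"
  shows "P = Q"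
proof -
  define c where "c = (2 :: real) powi (- j)"
  have c: "0 < c" by (simp add: c_def)
  obtain k where k: "\<forall>i. k $ i \<in> \<int>" "P = cube (c *\<^sub>R k) c"
    using dyadic_cubes_cube[OF assms(1)] unfolding c_def by blast
  obtain m where m: "\<forall>i. m $ i \<in> \<int>" "Q = cube (c *\<^sub>R m) c"
    using dyadic_cubes_cube[OF assms(2)] unfolding c_def by blast
  have "k $ i = m $ i" for i
  proof -
    obtain K M where KM: "k $ i = of_int K" "m $ i = of_int M" using k(1) m(1) by (metis Ints_cases)
    have "c * k $ i \<le> x $ i" "x $ i < c * k $ i + c" "c * m $ i \<le> x $ i" "x $ i < c * m $ i + c"
      using assms(3,4) unfolding k(2) m(2) by (simp_all add: cube_def)
    then have "c * k $ i < c * (m $ i + 1)" "c * m $ i < c * (k $ i + 1)" by (auto simp: distrib_left)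
    then have "k $ i < m $ i + 1" "m $ i < k $ i + 1" using c by simp_all
    then have "real_of_int K < real_of_int (M + 1)" "real_of_int M < real_of_int (K + 1)"
      unfolding KM by simp_all
    then show ?thesis unfolding KM of_int_less_iff by simp
  qed
  then have "k = m" by (simp add: vec_eq_iff)
  then show ?thesis using k m by simp
qed

text \<open>Dilation moves the decay from scale 1 to the side length of the dyadic cubes of
  generation \<open>j\<close> and raises the height by the inverse of their volume.\<close>

lemma decays_dilate:
  fixes \<phi> :: "real^'n \<Rightarrow> complex"
  assumes \<phi>: "decays \<phi> 0 1 S"
  shows "decays (\<lambda>y. dilate \<phi> j (x - y)) x (2 powi (- j)) (S / (2 powi (- j)) ^ CARD('n))"
proof -
  define c where "c = (2 :: real) powi (- j)"
  have c: "0 < c" by (simp add: c_def)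
  have c2: "(2 :: real) powi j = 1 / c" by (simp add: c_def power_int_minus field_simps)
  have nrm: "cmod (dilate \<phi> j z) = cmod (\<phi> ((1 / c) *\<^sub>R z)) / c ^ CARD('n)" for z
  proof -
    have "cmod (2 powi (j * int CARD('n))) = (2 powi j) ^ CARD('n)"
      by (simp add: norm_power_int norm_power power_int_mult)
    then show ?thesis unfolding dilate_def norm_mult c2 by (simp add: power_one_over field_simps)
  qed
  have "cmod (dilate \<phi> j (x - y)) \<le> S / c ^ CARD('n)" for y
    unfolding nrm using \<phi> c unfolding decays_def by (intro divide_right_mono) auto
  moreover have "cmod (dilate \<phi> j (x - y)) * (\<bar>y $ i - x $ i\<bar> / c) ^ Suc (2 * CARD('n)) \<le> S / c ^ CARD('n)" for y i
  proof -
    let ?z = "(1 / c) *\<^sub>R (x - y)"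
    have "\<bar>?z $ i - 0 $ i\<bar> / 1 = \<bar>y $ i - x $ i\<bar> / c"
      using c by (simp add: abs_mult abs_minus_commute)
    then have "cmod (\<phi> ?z) * (\<bar>y $ i - x $ i\<bar> / c) ^ Suc (2 * CARD('n)) \<le> S"
      using \<phi> unfolding decays_def by metis
    then have "(cmod (\<phi> ?z) * (\<bar>y $ i - x $ i\<bar> / c) ^ Suc (2 * CARD('n))) / c ^ CARD('n) \<le> S / c ^ CARD('n)"
      using c by (intro divide_right_mono) auto
    then show ?thesis unfolding nrm by (simp only: times_divide_eq_left)
  qed
  ultimately show ?thesis unfolding decays_def c_def by blast
qed

section \<open>The distribution defined by f and its norm\<close>

context Ap_setting
begin

lemma schwartz_has_weak_integral:
  assumes "f \<in> wLp_space p V" "\<psi> \<in> schwartz"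
  shows "has_weak_integral V f \<psi> (weak_pairing V f \<psi>)"
  by (rule has_weak_integral_pairing[OF assms(1) decays_decay_norm[OF schwartz_bounded[OF assms(2)]]])
    (simp_all add: continuous_lebesgue_measurable schwartz_continuous[OF assms(2)])

lemma weak_pairing_continuous:
  assumes f: "f \<in> wLp_space p V"
  shows "continuous_map (subtopology schwartz_topology schwartz0) euclidean (weak_pairing V f)"
  unfolding continuous_map_def
proof (intro conjI allI impI)
  let ?F = "weak_pairing V f" and ?T = "subtopology schwartz_topology schwartz0 :: (real^'n \<Rightarrow> complex) topology"
  show "?F \<in> topspace ?T \<rightarrow> topspace euclidean" by simp
  fix U :: "'a set" assume "openin euclidean U"
  then have U: "open U" by simp
  let ?n = "CARD('n)" and ?M = "Suc (2 * CARD('n))"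
  obtain D where D: "0 \<le> D" "\<And>\<Phi> S v. decays \<Phi> (0 :: real^'n) 1 S \<Longrightarrow> has_weak_integral V f \<Phi> v \<Longrightarrow> norm v \<le> S * D"
    by (rule weak_integral_norm_le[OF f zero_less_one, of 0]) blast
  have "\<exists>W. openin ?T W \<and> \<phi> \<in> W \<and> W \<subseteq> {x \<in> topspace ?T. ?F x \<in> U}" if \<phi>: "\<phi> \<in> schwartz0" "?F \<phi> \<in> U" for \<phi>
  proof -
    obtain \<epsilon> where \<epsilon>: "0 < \<epsilon>" "ball (?F \<phi>) \<epsilon> \<subseteq> U" using U \<phi>(2) by (meson open_contains_ball)
    \<comment> \<open>\<open>decay_norm\<close> is a sum of \<open>CARD('n) + 1\<close> seminorms;
      \<open>D + 1\<close> keeps the denominator positive and makes the final inequality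
      strict.\<close>
    define \<eta> where "\<eta> = \<epsilon> / ((real ?n + 1) * (D + 1))"
    have \<eta>: "0 < \<eta>" using \<epsilon> D(1) by (simp add: \<eta>_def add_nonneg_pos)
    define A where "A = insert (\<lambda>_. 0) (range (single_power ?M :: 'n \<Rightarrow> _))"
    define W where "W = (\<Inter>\<alpha>\<in>A. {\<psi> \<in> schwartz. schwartz_seminorm \<alpha> [] (\<lambda>x. \<psi> x - \<phi> x) < \<eta>})"
    have \<phi>S: "\<phi> \<in> schwartz" using \<phi>(1) by (simp add: schwartz0_def)
    have "openin schwartz_topology W"
      unfolding W_def by (intro openin_INT2 open_schwartz_ball \<phi>S \<eta>) (auto simp: A_def)
    then have "openin ?T (schwartz0 \<inter> W)" by (rule openin_subtopology_Int2)
    moreover have "\<phi> \<in> schwartz0 \<inter> W"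
      using \<phi> \<phi>S \<eta> by (auto simp: W_def schwartz_seminorm_zero)
    moreover have "?F \<psi> \<in> U" if \<psi>: "\<psi> \<in> schwartz0" "\<psi> \<in> W" for \<psi>
    proof -
      have \<psi>S: "\<psi> \<in> schwartz" using \<psi>(1) by (simp add: schwartz0_def)
      let ?d = "\<lambda>x. \<psi> x - \<phi> x"
      have "has_weak_integral V f (\<lambda>x. \<psi> x + (- 1) * \<phi> x) (?F \<psi> + (- 1) *\<^sub>C ?F \<phi>)"
        by (intro has_weak_integral_add has_weak_integral_scaleC schwartz_has_weak_integral f \<psi>S \<phi>S)
      moreover have "(- 1) *\<^sub>C ?F \<phi> = - ?F \<phi>" using scaleC_of_real[of "- 1" "?F \<phi>"] by simp
      ultimately have hw: "has_weak_integral V f ?d (?F \<psi> - ?F \<phi>)" by simp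
      have dec: "decays ?d 0 1 (decay_norm ?d)"
        by (intro decays_decay_norm bounded_minus_monomial schwartz_bounded \<psi>S \<phi>S)
      have small: "schwartz_seminorm \<alpha> [] ?d < \<eta>" if "\<alpha> \<in> A" for \<alpha> using \<psi>(2) that by (auto simp: W_def)
      have "decay_norm ?d \<le> \<eta> + (\<Sum>i\<in>(UNIV :: 'n set). \<eta>)"
        unfolding decay_norm_def by (intro add_mono sum_mono less_imp_le small) (auto simp: A_def)
      then have dn: "decay_norm ?d \<le> (real ?n + 1) * \<eta>" by (simp add: algebra_simps)
      have "norm (?F \<psi> - ?F \<phi>) \<le> decay_norm ?d * D" by (rule D(2)[OF dec hw])
      also have "\<dots> \<le> (real ?n + 1) * \<eta> * D" using dn D(1) by (intro mult_right_mono)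
      also have "\<dots> < (real ?n + 1) * \<eta> * (D + 1)" using \<eta> by (intro mult_strict_left_mono) auto
      also have "\<dots> = \<epsilon>"
      proof -
        have "real ?n + 1 \<noteq> 0" "D + 1 \<noteq> 0" using D(1) by linarith+
        then show ?thesis by (simp add: \<eta>_def)
      qed
      finally show ?thesis using \<epsilon>(2) by (auto simp: dist_norm norm_minus_commute subset_iff)
    qed
    ultimately show ?thesis unfolding topspace_schwartz0 by blast
  qed
  then show "openin ?T {x \<in> topspace ?T. ?F x \<in> U}"
    by (subst openin_subopen) (auto simp: topspace_schwartz0)
qed

lemma weak_pairing_distributions0:
  assumes f: "f \<in> wLp_space p V"
  shows "weak_pairing V f \<in> distributions0"
proof -
  have hw: "has_weak_integral V f \<psi> (weak_pairing V f \<psi>)" if "\<psi> \<in> schwartz0" for \<psi>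
    using that by (intro schwartz_has_weak_integral f) (simp add: schwartz0_def)
  show ?thesis
    unfolding distributions0_def
    using weak_pairing_continuous[OF f] hw
    by (auto intro!: weak_pairing_eq has_weak_integral_add has_weak_integral_scaleC)
qed

text \<open>Hahn--Banach provides a functional that is dominated by the seminorm and attains it at
  \<open>v\<close>; domination is \<open>functional_bound\<close> with constant 1. Its continuity
  comes from \<open>rho_bounded\<close>.\<close>

lemma rho_le_functionals:
  assumes l: "0 < l" and le: "\<And>e' :: 'a cdual. functional_bound e' 1 a l \<Longrightarrow> ennreal (cmod (cblinfun_apply e' v)) \<le> B"
  shows "rho V p a l v \<le> B"
proof -
  obtain K where K: "0 \<le> K" "\<And>e. rho V p a l e \<le> ennreal (K * norm e)"
    using rho_bounded[OF p l V] by metis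
  define \<rho> where "\<rho> e = enn2real (rho V p a l e)" for e
  have \<rho>: "rho V p a l e = ennreal (\<rho> e)" "0 \<le> \<rho> e" for e
    using rho_finite[OF V l, of a e] by (simp_all add: \<rho>_def)
  obtain \<phi> :: "'a cdual" where \<phi>: "cblinfun_apply \<phi> v = of_real (\<rho> v)" "\<And>x. cmod (cblinfun_apply \<phi> x) \<le> \<rho> x"
  proof (rule Hahn_Banach_seminorm[of \<rho> K v])
    show "\<rho> (x + y) \<le> \<rho> x + \<rho> y" for x y
      using rho_add[OF p l V, of a x y] unfolding \<rho>(1) using \<rho>(2) by (simp flip: ennreal_plus)
    show "\<rho> (c *\<^sub>C x) = cmod c * \<rho> x" for c x
      using rho_scaleC[OF _ l V, of a c x] p unfolding \<rho>(1) using \<rho>(2) by (simp flip: ennreal_mult)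
    show "\<rho> x \<le> K * norm x" for x
      using K(2)[of x] K(1) unfolding \<rho>(1) by (subst (asm) ennreal_le_iff) auto
  qed blast
  have "functional_bound \<phi> 1 a l"
    unfolding functional_bound_def \<rho>(1) using \<phi>(2) by (simp add: ennreal_leI)
  from le[OF this] show ?thesis unfolding \<rho>(1) \<phi>(1) using \<rho>(2)[of v] by simp
qed

lemma rho_exponent_le:
  assumes "0 < r" "r \<le> p" "0 < l"
  shows "rho V r a l e \<le> rho V p a l e"
  unfolding rho_def using assms by (intro cube_avg_power_le) auto

text \<open>At each point the dyadic terms of all generations have the same majorant, the maximal
  function of \<open>h\<close> to the power \<open>1 / q\<close>. Its \<open>p\<close>-th power is
  the maximal function to the power \<open>p / q > 1\<close>, where the strong type bound
  applies.\<close>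

lemma F0_norm_bound:
  assumes r: "0 < r" "r \<le> p" and \<phi>: "\<phi> \<in> schwartz"
  shows "\<exists>K>0. \<forall>f\<in>wLp_space p V. F0_norm \<phi> p r V (weak_pairing V f) \<le> ennreal K * wLp_norm p V f"
proof -
  let ?n = "CARD('n)"
  define S where "S = decay_norm \<phi>"
  have \<phi>d: "decays \<phi> 0 1 S" unfolding S_def by (rule decays_decay_norm[OF schwartz_bounded[OF \<phi>]])
  then have S: "0 \<le> S" unfolding decays_def by (meson norm_ge_zero order_trans)
  obtain q K :: real where q: "1 < q" "q < p" and K: "0 \<le> K" and
    max: "\<And>\<Phi> S (e' :: 'a cdual) (g :: real^'n \<Rightarrow> real) h x a l T.
      g \<in> borel_measurable lebesgue \<Longrightarrow> (\<And>x. 0 \<le> g x) \<Longrightarrow> h \<in> borel_measurable borel \<Longrightarrow>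
      AE y in lebesgue. ennpowr (ennreal (g y)) q = h y \<Longrightarrow> decays \<Phi> x l S \<Longrightarrow> 0 < l \<Longrightarrow> x \<in> cube a l \<Longrightarrow>
      functional_bound e' T a l \<Longrightarrow>
      (\<integral>\<^sup>+y. ennreal (cmod (\<Phi> y)) * (ennreal (dnorm e' y) * ennreal (g y)) \<partial>lebesgue) \<le>
        ennreal (S * K * l ^ CARD('n)) * T * ennpowr (hl_max h x) (1 / q)"
    by (rule maximal_bound) blast
  have pq: "1 < p / q" using q by simp
  obtain C0 where C0: "0 \<le> C0" "\<And>h :: real^'n \<Rightarrow> ennreal. h \<in> borel_measurable borel \<Longrightarrow>
    (\<integral>\<^sup>+x. ennpowr (hl_max h x) (p / q) \<partial>lborel) \<le> ennreal C0 * (\<integral>\<^sup>+x. ennpowr (h x) (p / q) \<partial>lborel)"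
    by (rule hl_max_strong_type[OF pq]) blast
  define K' where "K' = S * K * C0 powr (1 / p)"
  have K': "0 \<le> K'" using S K by (simp add: K'_def)
  have "F0_norm \<phi> p r V (weak_pairing V f) \<le> ennreal K' * wLp_norm p V f" if f: "f \<in> wLp_space p V" for f
  proof -
    have nV0: "0 \<le> nV f y" for y by (simp add: nV_def)
    have nVm [measurable]: "nV f \<in> borel_measurable lebesgue"
      using f by (intro nV_measurable) (simp add: wLp_space_def)
    have "(\<lambda>y. ennpowr (ennreal (nV f y)) q) \<in> borel_measurable lebesgue" by measurable
    \<comment> \<open>The maximal theorem is formulated for Borel functions, whereas
      \<open>nV f\<close> is only Lebesgue measurable.\<close>
    then obtain h where h: "h \<in> borel_measurable lborel" and ae: "AE y in lborel. ennpowr (ennreal (nV f y)) q = h y"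
      using completion_ex_borel_measurable by blast
    have hb [measurable]: "h \<in> borel_measurable borel" using h by simp
    have ae': "AE y in lebesgue. ennpowr (ennreal (nV f y)) q = h y" using ae by (rule AE_completion)
    have pointwise: "(\<Sum>\<^sub>\<infinity>Q\<in>dyadic_cubes j. indicator Q x * avg_norm V r Q (dist_conv (dilate \<phi> j) (weak_pairing V f) x))
      \<le> ennreal (S * K) * ennpowr (hl_max h x) (1 / q)" for j :: int and x
    proof (rule infsum_indicator_disjoint[OF dyadic_cubes_unique])
      fix Q assume Q: "Q \<in> dyadic_cubes j" "x \<in> Q"
      define l where "l = (2 :: real) powi (- j)"
      have l: "0 < l" by (simp add: l_def)
      obtain k where k: "Q = cube (l *\<^sub>R k) l" using dyadic_cubes_cube[OF Q(1)] unfolding l_def by blast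
      let ?\<Phi> = "\<lambda>y. dilate \<phi> j (x - y)"
      have \<Phi>: "decays ?\<Phi> x l (S / l ^ ?n)" unfolding l_def by (rule decays_dilate[OF \<phi>d])
      have "continuous_on UNIV ?\<Phi>"
        unfolding dilate_def
        by (intro continuous_intros continuous_on_compose2[OF schwartz_continuous[OF \<phi>]]) auto
      then have "?\<Phi> \<in> borel_measurable lebesgue" by (rule continuous_lebesgue_measurable)
      then have hw: "has_weak_integral V f ?\<Phi> (weak_pairing V f ?\<Phi>)"
        by (rule has_weak_integral_pairing[OF f \<Phi> l])
      have "avg_norm V r Q (weak_pairing V f ?\<Phi>) \<le> rho V p (l *\<^sub>R k) l (weak_pairing V f ?\<Phi>)"
        unfolding k avg_norm_cube[OF l] by (rule rho_exponent_le[OF r l])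
      also have "\<dots> \<le> ennreal (S * K) * ennpowr (hl_max h x) (1 / q)"
      proof (rule rho_le_functionals[OF l])
        fix e' :: "'a cdual" assume e': "functional_bound e' 1 (l *\<^sub>R k) l"
        have "ennreal (cmod (cblinfun_apply e' (weak_pairing V f ?\<Phi>))) \<le>
          (\<integral>\<^sup>+y. ennreal (cmod (?\<Phi> y)) * (ennreal (dnorm e' y) * ennreal (nV f y)) \<partial>lebesgue)"
          by (rule weak_integral_le[OF hw])
        also have "\<dots> \<le> ennreal (S / l ^ ?n * K * l ^ ?n) * 1 * ennpowr (hl_max h x) (1 / q)"
          by (rule max[OF nVm nV0 hb ae' \<Phi> l Q(2)[unfolded k] e'])
        \<comment> \<open>The height of the dilated kernel and the volume factor of
          \<open>maximal_bound\<close> cancel, which makes the bound independent of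
          \<open>j\<close>.\<close>
        also have "S / l ^ ?n * K * l ^ ?n = S * K" using l by simp
        finally show "ennreal (cmod (cblinfun_apply e' (weak_pairing V f ?\<Phi>))) \<le>
          ennreal (S * K) * ennpowr (hl_max h x) (1 / q)" by simp
      qed
      finally show "avg_norm V r Q (dist_conv (dilate \<phi> j) (weak_pairing V f) x) \<le>
        ennreal (S * K) * ennpowr (hl_max h x) (1 / q)"
        by (simp add: dist_conv_def)
    qed
    have "(\<integral>\<^sup>+x. ennpowr (ennreal (S * K) * ennpowr (hl_max h x) (1 / q)) p \<partial>lebesgue) =
      ennpowr (ennreal (S * K)) p * (\<integral>\<^sup>+x. ennpowr (hl_max h x) (p / q) \<partial>lborel)"
      by (simp add: nn_integral_completion ennpowr_mult ennpowr_ennpowr nn_integral_cmult)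
    also have "\<dots> \<le> ennpowr (ennreal (S * K)) p * (ennreal C0 * (\<integral>\<^sup>+x. ennpowr (h x) (p / q) \<partial>lborel))"
      by (intro mult_left_mono C0 hb) auto
    also have "(\<integral>\<^sup>+x. ennpowr (h x) (p / q) \<partial>lborel) = (\<integral>\<^sup>+x. ennpowr (ennreal (nV f x)) p \<partial>lborel)"
    proof (rule nn_integral_cong_AE)
      show "AE x in lborel. ennpowr (h x) (p / q) = ennpowr (ennreal (nV f x)) p"
        using ae
      proof eventually_elim
        case (elim x)
        have "ennpowr (h x) (p / q) = ennpowr (ennpowr (ennreal (nV f x)) q) (p / q)" by (simp only: elim)
        then show ?case using q by (simp add: ennpowr_ennpowr)
      qed
    qed
    finally have int: "(\<integral>\<^sup>+x. ennpowr (ennreal (S * K) * ennpowr (hl_max h x) (1 / q)) p \<partial>lebesgue) \<le>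
      ennpowr (ennreal (S * K)) p * (ennreal C0 * (\<integral>\<^sup>+x. ennpowr (ennreal (nV f x)) p \<partial>lborel))" .
    have "F0_norm \<phi> p r V (weak_pairing V f) \<le>
      ennpowr (\<integral>\<^sup>+x. ennpowr (ennreal (S * K) * ennpowr (hl_max h x) (1 / q)) p \<partial>lebesgue) (1 / p)"
      unfolding F0_norm_def Lp_norm_def using p pointwise
      by (intro ennpowr_mono nn_integral_mono SUP_least) auto
    also have "\<dots> \<le> ennpowr (ennpowr (ennreal (S * K)) p * (ennreal C0 * (\<integral>\<^sup>+x. ennpowr (ennreal (nV f x)) p \<partial>lborel))) (1 / p)"
      using p by (intro ennpowr_mono int) auto
    also have "\<dots> = ennreal K' * wLp_norm p V f"
      unfolding wLp_norm_def Lp_norm_def nV_def[symmetric] nn_integral_completion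
      using p S K C0(1) by (simp add: ennpowr_mult ennpowr_ennpowr ennpowr_ennreal K'_def ennreal_mult powr_powr mult.assoc)
    finally show ?thesis .
  qed
  \<comment> \<open>\<open>K'\<close> may be 0, whereas the constant is required to be
    positive.\<close>
  then have "F0_norm \<phi> p r V (weak_pairing V f) \<le> ennreal (K' + 1) * wLp_norm p V f" if "f \<in> wLp_space p V" for f
    using that K' by (meson ennreal_leI less_add_one less_imp_le mult_right_mono order_trans zero_le)
  then show ?thesis using K' by (intro exI[of _ "K' + 1"]) auto
qed

end

theorem proposition16p2:
  fixes V :: "real^'n \<Rightarrow> ('a::complex_banach \<Rightarrow>\<^sub>C\<^sub>L 'a)"
    and \<phi> :: "real^'n \<Rightarrow> complex"
    and p r :: real
  assumes "1 < p" and "0 < r" and "r \<le> p"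
    and "Ap_weight p V"
    and "littlewood_paley \<phi>"
  shows "\<exists>C::real. C > 0 \<and> (\<forall>f \<in> wLp_space p V.
    (\<forall>\<psi> \<in> schwartz0. has_weak_integral V f \<psi> (weak_pairing V f \<psi>)) \<and>
    weak_pairing V f \<in> F0_space \<phi> p r V \<and>
    F0_norm \<phi> p r V (weak_pairing V f) \<le> ennreal C * wLp_norm p V f)"
proof -
  obtain C0 :: real where pw: "p_weight p V" "p_weight (p / (p - 1)) (dual_weight V)"
    and C0: "\<And>Q e'. is_cube Q \<Longrightarrow> avg_norm (dual_weight V) (p / (p - 1)) Q e' \<le> ennreal C0 * dual_norm (avg_norm V p Q) e'"
    using assms(4) unfolding Ap_weight_def Let_def by blast
  \<comment> \<open>Raising the A_p constant to at least 1 gives \<open>Ainfty_const > 1\<close>, so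
    that \<open>1 - 1 / Ainfty_const\<close> is nonnegative.\<close>
  interpret Ap_setting V p "p / (p - 1)" "max 1 C0"
  proof
    fix Q :: "(real^'n) set" and e' :: "'a cdual" assume "is_cube Q"
    then have "avg_norm (dual_weight V) (p / (p - 1)) Q e' \<le> ennreal C0 * dual_norm (avg_norm V p Q) e'"
      by (rule C0)
    also have "\<dots> \<le> ennreal (max 1 C0) * dual_norm (avg_norm V p Q) e'"
      by (intro mult_right_mono ennreal_leI) auto
    finally show "avg_norm (dual_weight V) (p / (p - 1)) Q e' \<le> ennreal (max 1 C0) * dual_norm (avg_norm V p Q) e'" .
  qed (use assms pw in auto)
  have \<phi>: "\<phi> \<in> schwartz" using assms(5) by (simp add: littlewood_paley_def)
  obtain K where K: "0 < K" "\<And>f. f \<in> wLp_space p V \<Longrightarrow> F0_norm \<phi> p r V (weak_pairing V f) \<le> ennreal K * wLp_norm p V f"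
    using F0_norm_bound[OF assms(2,3) \<phi>] by blast
  have "has_weak_integral V f \<psi> (weak_pairing V f \<psi>)" if "f \<in> wLp_space p V" "\<psi> \<in> schwartz0" for f \<psi>
    using that by (intro schwartz_has_weak_integral) (auto simp: schwartz0_def)
  moreover have "weak_pairing V f \<in> F0_space \<phi> p r V" if f: "f \<in> wLp_space p V" for f
  proof -
    have "wLp_norm p V f < \<infinity>" using f by (simp add: wLp_space_def)
    then have "ennreal K * wLp_norm p V f < \<infinity>" by (simp add: ennreal_mult_less_top)
    then show ?thesis
      using weak_pairing_distributions0[OF f] K(2)[OF f] by (auto simp: F0_space_def intro: le_less_trans)
  qed
  ultimately show ?thesis using K by blast
qed

end
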